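(* If $X_K$ is a smooth dimensionally transverse linear section of $X$ of codimension $4=\dim K$, then $R_K\neq\mathrm{Gr}(2,K)$. Moreover, if $X_K$ is general, there are no very special over-sections $X_{K_3}\subset X$ of codimension 3 (that is, there is no 3-dimensional subspace $K_3\subset K$ for which $X_{K_3}$ is very special).
   Context: The base field is algebraically closed of characteristic zero. $V$ is a 10-dimensional vector space with a nondegenerate quadratic form; $\mathrm{OGr}_\pm(5,V)$ are the two connected components of the Grassmannian of isotropic 5-dimensional subspaces; $\mathbb{S}$, $\mathbb{S}^\vee$ are the two (mutually dual, 16-dimensional) half-spinor representations of $\mathrm{Spin}(V)$. $X=\mathrm{OGr}_+(5,V)\subset\mathbb{P}(\mathbb{S})$ and its projective dual $X^\vee=\mathrm{OGr}_-(5,V)\subset\mathbb{P}(\mathbb{S}^\vee)$ are embedded by the ample generators of their Picard groups. For $K\subset\mathbb{S}^\vee$ with annihilator $K^\perp\subset\mathbb{S}$, $X_K=X\times_{\mathbb{P}(\mathbb{S})}\mathbb{P}(K^\perp)$; for $\dim K\le5$ it is smooth and dimensionally transverse ($\dim X_K=10-\dim K$) iff $\mathbb{P}(K)\cap X^\vee=\varnothing$. $F_4(X_K)$ is the Hilbert scheme of linear 4-spaces on $X_K$. A smooth codimension-2 section $X_K$ is called special if $F_4(X_K)\ne\varnothing$; a smooth codimension-3 section $X_K$ is called very special if $F_4(X_K)\neq\varnothing$. The spinor quadratic line complex $R\subset\mathrm{Gr}(2,\mathbb{S}^\vee)$ is the closure of the set of $[K_2]$ with $\mathbb{P}(K_2)\cap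 X^\vee=\varnothing$ and $X_{K_2}$ special; $R_K:=R\cap\mathrm{Gr}(2,K)$. An over-section of $X_K$ is a section $X_{K'}$ with $K'\subset K$. "General" means for $K$ in a nonempty Zariski open subset of $\mathrm{Gr}(4,\mathbb{S}^\vee)$. *)

theory Defs
  imports
    "HOL-Analysis.Abstract_Topology"
    "HOL-Computational_Algebra.Polynomial"
    "Jordan_Normal_Form.Determinant"
begin

section \<open>Krull dimension of a topological space\<close>

definition irreducible_in :: "'a topology \<Rightarrow> 'a set \<Rightarrow> bool" where
  "irreducible_in T Z \<longleftrightarrow> Z \<noteq> {} \<and> Z \<subseteq> topspace T \<and>
     (\<forall>C D. closedin T C \<and> closedin T D \<and> Z \<subseteq> C \<union> D \<longrightarrow> Z \<subseteq> C \<or> Z \<subseteq> D)"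

definition closed_chain :: "'a topology \<Rightarrow> nat \<Rightarrow> (nat \<Rightarrow> 'a set) \<Rightarrow> bool" where
  "closed_chain T n Z \<longleftrightarrow>
     (\<forall>i\<le>n. closedin T (Z i) \<and> irreducible_in T (Z i)) \<and> (\<forall>i<n. Z i \<subset> Z (Suc i))"

text \<open>The empty space has no Krull dimension in this sense.\<close>

definition has_krull_dim :: "'a topology \<Rightarrow> nat \<Rightarrow> bool" where
  "has_krull_dim T n \<longleftrightarrow> (\<exists>Z. closed_chain T n Z) \<and> \<not> (\<exists>Z. closed_chain T (Suc n) Z)"

text \<open>For a projective variety over an algebraically closed field, with its space of closed points,
  this is the Krull dimension of the local ring at \<open>x\<close>, i.e. the largest dimension of a
  component through \<open>x\<close>.\<close>

definition has_local_dim :: "'a topology \<Rightarrow> 'a \<Rightarrow> nat \<Rightarrow> bool" where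
  "has_local_dim T x n \<longleftrightarrow> (\<exists>Z. closed_chain T n Z \<and> x \<in> Z 0) \<and>
     \<not> (\<exists>Z. closed_chain T (Suc n) Z \<and> x \<in> Z 0)"


section \<open>Grassmannians, projective spaces and their Zariski topology\<close>

text \<open>A new locale, since definitions in \<open>vector_space\<close> would be interpreted globally for
  real vector spaces.\<close>

locale vector_space_geometry = vector_space scale
  for scale :: "'a::field \<Rightarrow> 'b::ab_group_add \<Rightarrow> 'b"
begin

definition Gr :: "nat \<Rightarrow> 'b set set" where
  "Gr k = {U. local.subspace U \<and> local.dim U = k}"

definition Gr_in :: "nat \<Rightarrow> 'b set \<Rightarrow> 'b set set" where
  "Gr_in k W = {U \<in> Gr k. U \<subseteq> W}"

text \<open>Homogeneous polynomials of degree \<open>d\<close> in the Pluecker coordinates, as functions of a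
  \<open>k\<close>-tuple \<open>w 0, \<dots>, w (k - 1)\<close> spanning the subspace. A change of
  spanning tuple multiplies such a function by the \<open>d\<close>-th power of a nonzero determinant. For
  \<open>k = 1\<close> these are the homogeneous polynomials of degree \<open>d\<close> on the vector space itself,
  evaluated at \<open>w 0\<close>.\<close>

inductive pluecker_form :: "nat \<Rightarrow> nat \<Rightarrow> ((nat \<Rightarrow> 'b) \<Rightarrow> 'a) \<Rightarrow> bool" for k :: nat where
  const: "pluecker_form k 0 (\<lambda>_. c)"
| minor: "(\<And>i. i < k \<Longrightarrow> Vector_Spaces.linear scale (*) (l i)) \<Longrightarrow>
    pluecker_form k 1 (\<lambda>w. det (mat k k (\<lambda>(i, j). l i (w j))))"
| add: "pluecker_form k d f \<Longrightarrow> pluecker_form k d g \<Longrightarrow> pluecker_form k d (\<lambda>w. f w + g w)"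
| mult: "pluecker_form k d f \<Longrightarrow> pluecker_form k e g \<Longrightarrow> pluecker_form k (d + e) (\<lambda>w. f w * g w)"

text \<open>The topology on \<open>Gr k\<close> whose basic open sets are the nonvanishing loci of homogeneous
  polynomials in the Pluecker coordinates.\<close>

definition zariski :: "nat \<Rightarrow> 'b set topology" where
  "zariski k = topology_generated_by
     {{U \<in> Gr k. \<forall>w. local.span (w ` {..<k}) = U \<longrightarrow> f w \<noteq> 0} | f. \<exists>d. pluecker_form k d f}"

text \<open>Projective space is \<open>Gr 1\<close>. For a set \<open>Y\<close> of lines and \<open>L \<in> Y\<close> this is the
  tangent space at a nonzero \<open>x \<in> L\<close> of the affine cone of \<open>Y\<close> defined by the full
  homogeneous ideal of \<open>Y\<close>; the Zariski tangent space of \<open>Y\<close> at \<open>L\<close> is its quotient by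
  \<open>L\<close>. The differential of \<open>f\<close> at \<open>x\<close> in the direction \<open>t\<close> is the linear
  coefficient of the polynomial \<open>f (x + c t)\<close> in \<open>c\<close>.\<close>

definition cone_tangent :: "'b set set \<Rightarrow> 'b set \<Rightarrow> 'b set" where
  "cone_tangent Y L = {t. \<forall>f d x.
     pluecker_form 1 d f \<and> (\<forall>y. local.span {y} \<in> Y \<longrightarrow> f (\<lambda>_. y) = 0) \<and> local.span {x} = L \<longrightarrow>
     (\<exists>p. (\<forall>c. poly p c = f (\<lambda>_. x + scale c t)) \<and> coeff p 1 = 0)}"

end


section \<open>Half-spinor representations and the spinor tenfold\<close>

definition bilinear_map ::
  "('k::field \<Rightarrow> 'a::ab_group_add \<Rightarrow> 'a) \<Rightarrow> ('k \<Rightarrow> 'b::ab_group_add \<Rightarrow> 'b) \<Rightarrow>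
   ('k \<Rightarrow> 'c::ab_group_add \<Rightarrow> 'c) \<Rightarrow> ('a \<Rightarrow> 'b \<Rightarrow> 'c) \<Rightarrow> bool" where
  "bilinear_map s1 s2 s3 f \<longleftrightarrow>
     (\<forall>x. Vector_Spaces.linear s2 s3 (f x)) \<and> (\<forall>y. Vector_Spaces.linear s1 s3 (\<lambda>x. f x y))"

text \<open>\<open>V\<close> (type \<open>'v\<close>) is a quadratic space of dimension 10. The half-spinor
  representations \<open>S\<close> and \<open>S'\<close> (the latter in the role of the dual of \<open>S\<close>) are the two
  graded pieces of the \<open>\<int>/2\<close>-graded spinor module \<open>S \<oplus> S'\<close>, i.e. of the graded module of
  dimension 32 over the Clifford algebra of \<open>V\<close>: a vector \<open>v\<close> acts by the Clifford
  multiplications \<open>cl v : S \<rightarrow> S'\<close> and \<open>cl' v : S' \<rightarrow> S\<close>, with square \<open>q v\<close>. Since the Clifford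
  algebra is a matrix algebra of size 32, these data are unique up to isomorphism and exchange
  of \<open>S\<close> and \<open>S'\<close>. The group \<open>Spin(V)\<close> is generated by the products
  \<open>v w\<close> with \<open>q v = q w = 1\<close>, which act on \<open>S\<close> by \<open>cl' v \<circ> cl w\<close> and on \<open>S'\<close> by
  \<open>cl v \<circ> cl' w\<close>; so \<open>pairing\<close> is a \<open>Spin(V)\<close>-invariant perfect pairing of
  \<open>S\<close> and \<open>S'\<close>, which is unique up to a scalar.\<close>

locale half_spinors =
  V: vector_space_geometry sV + S: vector_space_geometry sS + S': vector_space_geometry sS'
  for sV :: "'k::{alg_closed_field, field_char_0} \<Rightarrow> 'v::ab_group_add \<Rightarrow> 'v"
    and sS :: "'k \<Rightarrow> 's::ab_group_add \<Rightarrow> 's"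
    and sS' :: "'k \<Rightarrow> 't::ab_group_add \<Rightarrow> 't" +
  fixes q :: "'v \<Rightarrow> 'k"
    and cl :: "'v \<Rightarrow> 's \<Rightarrow> 't"
    and cl' :: "'v \<Rightarrow> 't \<Rightarrow> 's"
    and pairing :: "'s \<Rightarrow> 't \<Rightarrow> 'k"
  assumes dim_V: "V.dim UNIV = 10"
    and q_scale: "q (sV c v) = c\<^sup>2 * q v"
    and q_polar: "bilinear_map sV sV (*) (\<lambda>v w. q (v + w) - q v - q w)"
    and q_nondegenerate: "(\<And>w. q (v + w) - q v - q w = 0) \<Longrightarrow> v = 0"
    and dim_S: "S.dim UNIV = 16"
    and dim_S': "S'.dim UNIV = 16"
    and cl_bilinear: "bilinear_map sV sS sS' cl"
    and cl'_bilinear: "bilinear_map sV sS' sS cl'"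
    and clifford: "cl' v (cl v s) = sS (q v) s"
    and clifford': "cl v (cl' v t) = sS' (q v) t"
    and pairing_bilinear: "bilinear_map sS sS' (*) pairing"
    and pairing_nondegenerate: "(\<And>t. pairing s t = 0) \<Longrightarrow> s = 0"
    and pairing_nondegenerate': "(\<And>s. pairing s t = 0) \<Longrightarrow> t = 0"
    and pairing_invariant:
      "q v = 1 \<Longrightarrow> q w = 1 \<Longrightarrow> pairing (cl' v (cl w s)) (cl v (cl' w t)) = pairing s t"
begin

definition OGr :: "'v set set" where
  "OGr = {U \<in> V.Gr 5. \<forall>u\<in>U. q u = 0}"

text \<open>The spinors annihilated by a maximal isotropic subspace \<open>U\<close> form a line in \<open>S \<oplus> S'\<close>,
  contained either in \<open>S\<close> or in \<open>S'\<close>; this distinguishes the two connected components of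
  \<open>OGr\<close>. Mapping \<open>U\<close> to this line is the embedding of each component by the ample
  generator of its Picard group.\<close>

definition pure_line :: "'v set \<Rightarrow> 's set" where
  "pure_line U = {s. \<forall>u\<in>U. cl u s = 0}"

definition pure_line' :: "'v set \<Rightarrow> 't set" where
  "pure_line' U = {t. \<forall>u\<in>U. cl' u t = 0}"

definition OGr_plus :: "'v set set" where
  "OGr_plus = {U \<in> OGr. pure_line U \<noteq> {0}}"

definition OGr_minus :: "'v set set" where
  "OGr_minus = {U \<in> OGr. pure_line' U \<noteq> {0}}"

definition X :: "'s set set" where
  "X = pure_line ` OGr_plus"

definition X_dual :: "'t set set" where
  "X_dual = pure_line' ` OGr_minus"

definition annihilator :: "'t set \<Rightarrow> 's set" where
  "annihilator K = {s. \<forall>t\<in>K. pairing s t = 0}"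

definition X_sec :: "'t set \<Rightarrow> 's set set" where
  "X_sec K = {L \<in> X. L \<subseteq> annihilator K}"

text \<open>As a scheme, the linear section is the fibre product, so the tangent space of its affine cone
  is the intersection of that of \<open>X\<close> with the annihilator of \<open>K\<close>; it has one dimension more
  than the Zariski tangent space of the section.\<close>

definition smooth_sec :: "'t set \<Rightarrow> bool" where
  "smooth_sec K \<longleftrightarrow> (\<forall>L \<in> X_sec K. \<exists>n.
     has_local_dim (subtopology (S.zariski 1) (X_sec K)) L n \<and>
     S.dim (S.cone_tangent X L \<inter> annihilator K) = n + 1)"

definition dim_transverse :: "'t set \<Rightarrow> bool" where
  "dim_transverse K \<longleftrightarrow>
     has_krull_dim (subtopology (S.zariski 1) (X_sec K)) (10 - S'.dim K)"

text \<open>The closed points of the Hilbert scheme of linear 4-spaces on the section, each given by the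
  5-dimensional subspace \<open>M\<close> of \<open>S\<close> whose projectivization is the 4-space.\<close>

definition F4 :: "'t set \<Rightarrow> 's set set" where
  "F4 K = {M \<in> S.Gr 5. S.Gr_in 1 M \<subseteq> X_sec K}"

definition special :: "'t set \<Rightarrow> bool" where
  "special K \<longleftrightarrow> K \<in> S'.Gr 2 \<and> smooth_sec K \<and> dim_transverse K \<and> F4 K \<noteq> {}"

definition very_special :: "'t set \<Rightarrow> bool" where
  "very_special K \<longleftrightarrow> K \<in> S'.Gr 3 \<and> smooth_sec K \<and> dim_transverse K \<and> F4 K \<noteq> {}"

definition line_complex :: "'t set set" where
  "line_complex = S'.zariski 2 closure_of
     {K \<in> S'.Gr 2. S'.Gr_in 1 K \<inter> X_dual = {} \<and> special K}"

definition line_complex_of :: "'t set \<Rightarrow> 't set set" where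
  "line_complex_of K = line_complex \<inter> S'.Gr_in 2 K"

end

end

theory Submission
  imports Defs
begin

text \<open>Every spinor \<open>t\<close> in \<open>S'\<close> defines a vector \<open>Q t\<close> of \<open>V\<close>, quadratic in \<open>t\<close>, by
  \<open>polar v (Q t) = pairing (cl' v t) t\<close>. So \<open>V\<close> is a space of quadrics on \<open>S'\<close>, and these
  quadrics cut out the pure spinors, i.e. the cone over \<open>OGr_-(5, V)\<close> (\<open>annihilates_if_null\<close>).
  Both assertions are about the restriction of these quadrics to the equations \<open>K\<close> of a section.

  A linear 4-space on \<open>X\<close> has the form \<open>V t0\<close> for a pure spinor \<open>t0\<close> of \<open>S'\<close>
  (\<open>linear_family_in_X\<close>): at one of its points, the others are given by bivectors which are decomposable
  together with all their sums, and of the two maximal families of such bivectors, those with a common factor and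
  those in a common plane, only the first one is large enough. If \<open>K\<close> is orthogonal to \<open>V t0\<close>, then the
  five-dimensional space of quadrics belonging to the isotropic subspace of \<open>t0\<close> vanishes on \<open>K\<close>
  (\<open>linear_four_space_quadrics\<close>). In other words, \<open>Q K\<close> lies in a maximal isotropic subspace.

  First assertion. For a special \<open>K2\<close> all \<open>Q t\<close> with \<open>t\<close> in \<open>K2\<close> are mutually orthogonal.
  This is a closed condition on \<open>K2\<close> (\<open>closure_isotropic\<close>), so if \<open>R_K\<close> is all of \<open>Gr(2, K)\<close>, then
  \<open>Q K\<close> spans an isotropic subspace and is contained in a maximal isotropic \<open>U\<close>: the quadrics of
  \<open>U\<close> vanish on \<open>K\<close>. Then \<open>K\<close> contains a pure spinor (\<open>web_contains_pure\<close>). If the pure spinor of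
  \<open>U\<close> is in \<open>S\<close>, this follows from a 3-dimensional subspace of \<open>K\<close>, where the five
  remaining quadrics are few and explicit enough to have a common zero (\<open>net_contains_pure\<close>). If it is in \<open>S'\<close>,
  then one of the five remaining quadrics has corank at least two on \<open>K\<close> (\<open>corank_two_member\<close>), hence
  vanishes on a 3-dimensional subspace; reflecting \<open>U\<close> in the corresponding isotropic vector leads back to the
  first case. But a pure spinor in \<open>K\<close> is a hyperplane tangent to \<open>X\<close> along a 4-space, some point of
  which is on the other three hyperplanes, so that the section is singular there
  (\<open>singular_section\<close>).

  Second assertion. The space \<open>V\<close> and the space of quadrics on \<open>K\<close> both have dimension 10, and for a general
  \<open>K\<close> no nonzero vector of \<open>V\<close> vanishes on \<open>K\<close> as a quadric (\<open>generic_quadrics_injective\<close>). For a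
  very special \<open>K3\<close> inside \<open>K\<close>, however, a 5-dimensional space of quadrics vanishes on the hyperplane
  \<open>K3\<close>; vanishing on all of \<open>K\<close> is only four more linear conditions, a contradiction.

  The computations are made in a Fock space model: a hyperbolic basis \<open>e\<close>, \<open>f\<close> of \<open>V\<close> and a vacuum
  \<open>Om\<close> annihilated by \<open>e\<close> identify \<open>S\<close> with the even part of the exterior algebra of the span of \<open>f\<close>,
  in which the quadrics are explicit (\<open>quadric_f\<close>, \<open>quadric_e\<close>). Most results are proved for spinors
  in \<open>S\<close> and used for \<open>S'\<close> by exchanging the two half-spinor representations.\<close>

section \<open>Linear algebra in finite dimension\<close>

locale fin_vs = vector_space scale
  for scale :: "'a::field \<Rightarrow> 'b::ab_group_add \<Rightarrow> 'b" +
  assumes dim_pos: "dim UNIV > 0"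
begin

text \<open>Fixing a basis once makes all finite-dimensional vector spaces instances of
  \<open>finite_dimensional_vector_space\<close>, whose locale takes a basis as a parameter.\<close>

definition some_basis :: "'b set" where
  "some_basis = (SOME B. finite B \<and> independent B \<and> span B = UNIV)"

lemma some_basis: "finite some_basis \<and> independent some_basis \<and> span some_basis = UNIV"
proof -
  obtain B where B: "B \<subseteq> UNIV" "independent B" "UNIV \<subseteq> span B" "card B = dim UNIV"
    using basis_exists[of UNIV] by blast
  have "finite B" using B(4) dim_pos card.infinite by fastforce
  then have "\<exists>B. finite B \<and> independent B \<and> span B = UNIV"
    using B by (intro exI[of _ B]) blast
  then show ?thesis unfolding some_basis_def by (rule someI_ex)
qed

sublocale finite_dimensional_vector_space scale some_basis
  by unfold_locales (use some_basis in auto)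

abbreviation linear_form :: "('b \<Rightarrow> 'a) \<Rightarrow> bool" where
  "linear_form \<equiv> Vector_Spaces.linear scale (*)"

text \<open>Linear independence of a family rather than a set, so that repeated members count as dependent.\<close>

definition indep_fam :: "'i set \<Rightarrow> ('i \<Rightarrow> 'b) \<Rightarrow> bool" where
  "indep_fam J g \<longleftrightarrow> (\<forall>c. (\<Sum>i\<in>J. scale (c i) (g i)) = 0 \<longrightarrow> (\<forall>i\<in>J. c i = 0))"

lemma vector_space_mult: "vector_space ((*) :: 'a \<Rightarrow> 'a \<Rightarrow> 'a)"
  by unfold_locales (auto simp: algebra_simps)

lemma linear_form_iff:
  "linear_form h \<longleftrightarrow> (\<forall>x y. h (x + y) = h x + h y) \<and> (\<forall>c x. h (scale c x) = c * h x)"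
  unfolding Vector_Spaces.linear_iff using vector_space_mult vector_space_axioms by blast

lemma linear_formI:
  "(\<And>x y. h (x + y) = h x + h y) \<Longrightarrow> (\<And>c x. h (scale c x) = c * h x) \<Longrightarrow> linear_form h"
  by (simp add: linear_form_iff)

lemma linear_form_add: "linear_form h \<Longrightarrow> h (x + y) = h x + h y"
  by (simp add: linear_form_iff)

lemma linear_form_scale: "linear_form h \<Longrightarrow> h (scale c x) = c * h x"
  by (simp add: linear_form_iff)

lemma linear_form_0: "linear_form h \<Longrightarrow> h 0 = 0"
  using linear_form_scale[of h 0 0] by simp

lemma linear_form_diff: "linear_form h \<Longrightarrow> h (x - y) = h x - h y"
  by (metis add_diff_cancel_right' diff_add_cancel linear_form_add)

lemma linear_form_sum: "linear_form h \<Longrightarrow> h (\<Sum>i\<in>J. scale (c i) (g i)) = (\<Sum>i\<in>J. c i * h (g i))"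
  by (induction J rule: infinite_finite_induct)
     (auto simp: linear_form_0 linear_form_add linear_form_scale)

lemma subspace_kernel: "linear_form h \<Longrightarrow> subspace W \<Longrightarrow> subspace (W \<inter> {x. h x = 0})"
  by (auto simp: subspace_def linear_form_0 linear_form_add linear_form_scale)

lemma linear_form_zero_span:
  assumes h: "linear_form h" and z: "\<And>x. x \<in> A \<Longrightarrow> h x = 0" and x: "x \<in> span A"
  shows "h x = 0"
  using x by (induction rule: span_induct_alt)
    (auto simp: linear_form_0[OF h] linear_form_add[OF h] linear_form_scale[OF h] z)

lemma indep_fam_iff:
  assumes fin: "finite J"
  shows "indep_fam J g \<longleftrightarrow> inj_on g J \<and> independent (g ` J)"
proof
  assume ind: "indep_fam J g"
  have inj: "inj_on g J"
  proof (rule inj_onI, rule ccontr)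
    fix i j assume ij: "i \<in> J" "j \<in> J" "g i = g j" "i \<noteq> j"
    have "(\<Sum>k\<in>J. scale ((if k = i then 1 else 0) - (if k = j then 1 else 0)) (g k)) = g i - g j"
      using fin ij by (simp add: scale_left_diff_distrib sum_subtractf if_distrib[of "\<lambda>c. scale c _"]
          sum.delta cong: if_cong)
    with ij have "(\<Sum>k\<in>J. scale ((if k = i then 1 else 0) - (if k = j then 1 else 0)) (g k)) = 0"
      by simp
    then have "(if i = i then 1 else 0) - (if i = j then 1 else 0) = (0::'a)"
      using ind ij(1) unfolding indep_fam_def
      by (elim allE[of _ "\<lambda>k. (if k = i then 1 else 0) - (if k = j then 1 else 0)"]) blast
    with ij(4) show False by simp
  qed
  moreover have "independent (g ` J)"
  proof (rule independent_if_scalars_zero)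
    show "finite (g ` J)" using fin by simp
    fix u x assume u: "(\<Sum>x\<in>g ` J. scale (u x) x) = 0" and x: "x \<in> g ` J"
    have "(\<Sum>i\<in>J. scale (u (g i)) (g i)) = 0" using u by (simp add: sum.reindex[OF inj])
    then have "\<forall>i\<in>J. u (g i) = 0"
      using ind unfolding indep_fam_def by (elim allE[of _ "\<lambda>i. u (g i)"]) blast
    with x show "u x = 0" by auto
  qed
  ultimately show "inj_on g J \<and> independent (g ` J)" by blast
next
  assume asm: "inj_on g J \<and> independent (g ` J)"
  show "indep_fam J g" unfolding indep_fam_def
  proof (intro allI impI ballI)
    fix c i assume c: "(\<Sum>i\<in>J. scale (c i) (g i)) = 0" and i: "i \<in> J"
    define u where "u = (\<lambda>x. c (inv_into J g x))"
    have "(\<Sum>x\<in>g ` J. scale (u x) x) = 0"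
      using c asm by (simp add: sum.reindex u_def)
    then have "u (g i) = 0"
      using independentD[of "g ` J" "g ` J" u "g i"] asm fin i by auto
    then show "c i = 0" using asm i by (simp add: u_def)
  qed
qed

lemma indep_famD:
  "indep_fam J g \<Longrightarrow> (\<Sum>i\<in>J. scale (c i) (g i)) = 0 \<Longrightarrow> i \<in> J \<Longrightarrow> c i = 0"
  unfolding indep_fam_def by blast

lemma dim_span_indep_fam:
  "finite J \<Longrightarrow> indep_fam J g \<Longrightarrow> dim (span (g ` J)) = card J"
  using dim_span_eq_card_independent[of "g ` J"] by (simp add: indep_fam_iff card_image)

lemma in_span_fam_iff:
  assumes "finite J"
  shows "x \<in> span (g ` J) \<longleftrightarrow> (\<exists>c. x = (\<Sum>i\<in>J. scale (c i) (g i)))"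
proof
  assume "x \<in> span (g ` J)"
  then show "\<exists>c. x = (\<Sum>i\<in>J. scale (c i) (g i))"
  proof (induction rule: span_induct_alt)
    case base show ?case by (rule exI[of _ "\<lambda>_. 0"]) simp
  next
    case (step c y x)
    then obtain j d where j: "j \<in> J" "y = g j" and d: "x = (\<Sum>i\<in>J. scale (d i) (g i))" by auto
    have "scale c y + x = (\<Sum>i\<in>J. scale ((if i = j then c else 0) + d i) (g i))"
      using j assms unfolding d
      by (simp add: scale_left_distrib sum.distrib if_distrib[of "\<lambda>c. scale c _"] sum.delta cong: if_cong)
    then show ?case by (rule exI[of _ "\<lambda>i. (if i = j then c else 0) + d i"])
  qed
next
  assume "\<exists>c. x = (\<Sum>i\<in>J. scale (c i) (g i))"
  then show "x \<in> span (g ` J)" by (auto intro!: span_sum span_scale intro: span_base)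
qed

lemma sum_fam_in_subspace:
  "subspace W \<Longrightarrow> (\<And>i. i \<in> J \<Longrightarrow> g i \<in> W) \<Longrightarrow> (\<Sum>i\<in>J. scale (c i) (g i)) \<in> W"
  by (auto intro!: subspace_sum subspace_scale)

lemma exists_fam:
  assumes "subspace W" "finite J" "dim W = card J"
  shows "\<exists>g. indep_fam J g \<and> span (g ` J) = W"
proof -
  obtain B where B: "B \<subseteq> W" "independent B" "W \<subseteq> span B" "card B = dim W"
    using basis_exists[of W] by blast
  have fB: "finite B" using B(2) finiteI_independent by blast
  obtain g where g: "bij_betw g J B"
    using finite_same_card_bij[OF assms(2) fB] assms(3) B(4) by auto
  have gJ: "inj_on g J" "g ` J = B" using g by (auto simp: bij_betw_def)
  have "indep_fam J g" unfolding indep_fam_iff[OF assms(2)] using gJ B(2) by simp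
  moreover have "span (g ` J) = W"
    unfolding gJ(2) using span_minimal[OF B(1) assms(1)] B(3) by (rule subset_antisym)
  ultimately show ?thesis by blast
qed

lemma span_fam_eq_subspace:
  assumes "subspace W" "finite J" "indep_fam J g" "\<And>i. i \<in> J \<Longrightarrow> g i \<in> W" "dim W \<le> card J"
  shows "span (g ` J) = W"
proof (rule subspace_dim_equal)
  show "span (g ` J) \<subseteq> W" using assms by (intro span_minimal) auto
  show "dim W \<le> dim (span (g ` J))" using assms dim_span_indep_fam[of J g] by simp
qed (use assms in auto)

lemma dim_insert_le: "dim (insert x S) \<le> dim S + 1"
  by (simp add: dim_insert)

lemma dim_kernel_ge:
  assumes W: "subspace W" and h: "linear_form h"
  shows "dim W \<le> dim (W \<inter> {x. h x = 0}) + 1"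
proof (cases "\<forall>x\<in>W. h x = 0")
  case True
  then have "W \<inter> {x. h x = 0} = W" by auto
  then show ?thesis by simp
next
  case False
  then obtain w where w: "w \<in> W" "h w \<noteq> 0" by auto
  have "x \<in> span (insert w (W \<inter> {x. h x = 0}))" if x: "x \<in> W" for x
  proof -
    have "x - scale (h x / h w) w \<in> W \<inter> {x. h x = 0}"
      using x w W by (simp add: subspace_diff subspace_scale linear_form_diff[OF h] linear_form_scale[OF h])
    then have "x - scale (h x / h w) w \<in> span (insert w (W \<inter> {x. h x = 0}))" by (auto intro: span_base)
    moreover have "scale (h x / h w) w \<in> span (insert w (W \<inter> {x. h x = 0}))"
      by (auto intro: span_base span_scale)
    ultimately show ?thesis using span_add by fastforce
  qed
  then have "dim W \<le> dim (insert w (W \<inter> {x. h x = 0}))" by (intro dim_mono) auto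
  with dim_insert_le[of w "W \<inter> {x. h x = 0}"] show ?thesis by linarith
qed

lemma dim_kernel_less:
  assumes W: "subspace W" and h: "linear_form h" and w: "w \<in> W" "h w \<noteq> 0"
  shows "dim (W \<inter> {x. h x = 0}) + 1 = dim W"
proof -
  have "dim (W \<inter> {x. h x = 0}) < dim W"
  proof (rule dim_psubset)
    have "span (W \<inter> {x. h x = 0}) = W \<inter> {x. h x = 0}" "span W = W"
      using W subspace_kernel[OF h W] by (simp_all add: span_eq_iff)
    moreover have "W \<inter> {x. h x = 0} \<subset> W" using w by auto
    ultimately show "span (W \<inter> {x. h x = 0}) \<subset> span W" by (simp only:)
  qed
  with dim_kernel_ge[OF W h] show ?thesis by simp
qed

lemma dim_common_kernel_ge:
  assumes W: "subspace W" and J: "finite J" and h: "\<And>j. j \<in> J \<Longrightarrow> linear_form (h j)"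
  shows "dim W \<le> dim (W \<inter> {x. \<forall>j\<in>J. h j x = 0}) + card J"
    and "subspace (W \<inter> {x. \<forall>j\<in>J. h j x = 0})"
proof -
  have "dim W \<le> dim (W \<inter> {x. \<forall>j\<in>J. h j x = 0}) + card J \<and> subspace (W \<inter> {x. \<forall>j\<in>J. h j x = 0})"
    using J h
  proof (induction J rule: finite_induct)
    case empty then show ?case using W by simp
  next
    case (insert j J)
    let ?W = "W \<inter> {x. \<forall>j\<in>J. h j x = 0}"
    have *: "W \<inter> {x. \<forall>i\<in>insert j J. h i x = 0} = ?W \<inter> {x. h j x = 0}" by auto
    have IH: "dim W \<le> dim ?W + card J" "subspace ?W" using insert by auto
    show ?case unfolding *
      using IH dim_kernel_ge[OF IH(2), of "h j"] subspace_kernel[OF _ IH(2), of "h j"] insert by simp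
  qed
  then show "dim W \<le> dim (W \<inter> {x. \<forall>j\<in>J. h j x = 0}) + card J"
    and "subspace (W \<inter> {x. \<forall>j\<in>J. h j x = 0})" by auto
qed

lemma dim_pos_imp_nonzero:
  assumes "dim W > 0" shows "\<exists>w\<in>W. w \<noteq> 0"
proof (rule ccontr)
  assume "\<not> ?thesis"
  then have "W \<subseteq> {0}" by auto
  then have "dim W = 0" by (simp add: dim_eq_0)
  with assms show False by simp
qed

lemma exists_common_zero:
  assumes "subspace W" "finite J" "\<And>j. j \<in> J \<Longrightarrow> linear_form (h j)" "card J < dim W"
  shows "\<exists>w\<in>W. w \<noteq> 0 \<and> (\<forall>j\<in>J. h j w = 0)"
proof -
  have "dim (W \<inter> {x. \<forall>j\<in>J. h j x = 0}) > 0"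
    using dim_common_kernel_ge(1)[OF assms(1-3), of "\<lambda>j. j"] assms(4) by simp
  from dim_pos_imp_nonzero[OF this] show ?thesis by auto
qed

lemma independent_pairI:
  assumes "x \<noteq> 0" "y \<notin> span {x}" and rs: "scale r x + scale s y = 0"
  shows "r = 0 \<and> s = 0"
proof -
  have "s = 0"
  proof (rule ccontr)
    assume s: "s \<noteq> 0"
    have "scale s y = - scale r x" using rs by (simp add: add.commute eq_neg_iff_add_eq_0)
    then have "scale (1 / s) (scale s y) = scale (1 / s) (- scale r x)" by simp
    then have "y = scale (- (r / s)) x" using s by simp
    with assms(2) show False by (metis span_singleton rangeI)
  qed
  with assms show ?thesis by simp
qed

lemma exists_notin_span:
  assumes "dim S < dim W" shows "\<exists>w\<in>W. w \<notin> span S"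
proof (rule ccontr)
  assume "\<not> ?thesis"
  then have "W \<subseteq> span S" by auto
  then have "dim W \<le> dim S" by (rule dim_mono)
  with assms show False by simp
qed

lemma exists_independent_pair:
  assumes W: "subspace W" and d: "2 \<le> dim W"
  shows "\<exists>x\<in>W. \<exists>y\<in>W. \<forall>r s. scale r x + scale s y = 0 \<longrightarrow> r = 0 \<and> s = 0"
proof -
  have "\<exists>x\<in>W. x \<noteq> 0" by (rule dim_pos_imp_nonzero) (use d in linarith)
  then obtain x where x: "x \<in> W" "x \<noteq> 0" by blast
  have "dim {x} < dim W" using dim_insert_le[of x "{}"] d unfolding dim_empty by linarith
  from exists_notin_span[OF this] obtain y where y: "y \<in> W" "y \<notin> span {x}" by blast
  from independent_pairI[OF x(2) y(2)] x(1) y(1) show ?thesis by blast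
qed

end

section \<open>The quadrics of a half-spinor representation\<close>

text \<open>The indices of a hyperbolic basis. An enumeration type lets identities between spinor coordinates be
  proved by case distinction on the indices.\<close>

datatype five = A0 | A1 | A2 | A3 | A4

lemma UNIV_five: "UNIV = {A0, A1, A2, A3, A4}"
  using five.exhaust by blast

instance five :: finite
  by standard (simp add: UNIV_five)

lemma card_five: "card (UNIV :: five set) = 5"
  by (simp add: UNIV_five)

lemma sum_five: "(\<Sum>i\<in>UNIV. h i) = h A0 + h A1 + h A2 + h A3 + h A4"
  for h :: "five \<Rightarrow> 'a::comm_monoid_add"
  by (simp add: UNIV_five add.assoc)

context half_spinors
begin

sublocale V: fin_vs sV by unfold_locales (simp add: dim_V)
sublocale S: fin_vs sS by unfold_locales (simp add: dim_S)
sublocale S': fin_vs sS' by unfold_locales (simp add: dim_S')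

lemma card_some_basis [simp]:
  "card V.some_basis = 10" "card S.some_basis = 16" "card S'.some_basis = 16"
  using dim_V dim_S dim_S' by simp_all

text \<open>Everything proved about \<open>S\<close> below holds for \<open>S'\<close> through this interpretation.\<close>

lemma dual_half_spinors: "half_spinors sV sS' sS q cl' cl (\<lambda>t s. pairing s t)"
proof unfold_locales
  show "bilinear_map sS' sS (*) (\<lambda>t s. pairing s t)"
    using pairing_bilinear unfolding bilinear_map_def by auto
qed (use dim_V q_scale q_polar q_nondegenerate dim_S dim_S' cl_bilinear cl'_bilinear clifford clifford'
      pairing_nondegenerate pairing_nondegenerate' pairing_invariant in auto)

definition polar :: "'v \<Rightarrow> 'v \<Rightarrow> 'k" where
  "polar v w = q (v + w) - q v - q w"

lemma q_add: "q (v + w) = q v + q w + polar v w"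
  by (simp add: polar_def)

lemma polar_nondegenerate: "(\<And>w. polar v w = 0) \<Longrightarrow> v = 0"
  using q_nondegenerate[of v] by (simp add: polar_def)

lemma polar_commute: "polar v w = polar w v"
  by (simp add: polar_def add.commute)

lemma polar_linear:
  "polar (v + v') w = polar v w + polar v' w" "polar (sV c v) w = c * polar v w"
  "polar w (v + v') = polar w v + polar w v'" "polar w (sV c v) = c * polar w v"
  using q_polar unfolding bilinear_map_def Vector_Spaces.linear_iff polar_def[symmetric] by metis+

lemma linear_form_polar: "V.linear_form (polar v)" "V.linear_form (\<lambda>w. polar w v)"
  by (intro V.linear_formI; rule polar_linear)+

lemma polar_self: "polar v v = 2 * q v"
proof -
  have "v + v = sV 2 v" using V.scale_left_distrib[of 1 1 v] by simp
  then show ?thesis by (simp add: q_scale polar_def)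
qed

lemma q_eq_0_iff: "q v = 0 \<longleftrightarrow> polar v v = 0"
  by (simp add: polar_self)

lemma cl_linear:
  "cl (v + w) s = cl v s + cl w s" "cl (sV c v) s = sS' c (cl v s)"
  "cl v (s + s') = cl v s + cl v s'" "cl v (sS c s) = sS' c (cl v s)"
  using cl_bilinear unfolding bilinear_map_def Vector_Spaces.linear_iff by metis+

lemma cl'_linear:
  "cl' (v + w) t = cl' v t + cl' w t" "cl' (sV c v) t = sS c (cl' v t)"
  "cl' v (t + t') = cl' v t + cl' v t'" "cl' v (sS' c t) = sS c (cl' v t)"
  using cl'_bilinear unfolding bilinear_map_def Vector_Spaces.linear_iff by metis+

lemma pairing_linear:
  "pairing (s + s') t = pairing s t + pairing s' t" "pairing (sS c s) t = c * pairing s t"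
  "pairing s (t + t') = pairing s t + pairing s t'" "pairing s (sS' c t) = c * pairing s t"
  using pairing_bilinear unfolding bilinear_map_def Vector_Spaces.linear_iff by metis+

lemma cl_0 [simp]: "cl 0 s = 0" "cl v 0 = 0"
  using cl_linear(2)[of 0 v s] cl_linear(4)[of v 0 0] by auto

lemma cl'_0 [simp]: "cl' 0 t = 0" "cl' v 0 = 0"
  using cl'_linear(2)[of 0 v t] cl'_linear(4)[of v 0 0] by auto

lemma pairing_0 [simp]: "pairing 0 t = 0" "pairing s 0 = 0"
  using pairing_linear(2)[of 0 0 t] pairing_linear(4)[of s 0 0] by auto

lemma cl_minus: "cl (- v) s = - cl v s" "cl v (- s) = - cl v s"
  by (metis add.right_inverse add_eq_0_iff cl_0 cl_linear(1,3))+

lemma cl'_minus: "cl' (- v) t = - cl' v t" "cl' v (- t) = - cl' v t"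
  by (metis add.right_inverse add_eq_0_iff cl'_0 cl'_linear(1,3))+

lemma pairing_minus: "pairing (- s) t = - pairing s t" "pairing s (- t) = - pairing s t"
  by (metis add.right_inverse add_eq_0_iff pairing_0 pairing_linear(1,3))+

lemma cl_diff: "cl (v - w) s = cl v s - cl w s" "cl v (s - s') = cl v s - cl v s'"
  by (metis cl_linear(1) cl_minus(1) diff_conv_add_uminus, metis cl_linear(3) cl_minus(2) diff_conv_add_uminus)

lemma cl'_diff: "cl' (v - w) t = cl' v t - cl' w t" "cl' v (t - t') = cl' v t - cl' v t'"
  by (metis cl'_linear(1) cl'_minus(1) diff_conv_add_uminus, metis cl'_linear(3) cl'_minus(2) diff_conv_add_uminus)

lemma pairing_diff: "pairing (s - s') t = pairing s t - pairing s' t"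
  "pairing s (t - t') = pairing s t - pairing s t'"
  by (metis pairing_linear(1) pairing_minus(1) diff_conv_add_uminus,
      metis pairing_linear(3) pairing_minus(2) diff_conv_add_uminus)

lemma cl_anticommute: "cl' v (cl w s) = sS (polar v w) s - cl' w (cl v s)"
proof -
  have "cl' (v + w) (cl (v + w) s) = sS (q (v + w)) s" by (rule clifford)
  then have *: "sS (q (v + w)) s = sS (q v) s + cl' v (cl w s) + (cl' w (cl v s) + sS (q w) s)"
    by (simp add: cl_linear cl'_linear clifford add_ac)
  have "sS (polar v w) s = cl' v (cl w s) + cl' w (cl v s)"
    unfolding polar_def S.scale_left_diff_distrib * by simp
  then show ?thesis by simp
qed

lemma cl'_anticommute: "cl v (cl' w t) = sS' (polar v w) t - cl w (cl' v t)"
proof -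
  have "cl (v + w) (cl' (v + w) t) = sS' (q (v + w)) t" by (rule clifford')
  then have *: "sS' (q (v + w)) t = sS' (q v) t + cl v (cl' w t) + (cl w (cl' v t) + sS' (q w) t)"
    by (simp add: cl_linear cl'_linear clifford' add_ac)
  have "sS' (polar v w) t = cl v (cl' w t) + cl w (cl' v t)"
    unfolding polar_def S'.scale_left_diff_distrib * by simp
  then show ?thesis by simp
qed

text \<open>The bilinear form \<open>pairing s (cl v s')\<close> on \<open>S\<close> is the quadric of \<open>v\<close>; it is
  symmetric by \<open>quadric_commute\<close> below.\<close>

lemma quadric_form_linear:
  "S.linear_form (\<lambda>s. pairing s (cl v s'))" "S.linear_form (\<lambda>s'. pairing s (cl v s'))"
  "V.linear_form (\<lambda>v. pairing s (cl v s'))"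
  by (auto intro!: S.linear_formI V.linear_formI simp: cl_linear pairing_linear)

lemma cl_zero_span: "(\<And>x. x \<in> A \<Longrightarrow> cl x s = 0) \<Longrightarrow> u \<in> V.span A \<Longrightarrow> cl u s = 0"
  by (rotate_tac, induction rule: V.span_induct_alt) (auto simp: cl_linear)

lemma cl'_zero_span: "(\<And>x. x \<in> A \<Longrightarrow> cl' x t = 0) \<Longrightarrow> u \<in> V.span A \<Longrightarrow> cl' u t = 0"
  by (rotate_tac, induction rule: V.span_induct_alt) (auto simp: cl'_linear)

lemma anisotropic_exists: "\<exists>v. q v \<noteq> 0"
proof (rule ccontr)
  assume "\<not> ?thesis"
  then have z: "q v = 0" for v by blast
  have "v = 0" for v :: 'v by (rule q_nondegenerate) (simp add: z)
  then have "(UNIV :: 'v set) \<subseteq> {0}" by auto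
  then have "V.dim UNIV = 0" using V.dim_eq_0 by blast
  then show False by (simp add: dim_V)
qed

text \<open>Invariance of the pairing gives this for vectors with \<open>q v = q w = 1\<close>, hence by scaling for
  all anisotropic vectors, and every vector is a difference of two anisotropic ones.\<close>

lemma pairing_adjoint: "pairing (cl' v (cl w s)) t = pairing s (cl w (cl' v t))"
proof -
  have unit: "pairing (cl' v (cl w s)) t = pairing s (cl w (cl' v t))" if "q v = 1" "q w = 1" for v w
  proof -
    have "cl v (cl' w (cl w (cl' v t))) = t"
      by (simp add: clifford clifford' that)
    then show ?thesis using pairing_invariant[OF that, of s "cl w (cl' v t)"] by simp
  qed
  have aniso: "pairing (cl' v (cl w s)) t = pairing s (cl w (cl' v t))" if qvw: "q v \<noteq> 0" "q w \<noteq> 0" for v w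
  proof -
    have "\<exists>x. x \<noteq> 0 \<and> q (sV x v) = 1" if v: "q v \<noteq> 0" for v
    proof -
      obtain r where r: "r ^ 2 = q v" using nth_root_exists[of 2 "q v"] by auto
      with v have "r \<noteq> 0" by auto
      then show ?thesis using r v by (intro exI[of _ "1 / r"]) (simp add: q_scale power_divide)
    qed
    then obtain x y where xy: "x \<noteq> 0" "q (sV x v) = 1" "y \<noteq> 0" "q (sV y w) = 1" using qvw by metis
    from unit[OF xy(2,4)] have "x * y * pairing (cl' v (cl w s)) t = x * y * pairing s (cl w (cl' v t))"
      by (simp add: cl_linear cl'_linear pairing_linear mult.assoc mult.left_commute)
    with xy show ?thesis by simp
  qed
  \<comment> \<open>If \<open>q v = 0\<close>, one of \<open>v + v0\<close>, \<open>v - v0\<close> is anisotropic for any anisotropic \<open>v0\<close>.\<close>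
  have split: "\<exists>x y. v = x - y \<and> q x \<noteq> 0 \<and> q y \<noteq> 0" for v
  proof -
    obtain v0 where v0: "q v0 \<noteq> 0" using anisotropic_exists by blast
    have dbl: "q (v0 + v0) \<noteq> 0" "q (- v0) \<noteq> 0"
      using v0 q_scale[of "-1" v0] by (auto simp: q_add polar_self)
    show ?thesis
    proof (cases "q v = 0")
      case False
      have "v = (v + v) - v" by simp
      moreover have "q (v + v) \<noteq> 0" using False by (auto simp: q_add polar_self)
      ultimately show ?thesis using False by blast
    next
      case True
      have neg: "polar v (- v0) = - polar v v0" "q (- v0) = q v0"
        using polar_linear(4)[of v "-1" v0] q_scale[of "-1" v0] by auto
      have "q (v + v0) \<noteq> 0 \<or> q (v + (- v0)) \<noteq> 0"
      proof (rule ccontr)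
        assume "\<not> ?thesis"
        then have "q (v + v0) = 0" "q (v + (- v0)) = 0" by auto
        then have "q v0 + polar v v0 = 0" "q v0 - polar v v0 = 0" unfolding q_add neg using True by simp_all
        then have "2 * q v0 = 0" by simp
        with v0 show False by simp
      qed
      then show ?thesis
      proof
        assume "q (v + v0) \<noteq> 0"
        moreover have "v = (v + v0) - v0" by simp
        ultimately show ?thesis using v0 by blast
      next
        assume "q (v + (- v0)) \<noteq> 0"
        moreover have "v = (v + (- v0)) - (- v0)" by simp
        ultimately show ?thesis using dbl by blast
      qed
    qed
  qed
  obtain x y where xy: "v = x - y" "q x \<noteq> 0" "q y \<noteq> 0" using split by blast
  obtain z u where zu: "w = z - u" "q z \<noteq> 0" "q u \<noteq> 0" using split by blast
  show ?thesis unfolding xy(1) zu(1)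
    by (simp add: cl_diff cl'_diff pairing_diff aniso xy zu)
qed

end

section \<open>Coordinates of spinors in a hyperbolic frame\<close>

text \<open>The vacuum \<open>Om\<close> is killed by the annihilation operators \<open>e\<close>, and the creation operators
  \<open>f\<close> build all spinors from it.\<close>

locale spinor_frame = half_spinors sV sS sS' q cl cl' pairing
  for sV :: "'k::{alg_closed_field, field_char_0} \<Rightarrow> 'v::ab_group_add \<Rightarrow> 'v"
    and sS :: "'k \<Rightarrow> 's::ab_group_add \<Rightarrow> 's"
    and sS' :: "'k \<Rightarrow> 't::ab_group_add \<Rightarrow> 't"
    and q cl cl' pairing +
  fixes e f :: "five \<Rightarrow> 'v" and Om :: 's
  assumes polar_e_e: "polar (e i) (e j) = 0"
    and polar_f_f: "polar (f i) (f j) = 0"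
    and polar_e_f: "polar (e i) (f j) = (if i = j then 1 else 0)"
    and e_Om: "cl (e i) Om = 0"
    and Om_nonzero: "Om \<noteq> 0"
begin

lemma polar_f_e: "polar (f i) (e j) = (if i = j then 1 else 0)"
  using polar_e_f[of j i] by (simp add: polar_commute)

lemma q_e: "q (e i) = 0" and q_f: "q (f i) = 0"
  using polar_e_e[of i i] polar_f_f[of i i] q_eq_0_iff by auto

lemma f_square: "cl' (f i) (cl (f i) s) = 0" "cl (f i) (cl' (f i) t) = 0"
  by (simp_all add: clifford clifford' q_f)

lemma e_square: "cl' (e i) (cl (e i) s) = 0" "cl (e i) (cl' (e i) t) = 0"
  by (simp_all add: clifford clifford' q_e)

lemma e_f_commute:
  "cl' (e i) (cl (f j) s) = (if i = j then s else 0) - cl' (f j) (cl (e i) s)"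
  "cl (e i) (cl' (f j) t) = (if i = j then t else 0) - cl (f j) (cl' (e i) t)"
  using polar_e_f[of i j] by (auto simp: cl_anticommute[of "e i"] cl'_anticommute[of "e i"])

lemma f_f_commute:
  "cl' (f i) (cl (f j) s) = - cl' (f j) (cl (f i) s)"
  "cl (f i) (cl' (f j) t) = - cl (f j) (cl' (f i) t)"
  using polar_f_f[of i j] cl_anticommute[of "f i" "f j" s] cl'_anticommute[of "f i" "f j" t] by auto

lemma e_e_commute:
  "cl' (e i) (cl (e j) s) = - cl' (e j) (cl (e i) s)"
  "cl (e i) (cl' (e j) t) = - cl (e j) (cl' (e i) t)"
  using polar_e_e[of i j] cl_anticommute[of "e i" "e j" s] cl'_anticommute[of "e i" "e j" t] by auto

text \<open>Rewrite rules that sort creation operators by index. Stating all cases avoids a looping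
  anticommutation rule.\<close>

lemma f_sort:
  shows "cl' (f A1) (cl (f A0) s) = - cl' (f A0) (cl (f A1) s)"
    and "cl (f A1) (cl' (f A0) t) = - cl (f A0) (cl' (f A1) t)"
    and "cl' (f A2) (cl (f A0) s) = - cl' (f A0) (cl (f A2) s)"
    and "cl (f A2) (cl' (f A0) t) = - cl (f A0) (cl' (f A2) t)"
    and "cl' (f A2) (cl (f A1) s) = - cl' (f A1) (cl (f A2) s)"
    and "cl (f A2) (cl' (f A1) t) = - cl (f A1) (cl' (f A2) t)"
    and "cl' (f A3) (cl (f A0) s) = - cl' (f A0) (cl (f A3) s)"
    and "cl (f A3) (cl' (f A0) t) = - cl (f A0) (cl' (f A3) t)"
    and "cl' (f A3) (cl (f A1) s) = - cl' (f A1) (cl (f A3) s)"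
    and "cl (f A3) (cl' (f A1) t) = - cl (f A1) (cl' (f A3) t)"
    and "cl' (f A3) (cl (f A2) s) = - cl' (f A2) (cl (f A3) s)"
    and "cl (f A3) (cl' (f A2) t) = - cl (f A2) (cl' (f A3) t)"
    and "cl' (f A4) (cl (f A0) s) = - cl' (f A0) (cl (f A4) s)"
    and "cl (f A4) (cl' (f A0) t) = - cl (f A0) (cl' (f A4) t)"
    and "cl' (f A4) (cl (f A1) s) = - cl' (f A1) (cl (f A4) s)"
    and "cl (f A4) (cl' (f A1) t) = - cl (f A1) (cl' (f A4) t)"
    and "cl' (f A4) (cl (f A2) s) = - cl' (f A2) (cl (f A4) s)"
    and "cl (f A4) (cl' (f A2) t) = - cl (f A2) (cl' (f A4) t)"
    and "cl' (f A4) (cl (f A3) s) = - cl' (f A3) (cl (f A4) s)"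
    and "cl (f A4) (cl' (f A3) t) = - cl (f A3) (cl' (f A4) t)"
  by (rule f_f_commute)+

lemmas frame_simps = f_square f_sort e_f_commute e_Om cl_linear cl'_linear cl_minus cl'_minus cl_diff cl'_diff

text \<open>Pairs of operators; \<open>ef i\<close> projects to the monomials without \<open>f i\<close>.\<close>

abbreviation "ff i j s \<equiv> cl' (f i) (cl (f j) s)"
abbreviation "ee i j s \<equiv> cl' (e i) (cl (e j) s)"
abbreviation "ee' i j t \<equiv> cl (e i) (cl' (e j) t)"
abbreviation "ef i s \<equiv> cl' (e i) (cl (f i) s)"

text \<open>The combinations of the 16 even monomials in the creation operators, sorted by degree and then
  lexicographically.\<close>

definition even_combination :: "(nat \<Rightarrow> 'k) \<Rightarrow> 's" where
  "even_combination c = sS (c 0) Om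
    + sS (c 1) (ff A0 A1 Om) + sS (c 2) (ff A0 A2 Om) + sS (c 3) (ff A0 A3 Om) + sS (c 4) (ff A0 A4 Om)
    + sS (c 5) (ff A1 A2 Om) + sS (c 6) (ff A1 A3 Om) + sS (c 7) (ff A1 A4 Om)
    + sS (c 8) (ff A2 A3 Om) + sS (c 9) (ff A2 A4 Om) + sS (c 10) (ff A3 A4 Om)
    + sS (c 11) (ff A0 A1 (ff A2 A3 Om)) + sS (c 12) (ff A0 A1 (ff A2 A4 Om)) + sS (c 13) (ff A0 A1 (ff A3 A4 Om))
    + sS (c 14) (ff A0 A2 (ff A3 A4 Om)) + sS (c 15) (ff A1 A2 (ff A3 A4 Om))"

text \<open>Each coefficient is isolated by a word in the operators which removes the creation operators of its
  monomial and projects away all other indices.\<close>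

lemma even_monomials_independent:
  assumes eq: "even_combination c = 0"
  shows "\<forall>i<16. c i = 0"
proof -
  note applied = arg_cong[OF eq[unfolded even_combination_def]]
  have c0: "c 0 = 0"
    using applied[of "\<lambda>x. ef A0 (ef A1 (ef A2 (ef A3 (ef A4 x))))"] Om_nonzero by (simp add: frame_simps)
  have c1: "c 1 = 0"
    using applied[of "\<lambda>x. ef A2 (ef A3 (ef A4 (ee A0 A1 x)))"] Om_nonzero by (simp add: frame_simps)
  have c2: "c 2 = 0"
    using applied[of "\<lambda>x. ef A1 (ef A3 (ef A4 (ee A0 A2 x)))"] Om_nonzero by (simp add: frame_simps)
  have c3: "c 3 = 0"
    using applied[of "\<lambda>x. ef A1 (ef A2 (ef A4 (ee A0 A3 x)))"] Om_nonzero by (simp add: frame_simps)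
  have c4: "c 4 = 0"
    using applied[of "\<lambda>x. ef A1 (ef A2 (ef A3 (ee A0 A4 x)))"] Om_nonzero by (simp add: frame_simps)
  have c5: "c 5 = 0"
    using applied[of "\<lambda>x. ef A0 (ef A3 (ef A4 (ee A1 A2 x)))"] Om_nonzero by (simp add: frame_simps)
  have c6: "c 6 = 0"
    using applied[of "\<lambda>x. ef A0 (ef A2 (ef A4 (ee A1 A3 x)))"] Om_nonzero by (simp add: frame_simps)
  have c7: "c 7 = 0"
    using applied[of "\<lambda>x. ef A0 (ef A2 (ef A3 (ee A1 A4 x)))"] Om_nonzero by (simp add: frame_simps)
  have c8: "c 8 = 0"
    using applied[of "\<lambda>x. ef A0 (ef A1 (ef A4 (ee A2 A3 x)))"] Om_nonzero by (simp add: frame_simps)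
  have c9: "c 9 = 0"
    using applied[of "\<lambda>x. ef A0 (ef A1 (ef A3 (ee A2 A4 x)))"] Om_nonzero by (simp add: frame_simps)
  have c10: "c 10 = 0"
    using applied[of "\<lambda>x. ef A0 (ef A1 (ef A2 (ee A3 A4 x)))"] Om_nonzero by (simp add: frame_simps)
  have c11: "c 11 = 0"
    using applied[of "\<lambda>x. ef A4 (ee A0 A1 (ee A2 A3 x))"] Om_nonzero by (simp add: frame_simps)
  have c12: "c 12 = 0"
    using applied[of "\<lambda>x. ef A3 (ee A0 A1 (ee A2 A4 x))"] Om_nonzero by (simp add: frame_simps)
  have c13: "c 13 = 0"
    using applied[of "\<lambda>x. ef A2 (ee A0 A1 (ee A3 A4 x))"] Om_nonzero by (simp add: frame_simps)
  have c14: "c 14 = 0"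
    using applied[of "\<lambda>x. ef A1 (ee A0 A2 (ee A3 A4 x))"] Om_nonzero by (simp add: frame_simps)
  have c15: "c 15 = 0"
    using applied[of "\<lambda>x. ef A0 (ee A1 A2 (ee A3 A4 x))"] Om_nonzero by (simp add: frame_simps)
  have "i = 0 \<or> i = 1 \<or> i = 2 \<or> i = 3 \<or> i = 4 \<or> i = 5 \<or> i = 6 \<or> i = 7 \<or> i = 8 \<or> i = 9
    \<or> i = 10 \<or> i = 11 \<or> i = 12 \<or> i = 13 \<or> i = 14 \<or> i = 15" if "i < 16" for i :: nat
    using that by presburger
  then show ?thesis
    using c0 c1 c2 c3 c4 c5 c6 c7 c8 c9 c10 c11 c12 c13 c14 c15 by metis
qed

lemma even_monomials_span:
  "\<exists>c. s = even_combination c"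
proof -
  define g where "g = nth [Om, ff A0 A1 Om, ff A0 A2 Om, ff A0 A3 Om, ff A0 A4 Om, ff A1 A2 Om, ff A1 A3 Om,
    ff A1 A4 Om, ff A2 A3 Om, ff A2 A4 Om, ff A3 A4 Om, ff A0 A1 (ff A2 A3 Om), ff A0 A1 (ff A2 A4 Om),
    ff A0 A1 (ff A3 A4 Om), ff A0 A2 (ff A3 A4 Om), ff A1 A2 (ff A3 A4 Om)]"
  have ind: "S.indep_fam {..<16::nat} g"
    unfolding S.indep_fam_def
  proof (intro allI impI)
    fix c assume "(\<Sum>i<16. sS (c i) (g i)) = 0"
    then have "even_combination c = 0"
      unfolding g_def even_combination_def by (simp add: eval_nat_numeral lessThan_Suc add_ac)
    then show "\<forall>i\<in>{..<16}. c i = 0" using even_monomials_independent by blast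
  qed
  have "S.span (g ` {..<16}) = UNIV"
    by (rule S.span_fam_eq_subspace[OF _ _ ind]) (auto simp: dim_S)
  then obtain c where "s = (\<Sum>i<16. sS (c i) (g i))"
    using S.in_span_fam_iff[of "{..<16::nat}" s g] by auto
  then have "s = even_combination c"
    unfolding g_def even_combination_def by (simp add: eval_nat_numeral lessThan_Suc add_ac)
  then show ?thesis by blast
qed

text \<open>The pure spinor of the opposite isotropic subspace, spanned by \<open>f\<close>; it lies in \<open>S'\<close> since 5
  is odd.\<close>

definition tau :: 't where
  "tau = cl (f A0) (ff A1 A2 (ff A3 A4 Om))"

definition kappa :: 'k where
  "kappa = pairing Om tau"

lemma f_tau: "cl' (f i) tau = 0"
  by (cases i) (simp_all add: tau_def frame_simps)

lemma tau_nonzero: "tau \<noteq> 0"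
proof
  assume "tau = 0"
  then have "ee A4 A3 (ee A2 A1 (cl' (e A0) tau)) = 0" by simp
  then show False using Om_nonzero by (simp add: tau_def frame_simps)
qed

lemma dual_spinor_frame: "spinor_frame sV sS' sS q cl' cl (\<lambda>t s. pairing s t) f e tau"
proof (rule spinor_frame.intro[OF dual_half_spinors], unfold_locales)
  show "cl' (f i) tau = 0" for i by (rule f_tau)
  show "tau \<noteq> 0" by (rule tau_nonzero)
qed (simp_all add: polar_e_e polar_f_f polar_f_e)

lemma another_index: "\<exists>m. m \<noteq> i \<and> m \<noteq> j \<and> m \<noteq> (k::five)"
proof -
  have "card {i, j, k} \<le> 3" by (simp add: card_insert_if)
  then have "{i, j, k} \<noteq> UNIV" using card_five
      by (metis numeral_le_iff semiring_norm(68,69,72,73) order_trans num.distinct(1))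
  then show ?thesis by blast
qed

text \<open>Since \<open>e m\<close> undoes \<open>f m\<close> on the vacuum, the pairing with \<open>Om\<close> is unchanged by inserting
  \<open>f m\<close> and \<open>e m\<close>. For an index \<open>m\<close> which does not occur otherwise, \<open>e m\<close> can be moved to the right, where it
  kills the vacuum.\<close>

lemma pairing_Om_small:
  "pairing Om (cl (f i) Om) = 0"
  "pairing Om (cl (f i) (cl' (f j) (cl (f k) Om))) = 0"
proof -
  have *: "pairing Om (cl (f m) (cl' (e m) t)) = pairing Om t" for m t
    using pairing_adjoint[of "e m" "f m" Om t] by (simp add: e_f_commute e_Om)
  obtain m where m: "m \<noteq> i" "m \<noteq> j" "m \<noteq> k" using another_index by blast
  show "pairing Om (cl (f i) Om) = 0"
    using *[of m "cl (f i) Om"] m by (simp add: e_f_commute e_Om cl'_minus)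
  show "pairing Om (cl (f i) (cl' (f j) (cl (f k) Om))) = 0"
    using *[of m "cl (f i) (cl' (f j) (cl (f k) Om))"] m by (simp add: e_f_commute e_Om cl'_minus cl_minus)
qed

lemma pairing_Om_tau: "pairing Om tau = kappa"
  by (simp add: kappa_def)

lemmas frame_pairing_simps = pairing_linear pairing_minus pairing_diff pairing_adjoint pairing_Om_small
    pairing_Om_tau[unfolded tau_def]

lemma pairing_Om_ee: "pairing Om (cl (e i) (cl' (e j) t)) = 0"
  using pairing_adjoint[of "e j" "e i" Om t] by (simp add: e_Om)

text \<open>All monomials over the opposite vacuum \<open>tau\<close> other than \<open>tau\<close> itself are orthogonal to \<open>Om\<close>,
  so \<open>kappa = 0\<close> would make \<open>Om\<close> orthogonal to everything.\<close>

lemma kappa_nonzero: "kappa \<noteq> 0"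
proof
  assume k: "kappa = 0"
  interpret dual: spinor_frame sV sS' sS q cl' cl "\<lambda>t s. pairing s t" f e tau
    by (rule dual_spinor_frame)
  have "pairing Om t = 0" for t
  proof -
    obtain c where "t = dual.even_combination c"
      using dual.even_monomials_span[of t] by blast
    then show ?thesis using k
      unfolding dual.even_combination_def
      by (simp add: pairing_linear pairing_Om_ee pairing_Om_tau)
  qed
  then have "Om = 0" by (rule pairing_nondegenerate)
  with Om_nonzero show False by blast
qed

lemma ee_tau:
  shows "ee' A0 A1 tau = - cl (f A2) (ff A3 A4 Om)"
    and "ee' A0 A2 tau = cl (f A1) (ff A3 A4 Om)"
    and "ee' A0 A3 tau = - cl (f A1) (ff A2 A4 Om)"
    and "ee' A0 A4 tau = cl (f A1) (ff A2 A3 Om)"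
    and "ee' A1 A2 tau = - cl (f A0) (ff A3 A4 Om)"
    and "ee' A1 A3 tau = cl (f A0) (ff A2 A4 Om)"
    and "ee' A1 A4 tau = - cl (f A0) (ff A2 A3 Om)"
    and "ee' A2 A3 tau = - cl (f A0) (ff A1 A4 Om)"
    and "ee' A2 A4 tau = cl (f A0) (ff A1 A3 Om)"
    and "ee' A3 A4 tau = - cl (f A0) (ff A1 A2 Om)"
  by (simp_all add: tau_def frame_simps)

text \<open>The components of a spinor of degree 0, 2 and 4 in the exterior algebra of the span of \<open>f\<close>; degree 4 is
  identified with its dual, with signs as in \<open>spinor_expansion\<close>.\<close>

definition a_coord :: "'s \<Rightarrow> 'k" where
  "a_coord s = pairing s tau / kappa"

definition b_coord :: "'s \<Rightarrow> five \<Rightarrow> five \<Rightarrow> 'k" where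
  "b_coord s i j = pairing s (cl (e i) (cl' (e j) tau)) / kappa"

definition c_coord :: "'s \<Rightarrow> five \<Rightarrow> 'k" where
  "c_coord s i = pairing s (cl (f i) Om) / kappa"

lemma b_coord_skew: "b_coord s j i = - b_coord s i j"
  unfolding b_coord_def by (subst e_e_commute(2)) (simp add: pairing_minus)

lemma b_coord_diag [simp]: "b_coord s i i = 0"
  unfolding b_coord_def by (simp add: e_square)

lemma coord_linear:
  "a_coord (s + s') = a_coord s + a_coord s'" "a_coord (sS r s) = r * a_coord s"
  "b_coord (s + s') i j = b_coord s i j + b_coord s' i j" "b_coord (sS r s) i j = r * b_coord s i j"
  "c_coord (s + s') i = c_coord s i + c_coord s' i" "c_coord (sS r s) i = r * c_coord s i"
  by (simp_all add: a_coord_def b_coord_def c_coord_def pairing_linear add_divide_distrib)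

lemma spinor_expansion:
  "s = sS (a_coord s) Om + sS (b_coord s A0 A1) (ff A0 A1 Om) + sS (b_coord s A0 A2) (ff A0 A2 Om)
    + sS (b_coord s A0 A3) (ff A0 A3 Om) + sS (b_coord s A0 A4) (ff A0 A4 Om) + sS (b_coord s A1 A2) (ff A1 A2 Om)
    + sS (b_coord s A1 A3) (ff A1 A3 Om) + sS (b_coord s A1 A4) (ff A1 A4 Om) + sS (b_coord s A2 A3) (ff A2 A3 Om)
    + sS (b_coord s A2 A4) (ff A2 A4 Om) + sS (b_coord s A3 A4) (ff A3 A4 Om)
    + sS (c_coord s A4) (ff A0 A1 (ff A2 A3 Om)) + sS (- c_coord s A3) (ff A0 A1 (ff A2 A4 Om))
    + sS (c_coord s A2) (ff A0 A1 (ff A3 A4 Om)) + sS (- c_coord s A1) (ff A0 A2 (ff A3 A4 Om))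
    + sS (c_coord s A0) (ff A1 A2 (ff A3 A4 Om))"
proof -
  obtain c where c: "s = even_combination c"
    using even_monomials_span by blast
  have a: "c 0 = a_coord s"
    unfolding c even_combination_def a_coord_def tau_def
    using kappa_nonzero by (simp add: frame_simps frame_pairing_simps)
  have b: "c 1 = b_coord s A0 A1" "c 2 = b_coord s A0 A2" "c 3 = b_coord s A0 A3" "c 4 = b_coord s A0 A4"
    "c 5 = b_coord s A1 A2" "c 6 = b_coord s A1 A3" "c 7 = b_coord s A1 A4"
    "c 8 = b_coord s A2 A3" "c 9 = b_coord s A2 A4" "c 10 = b_coord s A3 A4"
    unfolding c even_combination_def b_coord_def ee_tau
    using kappa_nonzero by (simp_all add: frame_simps frame_pairing_simps)
  have c': "c 11 = c_coord s A4" "c 12 = - c_coord s A3" "c 13 = c_coord s A2" "c 14 = - c_coord s A1"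
    "c 15 = c_coord s A0"
    unfolding c even_combination_def c_coord_def
    using kappa_nonzero by (simp_all add: frame_simps frame_pairing_simps)
  show ?thesis by (rule c[unfolded even_combination_def a b c'])
qed

lemma pairing_triple:
  shows "pairing s (cl (f A0) (ff A1 A2 Om)) = kappa * - b_coord s A3 A4"
    and "pairing s (cl (f A0) (ff A1 A3 Om)) = kappa * b_coord s A2 A4"
    and "pairing s (cl (f A0) (ff A1 A4 Om)) = kappa * - b_coord s A2 A3"
    and "pairing s (cl (f A0) (ff A2 A3 Om)) = kappa * - b_coord s A1 A4"
    and "pairing s (cl (f A0) (ff A2 A4 Om)) = kappa * b_coord s A1 A3"
    and "pairing s (cl (f A0) (ff A3 A4 Om)) = kappa * - b_coord s A1 A2"
    and "pairing s (cl (f A1) (ff A2 A3 Om)) = kappa * b_coord s A0 A4"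
    and "pairing s (cl (f A1) (ff A2 A4 Om)) = kappa * - b_coord s A0 A3"
    and "pairing s (cl (f A1) (ff A3 A4 Om)) = kappa * b_coord s A0 A2"
    and "pairing s (cl (f A2) (ff A3 A4 Om)) = kappa * - b_coord s A0 A1"
  by (subst spinor_expansion[of s], simp add: frame_simps frame_pairing_simps)+

lemma pairing_tau: "pairing s tau = kappa * a_coord s"
  using kappa_nonzero by (simp add: a_coord_def)

lemma pairing_f: "pairing s (cl (f i) Om) = kappa * c_coord s i"
  using kappa_nonzero by (simp add: c_coord_def)

text \<open>The polarized signed Pfaffians of the skew matrices of size 4 which omit an index: up to normalization,
  the coordinates of the product of two bivectors in dimension 5.\<close>

fun pf :: "five \<Rightarrow> (five \<Rightarrow> five \<Rightarrow> 'k) \<Rightarrow> (five \<Rightarrow> five \<Rightarrow> 'k) \<Rightarrow> 'k" where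
  "pf A0 b d = ((b A1 A2 * d A3 A4 + d A1 A2 * b A3 A4) - (b A1 A3 * d A2 A4 + d A1 A3 * b A2 A4)
      + (b A1 A4 * d A2 A3 + d A1 A4 * b A2 A3))"
| "pf A1 b d = - ((b A0 A2 * d A3 A4 + d A0 A2 * b A3 A4) - (b A0 A3 * d A2 A4 + d A0 A3 * b A2 A4)
    + (b A0 A4 * d A2 A3 + d A0 A4 * b A2 A3))"
| "pf A2 b d = ((b A0 A1 * d A3 A4 + d A0 A1 * b A3 A4) - (b A0 A3 * d A1 A4 + d A0 A3 * b A1 A4)
    + (b A0 A4 * d A1 A3 + d A0 A4 * b A1 A3))"
| "pf A3 b d = - ((b A0 A1 * d A2 A4 + d A0 A1 * b A2 A4) - (b A0 A2 * d A1 A4 + d A0 A2 * b A1 A4)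
    + (b A0 A4 * d A1 A2 + d A0 A4 * b A1 A2))"
| "pf A4 b d = ((b A0 A1 * d A2 A3 + d A0 A1 * b A2 A3) - (b A0 A2 * d A1 A3 + d A0 A2 * b A1 A3)
    + (b A0 A3 * d A1 A2 + d A0 A3 * b A1 A2))"

text \<open>In the coordinates \<open>(a, b, c)\<close> the quadrics are \<open>2 a c - b \<and> b\<close> and the contraction of \<open>b\<close>
  with \<open>c\<close>, the classical equations of the spinor tenfold.\<close>

lemma quadric_f:
  "pairing s (cl (f m) s') = kappa * (a_coord s * c_coord s' m + a_coord s' * c_coord s m
     - pf m (b_coord s) (b_coord s'))"
  by (subst spinor_expansion[of s'], cases m;
      simp add: frame_simps pairing_linear pairing_minus pairing_diff pairing_triple pairing_tau[unfolded tau_def]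
          pairing_f;
      simp add: algebra_simps)

lemma quadric_e:
  "pairing s (cl (e i) s') = kappa * (\<Sum>j\<in>UNIV. b_coord s i j * c_coord s' j + b_coord s' i j * c_coord s j)"
  by (subst spinor_expansion[of s'], cases i;
      simp add: frame_simps pairing_linear pairing_minus pairing_diff pairing_triple pairing_tau[unfolded tau_def]
          pairing_f sum_five;
      simp add: b_coord_skew[of _ A1 A0] b_coord_skew[of _ A2 A0] b_coord_skew[of _ A3 A0] b_coord_skew[of _ A4 A0]
        b_coord_skew[of _ A2 A1] b_coord_skew[of _ A3 A1] b_coord_skew[of _ A4 A1]
        b_coord_skew[of _ A3 A2] b_coord_skew[of _ A4 A2] b_coord_skew[of _ A4 A3] algebra_simps)

end

section \<open>Five quadrics on a 4-dimensional space\<close>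

definition polynomial_fun :: "('a::comm_ring_1 \<Rightarrow> 'a) \<Rightarrow> bool" where
  "polynomial_fun h \<longleftrightarrow> (\<exists>p. \<forall>x. h x = poly p x)"

lemma polynomial_fun_const: "polynomial_fun (\<lambda>_. c)"
  unfolding polynomial_fun_def by (rule exI[of _ "[:c:]"]) simp

lemma polynomial_fun_id: "polynomial_fun (\<lambda>x. x)"
  unfolding polynomial_fun_def by (rule exI[of _ "[:0, 1:]"]) simp

lemma polynomial_fun_add: "polynomial_fun f \<Longrightarrow> polynomial_fun g \<Longrightarrow> polynomial_fun (\<lambda>x. f x + g x)"
  unfolding polynomial_fun_def by (metis poly_add)

lemma polynomial_fun_mult: "polynomial_fun f \<Longrightarrow> polynomial_fun g \<Longrightarrow> polynomial_fun (\<lambda>x. f x * g x)"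
  unfolding polynomial_fun_def by (metis poly_mult)

lemma polynomial_fun_diff: "polynomial_fun f \<Longrightarrow> polynomial_fun g \<Longrightarrow> polynomial_fun (\<lambda>x. f x - g x)"
  unfolding polynomial_fun_def by (metis poly_diff)

lemma polynomial_fun_sum: "(\<And>i. i \<in> I \<Longrightarrow> polynomial_fun (f i)) \<Longrightarrow> polynomial_fun (\<lambda>x. \<Sum>i\<in>I. f i x)"
  by (induction I rule: infinite_finite_induct) (auto intro: polynomial_fun_const polynomial_fun_add)

lemma polynomial_fun_prod: "(\<And>i. i \<in> I \<Longrightarrow> polynomial_fun (f i)) \<Longrightarrow> polynomial_fun (\<lambda>x. \<Prod>i\<in>I. f i x)"
  by (induction I rule: infinite_finite_induct) (auto intro: polynomial_fun_const polynomial_fun_mult)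

lemma det_leibniz:
  "det (mat n n (\<lambda>(i, j). m i j)) = (\<Sum>p | p permutes {0..<n}. signof p * (\<Prod>i = 0..<n. m i (p i)))"
  by (subst det_def'[of _ n]) (auto intro!: sum.cong prod.cong dest: permutes_in_image)

lemma polynomial_fun_det:
  assumes "\<And>i j. i < n \<Longrightarrow> j < n \<Longrightarrow> polynomial_fun (\<lambda>x. m x i j)"
  shows "polynomial_fun (\<lambda>x. det (mat n n (\<lambda>(i, j). m x i j)))"
  unfolding det_leibniz
  by (intro polynomial_fun_sum polynomial_fun_mult polynomial_fun_prod polynomial_fun_const assms)
     (auto dest: permutes_in_image)

text \<open>Applied to the affine pieces of a projective line, this replaces the statement that a form of positive
  degree has a zero.\<close>

lemma polynomial_fun_root_or_const:
  fixes h :: "'k::alg_closed_field \<Rightarrow> 'k"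
  assumes "polynomial_fun h"
  shows "(\<exists>x. h x = 0) \<or> (\<forall>x y. h x = h y)"
proof -
  obtain p where p: "\<And>x. h x = poly p x" using assms unfolding polynomial_fun_def by blast
  show ?thesis
  proof (cases "degree p = 0")
    case True
    then obtain a where "p = [:a:]" by (rule degree_eq_zeroE)
    with p show ?thesis by simp
  next
    case False
    then show ?thesis using alg_closed_imp_poly_has_root[of p] p by auto
  qed
qed

lemma quadratic_form_root:
  fixes a b c :: "'k::alg_closed_field"
  shows "\<exists>x y. (x \<noteq> 0 \<or> y \<noteq> 0) \<and> a * x\<^sup>2 + b * (x * y) + c * y\<^sup>2 = 0"
proof (cases "c = 0")
  case True
  then show ?thesis by (intro exI[of _ 0] exI[of _ 1]) simp
next
  case False
  then have "degree [:a, b, c:] > 0" by simp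
  from alg_closed_imp_poly_has_root[OF this] obtain y where "poly [:a, b, c:] y = 0" by blast
  then show ?thesis by (intro exI[of _ 1] exI[of _ y]) (simp add: power2_eq_square algebra_simps)
qed

text \<open>The principal minor with the rows and columns \<open>i\<close>, \<open>j\<close>, \<open>k\<close>.\<close>

definition det3 :: "(nat \<Rightarrow> nat \<Rightarrow> 'a::comm_ring_1) \<Rightarrow> nat \<Rightarrow> nat \<Rightarrow> nat \<Rightarrow> 'a" where
  "det3 g i j k = g i i * (g j j * g k k - g j k * g k j) - g i j * (g j i * g k k - g j k * g k i)
    + g i k * (g j i * g k j - g j j * g k i)"

lemma det_mat_2: "det (mat 2 2 m) = m (0, 0) * m (1, 1) - m (0, 1) * m (1, 0)"
  for m :: "nat \<times> nat \<Rightarrow> 'a::comm_ring_1"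
proof -
  have "mat_delete (mat 2 2 m) i 0 = mat 1 1 (\<lambda>_. m (1 - i, 1))" if "i < 2" for i
    using that by (intro eq_matI) (auto simp: mat_delete_def less_2_cases_iff)
  then show ?thesis
    by (subst laplace_expansion_column[of _ 2 0])
       (auto simp: cofactor_def det_single eval_nat_numeral lessThan_Suc algebra_simps)
qed

lemma det_mat_3: "det (mat 3 3 (\<lambda>(i, j). g i j)) = det3 g 0 1 2"
proof -
  have "mat_delete (mat 3 3 (\<lambda>(i, j). g i j)) i 0 =
      mat 2 2 (\<lambda>(k, j). g (if k < i then k else Suc k) (Suc j))" if "i < 3" for i
    using that by (intro eq_matI) (auto simp: mat_delete_def)
  note del = this
  have "{..<3} = {0, 1, 2::nat}" by auto
  then have "det (mat 3 3 (\<lambda>(i, j). g i j)) = g 0 0 * cofactor (mat 3 3 (\<lambda>(i, j). g i j)) 0 0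
      + g 1 0 * cofactor (mat 3 3 (\<lambda>(i, j). g i j)) 1 0 + g 2 0 * cofactor (mat 3 3 (\<lambda>(i, j). g i j)) 2 0"
    by (subst laplace_expansion_column[of _ 3 0]) (simp_all add: add.assoc)
  also have "cofactor (mat 3 3 (\<lambda>(i, j). g i j)) 0 0 = g 1 1 * g 2 2 - g 1 2 * g 2 1"
    using del[of 0] by (simp add: cofactor_def det_mat_2[unfolded numeral_2_eq_2] numeral_2_eq_2)
  also have "cofactor (mat 3 3 (\<lambda>(i, j). g i j)) 1 0 = - (g 0 1 * g 2 2 - g 0 2 * g 2 1)"
    using del[of 1] by (simp add: cofactor_def det_mat_2[unfolded numeral_2_eq_2] numeral_2_eq_2)
  also have "cofactor (mat 3 3 (\<lambda>(i, j). g i j)) 2 0 = g 0 1 * g 1 2 - g 0 2 * g 1 1"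
    using del[of 2] by (simp add: cofactor_def det_mat_2[unfolded numeral_2_eq_2] numeral_2_eq_2)
  finally show ?thesis by (simp add: det3_def algebra_simps)
qed

lemma det3_zero_kernel:
  fixes g :: "nat \<Rightarrow> nat \<Rightarrow> 'a::field"
  assumes "det3 g i j k = 0"
  shows "\<exists>x y z. (x \<noteq> 0 \<or> y \<noteq> 0 \<or> z \<noteq> 0) \<and> (\<forall>n\<in>{i, j, k}. x * g i n + y * g j n + z * g k n = 0)"
proof -
  define M where "M = mat 3 3 (\<lambda>(r, c). g ([i, j, k] ! c) ([i, j, k] ! r))"
  have M: "M \<in> carrier_mat 3 3" by (simp add: M_def)
  have "det M = 0"
    using assms by (simp add: M_def det_mat_3) (simp add: det3_def numeral_2_eq_2 algebra_simps)
  then obtain v where v: "v \<in> carrier_vec 3" "v \<noteq> 0\<^sub>v 3" "M *\<^sub>v v = 0\<^sub>v 3"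
    using det_0_iff_vec_prod_zero_field[OF M] by blast
  have "v $ 0 * g i n + v $ 1 * g j n + v $ 2 * g k n = 0" if n: "n \<in> {i, j, k}" for n
  proof -
    obtain r where r: "r < 3" "n = [i, j, k] ! r"
    proof -
      consider "n = i" | "n = j" | "n = k" using n by auto
      then show ?thesis by cases (auto intro: that[of 0] that[of 1] that[of 2])
    qed
    have "(M *\<^sub>v v) $ r = 0" using v(3) r(1) by simp
    moreover have "(M *\<^sub>v v) $ r = (\<Sum>c\<in>{0..<3}. g ([i, j, k] ! c) n * v $ c)"
      using r v(1) by (simp add: M_def scalar_prod_def)
    moreover have "{0..<3} = {0, 1, 2::nat}" by auto
    ultimately show ?thesis by (simp add: algebra_simps)
  qed
  moreover have "v $ 0 \<noteq> 0 \<or> v $ 1 \<noteq> 0 \<or> v $ 2 \<noteq> 0"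
  proof (rule ccontr)
    assume *: "\<not> ?thesis"
    have "v = 0\<^sub>v 3"
    proof (rule eq_vecI)
      fix r assume "r < dim_vec (0\<^sub>v 3 :: 'a vec)"
      then have "r = 0 \<or> r = 1 \<or> r = 2" by auto
      with * show "v $ r = 0\<^sub>v 3 $ r" by auto
    qed (use v(1) in auto)
    with v(2) show False by blast
  qed
  ultimately show ?thesis by blast
qed

lemma det3_pencil:
  fixes g h :: "nat \<Rightarrow> nat \<Rightarrow> 'k::alg_closed_field"
  shows "\<exists>x y. (x \<noteq> 0 \<or> y \<noteq> 0) \<and> det3 (\<lambda>m n. x * g m n + y * h m n) i j k = 0"
proof (cases "det3 h i j k = 0")
  case True
  then show ?thesis by (intro exI[of _ 0] exI[of _ 1]) simp
next
  case False
  define D where "D a b c = a i * (b j * c k - b k * c j) - a j * (b i * c k - b k * c i) + a k * (b i * c j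
      - b j * c i)"
    for a b c :: "nat \<Rightarrow> 'k"
  define P where "P = [:det3 g i j k, D (h i) (g j) (g k) + D (g i) (h j) (g k) + D (g i) (g j) (h k),
    D (g i) (h j) (h k) + D (h i) (g j) (h k) + D (h i) (h j) (g k), det3 h i j k:]"
  have "degree P > 0" using False by (simp add: P_def)
  then obtain y where y: "poly P y = 0" using alg_closed_imp_poly_has_root by blast
  have "det3 (\<lambda>m n. 1 * g m n + y * h m n) i j k = poly P y"
    by (simp add: P_def D_def det3_def algebra_simps)
  with y show ?thesis by (intro exI[of _ 1] exI[of _ y]) simp
qed

text \<open>Let a symmetric matrix of size 4 have \<open>p\<close> with coordinates \<open>x, y, 0, 0\<close> in its kernel. Its adjugate
  is then a multiple of \<open>p p\<^sup>T\<close>, so the principal minors omitting the first and the second index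
  are in the ratio \<open>x\<^sup>2 : y\<^sup>2\<close>. Here \<open>a\<close> and \<open>b\<close> are the first two rows and
  \<open>c, e, d\<close> the entries of the last block.\<close>

lemma minor_relation:
  fixes x y :: "'a::comm_ring_1"
  assumes "x * a0 = - (y * a1)" "x * a1 = - (y * b1)" "x * a2 = - (y * b2)" "x * a3 = - (y * b3)"
  shows "x\<^sup>2 * (a0 * (c * d - e * e) - a2 * (a2 * d - e * a3) + a3 * (a2 * e - c * a3)) =
    y\<^sup>2 * (b1 * (c * d - e * e) - b2 * (b2 * d - e * b3) + b3 * (b2 * e - c * b3))"
proof -
  have a0: "x * (x * a0) = y * (y * b1)"
    by (simp only: assms(1) mult_minus_right mult.left_commute[of x y] assms(2) minus_minus)
  have "x\<^sup>2 * (a0 * (c * d - e * e) - a2 * (a2 * d - e * a3) + a3 * (a2 * e - c * a3)) =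
      (x * (x * a0)) * (c * d - e * e) - (x * a2) * ((x * a2) * d - e * (x * a3))
      + (x * a3) * ((x * a2) * e - c * (x * a3))"
    by (simp add: power2_eq_square algebra_simps)
  also have "\<dots> = y\<^sup>2 * (b1 * (c * d - e * e) - b2 * (b2 * d - e * b3) + b3 * (b2 * e - c * b3))"
    unfolding a0 assms(3,4) by (simp add: power2_eq_square algebra_simps)
  finally show ?thesis .
qed

lemma det3_scale: "det3 (\<lambda>m n. c * g m n) i j k = c ^ 3 * det3 g i j k"
  by (simp add: det3_def power3_eq_cube algebra_simps)

text \<open>Five symmetric bilinear forms \<open>A 0, \<dots>, A 4\<close> in four variables.\<close>

locale quadric_web =
  fixes A :: "nat \<Rightarrow> nat \<Rightarrow> nat \<Rightarrow> 'k::{alg_closed_field, field_char_0}"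
  assumes sym: "A i m n = A i n m"
begin

definition G :: "(nat \<Rightarrow> 'k) \<Rightarrow> nat \<Rightarrow> nat \<Rightarrow> 'k" where
  "G l m n = (\<Sum>i<5. l i * A i m n)"

text \<open>The member of the linear system with coefficients \<open>l\<close> has \<open>p\<close> in its kernel.\<close>

definition singular_at :: "(nat \<Rightarrow> 'k) \<Rightarrow> (nat \<Rightarrow> 'k) \<Rightarrow> bool" where
  "singular_at l p \<longleftrightarrow> (\<forall>n<4. (\<Sum>m<4. p m * G l m n) = 0)"

definition corank_two_member :: bool where
  "corank_two_member \<longleftrightarrow> (\<exists>l x y. (\<exists>i<5. l i \<noteq> 0) \<and> singular_at l x \<and> singular_at l y \<and>
     (\<forall>r s. (\<forall>m<4. r * x m + s * y m = 0) \<longrightarrow> r = 0 \<and> s = 0))"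

lemma G_sym: "G l m n = G l n m"
  by (simp add: G_def sym[of _ m n])

text \<open>Points \<open>p\<close> on the line of the first two coordinates are treated in the two charts \<open>p z \<noteq> 0\<close>;
  \<open>h\<close> is the other coordinate.\<close>

definition chart :: "nat \<Rightarrow> nat \<Rightarrow> bool" where
  "chart z h \<longleftrightarrow> (z = 0 \<and> h = 1) \<or> (z = 1 \<and> h = 0)"

lemma sum_chart: "chart z h \<Longrightarrow> (\<Sum>m<4. F m) = F z + F h + F 2 + (F 3 :: 'k)"
  by (auto simp: chart_def eval_nat_numeral)

lemma less_4: "n < 4 \<longleftrightarrow> n = 0 \<or> n = 1 \<or> n = 2 \<or> n = (3::nat)"
  by auto

text \<open>A form with \<open>p\<close> in its kernel lives on the quotient by \<open>p\<close>, where \<open>h\<close>, 2 and 3 are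
  coordinates. If it is degenerate there, its kernel has dimension at least two.\<close>

lemma member_from_det3:
  assumes c: "chart z h" and l: "i < 5" "l i \<noteq> 0" and s: "singular_at l p" and p: "p z \<noteq> 0"
    and d: "det3 (G l) h 2 3 = 0"
  shows corank_two_member
proof -
  obtain r1 r2 r3 where r: "r1 \<noteq> 0 \<or> r2 \<noteq> 0 \<or> r3 \<noteq> 0"
    and k: "\<And>n. n \<in> {h, 2, 3} \<Longrightarrow> r1 * G l h n + r2 * G l 2 n + r3 * G l 3 n = 0"
    using det3_zero_kernel[OF d] by blast
  define x where "x = (\<lambda>m. if m = h then r1 else if m = 2 then r2 else if m = 3 then r3 else 0)"
  have x: "x z = 0" "x h = r1" "x 2 = r2" "x 3 = r3" using c by (auto simp: x_def chart_def)
  have pz: "p z * G l z n = - (p h * G l h n + p 2 * G l 2 n + p 3 * G l 3 n)" if "n < 4" for n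
    using s that unfolding singular_at_def sum_chart[OF c]
        by (simp add: eq_neg_iff_add_eq_0 add.assoc del: minus_add_distrib)
  have lt: "h < 4" using c by (auto simp: chart_def)
  have "p z * (r1 * G l z h + r2 * G l z 2 + r3 * G l z 3) =
      r1 * (p z * G l z h) + r2 * (p z * G l z 2) + r3 * (p z * G l z 3)" by (simp add: algebra_simps)
  also have "\<dots> = - (p h * (r1 * G l h h + r2 * G l 2 h + r3 * G l 3 h)
      + p 2 * (r1 * G l h 2 + r2 * G l 2 2 + r3 * G l 3 2) + p 3 * (r1 * G l h 3 + r2 * G l 2 3 + r3 * G l 3 3))"
    using lt by (simp add: pz G_sym[of l 2 h] G_sym[of l 3 h] G_sym[of l 3 2] algebra_simps)
  also have "\<dots> = 0" by (simp add: k)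
  finally have kz: "r1 * G l h z + r2 * G l 2 z + r3 * G l 3 z = 0"
    using p by (simp add: G_sym[of l _ z])
  have "singular_at l x"
    unfolding singular_at_def sum_chart[OF c] x
  proof (intro allI impI)
    fix n :: nat assume "n < 4"
    then have "n = z \<or> n \<in> {h, 2, 3}" using c by (auto simp: chart_def)
    then show "0 * G l z n + r1 * G l h n + r2 * G l 2 n + r3 * G l 3 n = 0"
      using k kz by auto
  qed
  moreover have "r = 0 \<and> t = 0" if rt: "\<forall>m<4. r * p m + t * x m = 0" for r t
  proof -
    have z: "z < 4" using c by (auto simp: chart_def)
    have "r = 0" using rt[rule_format, OF z] p x by simp
    with rt lt have "t * x h = 0" "t * x 2 = 0" "t * x 3 = 0" by auto
    with x r \<open>r = 0\<close> show ?thesis by auto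
  qed
  ultimately show corank_two_member unfolding corank_two_member_def using l s by blast
qed

text \<open>In a pencil of forms which are all singular at \<open>p\<close>, one is degenerate modulo \<open>p\<close>.\<close>

lemma member_from_pencil:
  assumes c: "chart z h" and p: "p z \<noteq> 0" and s: "singular_at l p" "singular_at l' p"
    and ind: "\<And>x y. (\<forall>i<5. x * l i + y * l' i = 0) \<Longrightarrow> x = 0 \<and> y = 0"
  shows corank_two_member
proof -
  obtain x y where xy: "x \<noteq> 0 \<or> y \<noteq> 0" "det3 (\<lambda>m n. x * G l m n + y * G l' m n) h 2 3 = 0"
    using det3_pencil[of "G l" "G l'" h 2 3] by blast
  define k where "k = (\<lambda>i. x * l i + y * l' i)"
  have G: "G k m n = x * G l m n + y * G l' m n" for m n
    by (simp add: G_def k_def sum_distrib_left sum.distrib algebra_simps)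
  have sk: "singular_at k p"
    unfolding singular_at_def
  proof (intro allI impI)
    fix n :: nat assume n: "n < 4"
    have "(\<Sum>m<4. p m * G k m n) = x * (\<Sum>m<4. p m * G l m n) + y * (\<Sum>m<4. p m * G l' m n)"
      by (simp add: G sum_distrib_left sum.distrib algebra_simps)
    with s n show "(\<Sum>m<4. p m * G k m n) = 0" by (simp add: singular_at_def)
  qed
  obtain i where i: "i < 5" "k i \<noteq> 0" using ind[of x y] xy(1) unfolding k_def by blast
  have "det3 (G k) h 2 3 = 0" using xy(2) by (simp add: G det3_def)
  from member_from_det3[OF c i sk p this] show corank_two_member .
qed

text \<open>The columns of the matrix \<open>T p\<close> of size 4 by 5 are the linear forms \<open>A c\<close> applied to \<open>p\<close>. Its
  kernel consists of the members singular at \<open>p\<close>, and its signed maximal minors \<open>L p\<close>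
  are an element of the kernel, of degree 4 in \<open>p\<close>. The last row \<open>w\<close> of \<open>M\<close> is arbitrary, so that
  expansion along it evaluates \<open>L p\<close> on any linear form.\<close>

definition T :: "(nat \<Rightarrow> 'k) \<Rightarrow> nat \<Rightarrow> nat \<Rightarrow> 'k" where
  "T p r c = (\<Sum>m<4. p m * A c m r)"

definition M :: "(nat \<Rightarrow> 'k) \<Rightarrow> (nat \<Rightarrow> 'k) \<Rightarrow> 'k mat" where
  "M p w = mat 5 5 (\<lambda>(r, c). if r < 4 then T p r c else w c)"

definition L :: "(nat \<Rightarrow> 'k) \<Rightarrow> nat \<Rightarrow> 'k" where
  "L p c = cofactor (M p (\<lambda>_. 0)) 4 c"

lemma M_carrier: "M p w \<in> carrier_mat 5 5"
  by (simp add: M_def)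

lemma mat_delete_M:
  "c < 5 \<Longrightarrow> mat_delete (M p w) 4 c = mat 4 4 (\<lambda>(i, j). T p i (if j < c then j else Suc j))"
  by (rule eq_matI) (auto simp: M_def mat_delete_def)

lemma L_eq: "c < 5 \<Longrightarrow> L p c = (- 1) ^ (4 + c) * det (mat 4 4 (\<lambda>(i, j). T p i (if j < c then j else Suc j)))"
  by (simp add: L_def cofactor_def mat_delete_M)

lemma det_M: "det (M p w) = (\<Sum>c<5. w c * L p c)"
proof -
  have "det (M p w) = (\<Sum>c<5. M p w $$ (4, c) * cofactor (M p w) 4 c)"
    by (rule laplace_expansion_row[OF M_carrier]) simp
  also have "\<dots> = (\<Sum>c<5. w c * L p c)"
    by (rule sum.cong) (auto simp: M_def[of p w] L_eq cofactor_def mat_delete_M[unfolded M_def])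
  finally show ?thesis .
qed

lemma sum_T: "(\<Sum>c<5. T p n c * l c) = (\<Sum>m<4. p m * G l m n)"
  unfolding T_def G_def sum_distrib_left sum_distrib_right
  by (subst sum.swap) (simp add: algebra_simps)

lemma singular_L: "singular_at (L p) p"
  unfolding singular_at_def
proof (intro allI impI)
  fix n :: nat assume n: "n < 4"
  have "det (M p (T p n)) = 0"
    by (rule det_identical_rows[OF M_carrier, of n 4])
       (use n in \<open>auto simp: M_def intro!: eq_vecI\<close>)
  then show "(\<Sum>m<4. p m * G (L p) m n) = 0" by (simp add: det_M sum_T)
qed

text \<open>If all maximal minors vanish, the kernel of \<open>T p\<close> has dimension at least two and meets every hyperplane
  \<open>w\<close>.\<close>

lemma exists_singular:
  assumes "\<And>c. c < 5 \<Longrightarrow> L p c = 0"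
  shows "\<exists>l. singular_at l p \<and> (\<exists>i<5. l i \<noteq> 0) \<and> (\<Sum>c<5. w c * l c) = 0"
proof -
  have "det (M p w) = 0" using assms by (simp add: det_M)
  then obtain v where v: "v \<in> carrier_vec 5" "v \<noteq> 0\<^sub>v 5" "M p w *\<^sub>v v = 0\<^sub>v 5"
    using det_0_iff_vec_prod_zero_field[OF M_carrier] by blast
  have rows: "(\<Sum>c<5. (if r < 4 then T p r c else w c) * v $ c) = 0" if r: "r < 5" for r
  proof -
    have "(M p w *\<^sub>v v) $ r = (\<Sum>c<5. (if r < 4 then T p r c else w c) * v $ c)"
      using r v(1) by (simp add: M_def scalar_prod_def atLeast0LessThan)
    with v(3) r show ?thesis by simp
  qed
  have "singular_at (\<lambda>c. v $ c) p"
    unfolding singular_at_def sum_T[symmetric]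
  proof (intro allI impI)
    fix n :: nat assume "n < 4"
    with rows[of n] show "(\<Sum>c<5. T p n c * v $ c) = 0" by simp
  qed
  moreover have "(\<Sum>c<5. w c * v $ c) = 0" using rows[of 4] by simp
  moreover have "\<exists>i<5. v $ i \<noteq> 0"
  proof (rule ccontr)
    assume "\<not> ?thesis"
    then have "v = 0\<^sub>v 5" using v(1) by (intro eq_vecI) auto
    with v(2) show False by blast
  qed
  ultimately show ?thesis by blast
qed

lemma member_from_L_zero:
  assumes c: "chart z h" and p: "p z \<noteq> 0" and L: "\<And>c. c < 5 \<Longrightarrow> L p c = 0"
  shows corank_two_member
proof -
  obtain l i where l: "singular_at l p" "i < 5" "l i \<noteq> 0" using exists_singular[of p, OF L] by blast
  obtain l' j where l': "singular_at l' p" "j < 5" "l' j \<noteq> 0"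
    "(\<Sum>c<5. (if c = i then 1 else 0) * l' c) = 0"
    using exists_singular[of p "\<lambda>c. if c = i then 1 else 0", OF L] by blast
  have "l' i = 0"
    using l'(4) l(2) by (simp add: if_distrib[of "\<lambda>c. c * _"] sum.delta cong: if_cong)
  then have "x = 0 \<and> y = 0" if xy: "\<forall>i<5. x * l i + y * l' i = 0" for x y
    using xy[rule_format, OF l(2)] xy[rule_format, OF l'(2)] l(3) l'(3) by auto
  from member_from_pencil[OF c p l(1) l'(1) this] show corank_two_member .
qed

definition pt :: "'k \<Rightarrow> 'k \<Rightarrow> nat \<Rightarrow> 'k" where
  "pt x y m = (if m = 0 then x else if m = 1 then y else 0)"

lemma L_scale: "c < 5 \<Longrightarrow> L (pt (t * x) (t * y)) c = t ^ 4 * L (pt x y) c"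
proof -
  assume c: "c < 5"
  have "mat 4 4 (\<lambda>(i, j). T (pt (t * x) (t * y)) i (if j < c then j else Suc j)) =
      t \<cdot>\<^sub>m mat 4 4 (\<lambda>(i, j). T (pt x y) i (if j < c then j else Suc j))"
    by (rule eq_matI) (auto simp: T_def pt_def sum_distrib_left algebra_simps intro!: sum.cong)
  then show ?thesis by (simp add: L_eq[OF c])
qed

lemma polynomial_fun_L:
  assumes "\<And>m. m < 4 \<Longrightarrow> polynomial_fun (\<lambda>x. p x m)" "c < 5"
  shows "polynomial_fun (\<lambda>x. L (p x) c)"
  unfolding L_eq[OF assms(2)] T_def
  by (intro polynomial_fun_mult polynomial_fun_const polynomial_fun_det polynomial_fun_sum assms(1)) auto

lemma polynomial_fun_det3_L:
  assumes "\<And>m. m < 4 \<Longrightarrow> polynomial_fun (\<lambda>x. p x m)"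
  shows "polynomial_fun (\<lambda>x. det3 (G (L (p x))) i j k)"
  unfolding det3_def G_def
  by (intro polynomial_fun_add polynomial_fun_diff polynomial_fun_mult polynomial_fun_sum
      polynomial_fun_const polynomial_fun_L assms) auto

text \<open>For \<open>p\<close> on a line, the form with coefficients \<open>L p\<close> has \<open>p\<close> in its kernel, so its adjugate is
  \<open>\<lambda>(p) p p\<^sup>T\<close> with \<open>\<lambda>\<close> homogeneous of degree \<open>3 * 4 - 2 = 10\<close> in \<open>p\<close>. At
  a zero of \<open>\<lambda>\<close> either \<open>L p\<close> vanishes, and there is a pencil of members singular at \<open>p\<close>, or the
  corresponding member has corank at least two.

  To avoid dividing by \<open>p p\<^sup>T\<close>, the proof uses the two minors \<open>?D 1 = x\<^sup>2 \<lambda>\<close> and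
  \<open>?D 0 = y\<^sup>2 \<lambda>\<close>. Without a zero of \<open>\<lambda>\<close>, they are constant for \<open>x = 1\<close> and for \<open>y = 1\<close>
  respectively, and comparing their values at \<open>(2, 1)\<close> and \<open>(1, 1)\<close> contradicts homogeneity.\<close>

theorem corank_two_member: corank_two_member
proof (rule ccontr)
  assume ng: "\<not> corank_two_member"
  have c0: "chart 0 1" and c1: "chart 1 0" by (auto simp: chart_def)
  have nz: "det3 (G (L p)) h 2 3 \<noteq> 0" if c: "chart z h" and p: "p z \<noteq> 0" for p z h
  proof
    assume d: "det3 (G (L p)) h 2 3 = 0"
    show False
    proof (cases "\<forall>c<5. L p c = 0")
      case True
      have corank_two_member by (rule member_from_L_zero[of z h p]) (use c p True in auto)
      with ng show False by blast
    next
      case False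
      then obtain i where "i < 5" "L p i \<noteq> 0" by blast
      from member_from_det3[OF c this singular_L p d] ng show False by blast
    qed
  qed
  let ?D = "\<lambda>h x y. det3 (G (L (pt x y))) h 2 3"
  have "polynomial_fun (\<lambda>y. ?D 1 1 y)" "polynomial_fun (\<lambda>x. ?D 0 x 1)"
    by (auto intro!: polynomial_fun_det3_L simp: pt_def polynomial_fun_const polynomial_fun_id less_4)
  from this[THEN polynomial_fun_root_or_const]
  have const: "?D 1 1 y = ?D 1 1 y'" "?D 0 x 1 = ?D 0 x' 1" for x x' y y'
    using nz[OF c0, of "pt 1 _"] nz[OF c1, of "pt _ 1"] by (auto simp: pt_def)
  have rel: "x\<^sup>2 * ?D 0 x y = y\<^sup>2 * ?D 1 x y" for x y
  proof -
    let ?g = "G (L (pt x y))"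
    have "x * ?g 0 n + y * ?g 1 n = 0" if "n < 4" for n
      using singular_L[of "pt x y"] that unfolding singular_at_def
      by (simp add: pt_def eval_nat_numeral)
    from this[of 0] this[of 1] this[of 2] this[of 3]
    have g: "x * ?g 0 0 = - (y * ?g 0 1)" "x * ?g 0 1 = - (y * ?g 1 1)" "x * ?g 0 2 = - (y * ?g 1 2)"
      "x * ?g 0 3 = - (y * ?g 1 3)"
      by (simp_all add: eq_neg_iff_add_eq_0 G_sym[of _ "Suc 0" 0])
    show ?thesis
      unfolding det3_def G_sym[of _ 2 0] G_sym[of _ 2 1] G_sym[of _ 3 0] G_sym[of _ 3 1] G_sym[of _ 3 2]
      by (rule minor_relation[OF g])
  qed
  \<comment> \<open>\<open>?D 1\<close> is homogeneous of degree 12; scale \<open>(2, 1)\<close> to \<open>(1, 1/2)\<close>.\<close>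
  have "?D 1 2 1 = (2 ^ 4) ^ 3 * ?D 1 1 (1/2)"
  proof -
    have "G (L (pt 2 1)) m n = 2 ^ 4 * G (L (pt 1 (1/2))) m n" for m n
    proof -
      have "L (pt 2 1) c = 2 ^ 4 * L (pt 1 (1/2)) c" if "c < 5" for c
        using L_scale[OF that, of 2 1 "1/2"] by simp
      then show ?thesis unfolding G_def sum_distrib_left by (intro sum.cong) auto
    qed
    then have "G (L (pt 2 1)) = (\<lambda>m n. 2 ^ 4 * G (L (pt 1 (1/2))) m n)" by (intro ext)
    then show ?thesis by (simp only: det3_scale)
  qed
  then have "?D 1 2 1 = 4096 * ?D 1 1 1" using const(1)[of "1/2" 1] by simp
  moreover have "?D 0 1 1 = ?D 1 1 1" using rel[of 1 1] by simp
  moreover have "4 * ?D 0 2 1 = ?D 1 2 1" using rel[of 2 1] by simp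
  moreover have "?D 0 2 1 = ?D 0 1 1" by (rule const)
  ultimately have "4 * ?D 1 1 1 = 4096 * ?D 1 1 1" by simp
  then have "?D 1 1 1 = 0" by simp
  moreover have "?D 1 1 1 \<noteq> 0" by (rule nz[OF c0]) (simp add: pt_def)
  ultimately show False by blast
qed

end

section \<open>Maximal isotropic subspaces\<close>

context half_spinors
begin

definition hyperbolic :: "(five \<Rightarrow> 'v) \<Rightarrow> (five \<Rightarrow> 'v) \<Rightarrow> bool" where
  "hyperbolic e f \<longleftrightarrow> (\<forall>i j. polar (e i) (e j) = 0 \<and> polar (f i) (f j) = 0 \<and>
     polar (e i) (f j) = (if i = j then 1 else 0))"

lemma polar_sum: "polar v (\<Sum>i\<in>J. sV (c i) (g i)) = (\<Sum>i\<in>J. c i * polar v (g i))"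
  "polar (\<Sum>i\<in>J. sV (c i) (g i)) v = (\<Sum>i\<in>J. c i * polar (g i) v)"
  by (rule V.linear_form_sum[OF linear_form_polar(1)], rule V.linear_form_sum[OF linear_form_polar(2)])

lemma polar_0 [simp]: "polar v 0 = 0" "polar 0 v = 0"
  using polar_linear(2)[of 0 0 v] polar_linear(4)[of v 0 0] by auto

lemma polar_diff: "polar v (x - y) = polar v x - polar v y" "polar (x - y) v = polar x v - polar y v"
  by (rule V.linear_form_diff[OF linear_form_polar(1)], rule V.linear_form_diff[OF linear_form_polar(2)])

lemma polar_span:
  assumes "\<And>a b. a \<in> A \<Longrightarrow> b \<in> B \<Longrightarrow> polar a b = 0" "x \<in> V.span A" "y \<in> V.span B"
  shows "polar x y = 0"
proof (rule V.linear_form_zero_span[OF linear_form_polar(2) _ assms(2)])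
  fix a assume "a \<in> A"
  then show "polar a y = 0"
    using V.linear_form_zero_span[OF linear_form_polar(1) _ assms(3), of a] assms(1) by blast
qed

text \<open>Gram-Schmidt orthogonalization inside \<open>F\<close>: the hypothesis says that \<open>F\<close> separates the points of the span of
  \<open>e\<close>.\<close>

lemma dual_family:
  assumes "finite J" "V.indep_fam J e" "V.subspace F"
    and "\<And>u. u \<in> V.span (e ` J) \<Longrightarrow> (\<And>v. v \<in> F \<Longrightarrow> polar u v = 0) \<Longrightarrow> u = 0"
  shows "\<exists>d. \<forall>j\<in>J. d j \<in> F \<and> (\<forall>i\<in>J. polar (e i) (d j) = (if i = j then 1 else 0))"
  using assms
proof (induction J rule: finite_induct)
  case empty
  show ?case by simp
next
  case (insert m J)
  have fin: "finite (insert m J)" using insert.hyps by simp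
  have inj: "inj_on e (insert m J)" and indI: "V.independent (e ` insert m J)"
    using insert.prems(1) unfolding V.indep_fam_iff[OF fin] by auto
  have "V.independent (e ` J)" by (rule V.independent_mono[OF indI]) auto
  then have ind: "V.indep_fam J e"
    using inj unfolding V.indep_fam_iff[OF insert.hyps(1)] by auto
  have sp: "V.span (e ` J) \<subseteq> V.span (e ` insert m J)" by (intro V.span_mono) auto
  obtain d where d: "\<And>j. j \<in> J \<Longrightarrow> d j \<in> F"
    "\<And>i j. i \<in> J \<Longrightarrow> j \<in> J \<Longrightarrow> polar (e i) (d j) = (if i = j then 1 else 0)"
    using insert.IH[OF ind insert.prems(2)] insert.prems(3) sp by blast
  define p where "p v = v - (\<Sum>j\<in>J. sV (polar (e j) v) (d j))" for v
  have pF: "p v \<in> F" if "v \<in> F" for v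
    unfolding p_def using that insert.prems(2) d(1) by (intro V.subspace_diff V.sum_fam_in_subspace)
  have pJ: "polar (e i) (p v) = 0" if "i \<in> J" for i v
  proof -
    have "(\<Sum>j\<in>J. polar (e j) v * polar (e i) (d j)) = (\<Sum>j\<in>J. if i = j then polar (e j) v else 0)"
      by (rule sum.cong) (simp_all add: d(2)[OF that])
    then show ?thesis
      unfolding p_def polar_diff polar_sum using that insert.hyps(1) by simp
  qed
  \<comment> \<open>The projection \<open>p\<close> makes a vector orthogonal to the \<open>e i\<close> already treated. If all projections were
    orthogonal to \<open>e m\<close>, then \<open>e m\<close>, corrected by the other \<open>e j\<close>, would be orthogonal to \<open>F\<close>.\<close>
  obtain v where v: "v \<in> F" "polar (e m) (p v) \<noteq> 0"
  proof (rule ccontr)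
    assume asm: "\<not> thesis"
    define u where "u = e m - (\<Sum>j\<in>J. sV (polar (e m) (d j)) (e j))"
    have "u = 0"
    proof (rule insert.prems(3))
      show "u \<in> V.span (e ` insert m J)" unfolding u_def
        by (intro V.span_diff V.sum_fam_in_subspace V.subspace_span) (auto intro: V.span_base)
      fix v assume "v \<in> F"
      then have "polar (e m) (p v) = 0" using asm that by blast
      then show "polar u v = 0"
        unfolding p_def u_def polar_diff polar_sum by (simp only: mult.commute)
    qed
    then have "(\<Sum>j\<in>insert m J. sV (if j = m then 1 else - polar (e m) (d j)) (e j)) = 0"
    proof -
      have "(\<Sum>j\<in>J. sV (if j = m then 1 else - polar (e m) (d j)) (e j))
          = (\<Sum>j\<in>J. - sV (polar (e m) (d j)) (e j))"
        using insert.hyps by (intro sum.cong) auto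
      then show ?thesis using \<open>u = 0\<close> insert.hyps by (simp add: u_def sum_negf)
    qed
    from V.indep_famD[OF insert.prems(1) this, of m] show False by simp
  qed
  define dm where "dm = sV (1 / polar (e m) (p v)) (p v)"
  define d' where "d' j = (if j = m then dm else d j - sV (polar (e m) (d j)) dm)" for j
  have dm: "dm \<in> F" "polar (e m) dm = 1" "\<And>i. i \<in> J \<Longrightarrow> polar (e i) dm = 0"
    unfolding dm_def using pF[OF v(1)] insert.prems(2) v(2) pJ
    by (auto simp only: V.subspace_scale polar_linear mult_zero_right) simp
  show ?case
  proof (intro exI[of _ d'] ballI conjI)
    fix j assume j: "j \<in> insert m J"
    show "d' j \<in> F"
      using j d(1) dm(1) insert.prems(2) by (auto simp: d'_def V.subspace_diff V.subspace_scale)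
    fix i assume i: "i \<in> insert m J"
    show "polar (e i) (d' j) = (if i = j then 1 else 0)"
    proof (cases "j = m")
      case True
      then show ?thesis using i dm insert.hyps by (auto simp: d'_def)
    next
      case False
      then have jJ: "j \<in> J" using j by simp
      have "polar (e i) (d' j) = polar (e i) (d j) - polar (e m) (d j) * polar (e i) dm"
        using False by (simp only: d'_def if_False polar_diff polar_linear)
      also have "\<dots> = (if i = j then 1 else 0)"
      proof (cases "i = m")
        case True
        with dm(2) False show ?thesis by simp
      next
        case im: False
        then have "i \<in> J" using i by simp
        with dm(3) d(2) jJ show ?thesis by simp
      qed
      finally show ?thesis .
    qed
  qed
qed

lemma OGr_D:
  assumes "U \<in> OGr"
  shows "V.subspace U" "V.dim U = 5" "\<And>u w. u \<in> U \<Longrightarrow> w \<in> U \<Longrightarrow> polar u w = 0" "\<And>u. u \<in> U \<Longrightarrow> q u = 0"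
proof -
  show *: "V.subspace U" "V.dim U = 5" "\<And>u. u \<in> U \<Longrightarrow> q u = 0"
    using assms by (auto simp: OGr_def V.Gr_def)
  fix u w assume "u \<in> U" "w \<in> U"
  then show "polar u w = 0" using * V.subspace_add[of U u w] by (simp add: polar_def)
qed

lemma OGr_I:
  "V.subspace U \<Longrightarrow> V.dim U = 5 \<Longrightarrow> (\<And>u. u \<in> U \<Longrightarrow> polar u u = 0) \<Longrightarrow> U \<in> OGr"
  using q_eq_0_iff by (auto simp: OGr_def V.Gr_def)

lemma hyperbolic_commute: "hyperbolic e f \<Longrightarrow> hyperbolic f e"
  unfolding hyperbolic_def using polar_commute by metis

lemma hyperbolic_polar_sum:
  assumes "hyperbolic e f"
  shows "polar (\<Sum>i\<in>UNIV. sV (c i) (e i)) (f j) = c j" "polar (\<Sum>i\<in>UNIV. sV (c i) (e i)) (e j) = 0"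
    "polar (\<Sum>i\<in>UNIV. sV (c i) (f i)) (e j) = c j" "polar (\<Sum>i\<in>UNIV. sV (c i) (f i)) (f j) = 0"
proof -
  have h: "polar (e i) (f j) = (if i = j then 1 else 0)" "polar (f i) (e j) = (if i = j then 1 else 0)"
    "polar (e i) (e j) = 0" "polar (f i) (f j) = 0" for i j
    using assms hyperbolic_commute[OF assms] unfolding hyperbolic_def by metis+
  show "polar (\<Sum>i\<in>UNIV. sV (c i) (e i)) (f j) = c j" "polar (\<Sum>i\<in>UNIV. sV (c i) (e i)) (e j) = 0"
    "polar (\<Sum>i\<in>UNIV. sV (c i) (f i)) (e j) = c j" "polar (\<Sum>i\<in>UNIV. sV (c i) (f i)) (f j) = 0"
    unfolding polar_sum h by (simp_all add: if_distrib[of "\<lambda>x. _ * x"] sum.delta cong: if_cong)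
qed

lemma hyperbolic_indep:
  assumes "hyperbolic e f" shows "V.indep_fam UNIV e"
  unfolding V.indep_fam_def
proof (intro allI impI ballI)
  fix c i assume "(\<Sum>i\<in>UNIV. sV (c i) (e i)) = 0"
  then have "polar (\<Sum>i\<in>UNIV. sV (c i) (e i)) (f i) = 0" by simp
  then show "c i = 0" using hyperbolic_polar_sum(1)[OF assms] by metis
qed

lemma hyperbolic_OGr:
  assumes "hyperbolic e f" shows "V.span (range e) \<in> OGr"
proof (rule OGr_I)
  show "V.dim (V.span (range e)) = 5"
    using V.dim_span_indep_fam[OF _ hyperbolic_indep[OF assms]] card_five by simp
  fix u assume u: "u \<in> V.span (range e)"
  show "polar u u = 0"
    by (rule polar_span[OF _ u u]) (use assms in \<open>auto simp: hyperbolic_def\<close>)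
qed auto

lemma hyperbolic_expansion:
  assumes h: "hyperbolic e f"
  shows "x = (\<Sum>i\<in>UNIV. sV (polar x (f i)) (e i)) + (\<Sum>i\<in>UNIV. sV (polar x (e i)) (f i))"
proof -
  define g where "g = case_sum e f"
  have split: "(\<Sum>k\<in>UNIV. sV (c k) (g k)) = (\<Sum>i\<in>UNIV. sV (c (Inl i)) (e i)) + (\<Sum>i\<in>UNIV. sV (c (Inr i)) (f i))" for c
    unfolding UNIV_sum by (subst sum.union_disjoint) (auto simp: g_def sum.reindex)
  have ind: "V.indep_fam UNIV g"
    unfolding V.indep_fam_def
  proof (intro allI impI ballI)
    fix c and k :: "five + five" assume "(\<Sum>k\<in>UNIV. sV (c k) (g k)) = 0"
    then have z: "polar ((\<Sum>i\<in>UNIV. sV (c (Inl i)) (e i)) + (\<Sum>i\<in>UNIV. sV (c (Inr i)) (f i))) v = 0" for v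
      unfolding split by simp
    show "c k = 0"
    proof (cases k)
      case (Inl i)
      from z[of "f i", unfolded polar_linear hyperbolic_polar_sum[OF h]] Inl show ?thesis by simp
    next
      case (Inr i)
      from z[of "e i", unfolded polar_linear hyperbolic_polar_sum[OF h]] Inr show ?thesis by simp
    qed
  qed
  have "card (UNIV :: (five + five) set) = 10"
    unfolding UNIV_sum by (subst card_Un_disjoint) (auto simp: card_image card_five)
  then have "V.span (range g) = UNIV"
    by (intro V.span_fam_eq_subspace[OF _ _ ind]) auto
  then obtain c where "x = (\<Sum>k\<in>UNIV. sV (c k) (g k))"
    using V.in_span_fam_iff[of UNIV x g] by auto
  then have x: "x = (\<Sum>i\<in>UNIV. sV (c (Inl i)) (e i)) + (\<Sum>i\<in>UNIV. sV (c (Inr i)) (f i))"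
    unfolding split .
  have "polar x (f i) = c (Inl i)" "polar x (e i) = c (Inr i)" for i
    by (simp_all only: x polar_linear hyperbolic_polar_sum[OF h] add_0 add_0_right)
  with x show ?thesis by simp
qed

text \<open>A dual family of an isotropic basis becomes isotropic after subtracting half of its Gram matrix.\<close>

lemma hyperbolic_exists:
  assumes U: "U \<in> OGr" and ind: "V.indep_fam UNIV e" and e: "\<And>i. e i \<in> U"
  shows "\<exists>f. hyperbolic e f"
proof -
  have "\<exists>d. \<forall>j\<in>UNIV. d j \<in> UNIV \<and> (\<forall>i\<in>UNIV. polar (e i) (d j) = (if i = j then 1 else 0))"
    by (rule dual_family[OF _ ind]) (auto intro: polar_nondegenerate)
  then obtain d where d: "\<And>i j. polar (e i) (d j) = (if i = j then 1 else 0)" by blast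
  have d': "polar (d j) (e i) = (if i = j then 1 else 0)" for i j
    using d[of i j] polar_commute[of "d j" "e i"] by simp
  have ee: "polar (e i) (e j) = 0" for i j using OGr_D(3)[OF U e e] .
  define f where "f i = d i - (\<Sum>j\<in>UNIV. sV (polar (d i) (d j) / 2) (e j))" for i
  have ef: "polar (e i) (f j) = (if i = j then 1 else 0)" for i j
    unfolding f_def polar_diff polar_sum ee d by simp
  have df: "polar (d i) (f j) = polar (d i) (d j) / 2" for i j
  proof -
    have "polar (d i) (f j) = polar (d i) (d j) - (\<Sum>k\<in>UNIV. polar (d j) (d k) / 2 * (if k = i then 1 else 0))"
      unfolding f_def polar_diff polar_sum d' ..
    also have "(\<Sum>k\<in>UNIV. polar (d j) (d k) / 2 * (if k = i then 1 else 0)) = polar (d j) (d i) / 2"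
      by (simp only: if_distrib[of "\<lambda>x. _ * x"] mult_1_right mult_zero_right) (simp add: sum.delta)
    finally show ?thesis using polar_commute[of "d i" "d j"] by (simp add: field_simps)
  qed
  have "polar (f i) (f j) = 0" for i j
  proof -
    have "polar (f i) (f j) = polar (d i) (f j) - (\<Sum>k\<in>UNIV. polar (d i) (d k) / 2 * polar (e k) (f j))"
      by (simp only: f_def[of i] polar_diff(2) polar_sum(2))
    also have "(\<Sum>k\<in>UNIV. polar (d i) (d k) / 2 * polar (e k) (f j)) = polar (d i) (d j) / 2"
      by (simp only: ef if_distrib[of "\<lambda>x. _ * x"] mult_1_right mult_zero_right) (simp add: sum.delta)
    finally show ?thesis unfolding df by simp
  qed
  with ee ef show ?thesis unfolding hyperbolic_def by blast
qed

text \<open>A change of basis of one isotropic subspace is complemented by the contragredient change of basis of the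
  other one.\<close>

lemma hyperbolic_rebase:
  assumes h: "hyperbolic e f" and ind: "V.indep_fam UNIV e'" and e': "\<And>i. e' i \<in> V.span (range e)"
  shows "\<exists>f'. (\<forall>i. f' i \<in> V.span (range f)) \<and> hyperbolic e' f'"
proof -
  have "\<exists>d. \<forall>j\<in>UNIV. d j \<in> V.span (range f) \<and> (\<forall>i\<in>UNIV. polar (e' i) (d j) = (if i = j then 1 else 0))"
  proof (rule dual_family[OF _ ind])
    fix u assume u: "u \<in> V.span (range e')" and z: "\<And>v. v \<in> V.span (range f) \<Longrightarrow> polar u v = 0"
    have "V.span (range e') \<subseteq> V.span (range e)" using e' by (intro V.span_minimal) auto
    with u obtain c where c: "u = (\<Sum>i\<in>UNIV. sV (c i) (e i))" using V.in_span_fam_iff[of UNIV u e] by auto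
    have "c i = 0" for i
      using z[of "f i"] unfolding c hyperbolic_polar_sum[OF h] by (auto intro: V.span_base)
    then show "u = 0" by (simp add: c)
  qed auto
  then obtain f' where f': "\<And>i. f' i \<in> V.span (range f)"
      "\<And>i j. polar (e' i) (f' j) = (if i = j then 1 else 0)" by blast
  moreover have "polar (e' i) (e' j) = 0" for i j
    using OGr_D(3)[OF hyperbolic_OGr[OF h] e' e'] .
  moreover have "polar (f' i) (f' j) = 0" for i j
    using OGr_D(3)[OF hyperbolic_OGr[OF hyperbolic_commute[OF h]] f'(1) f'(1)] .
  ultimately show ?thesis unfolding hyperbolic_def by blast
qed

lemma OGr_basis:
  assumes "U \<in> OGr" shows "\<exists>e f. hyperbolic e f \<and> V.span (range e) = U"
proof -
  obtain e :: "five \<Rightarrow> 'v" where e: "V.indep_fam UNIV e" "V.span (range e) = U"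
    using V.exists_fam[OF OGr_D(1)[OF assms], of "UNIV :: five set"] OGr_D(2)[OF assms] card_five by auto
  then have "e i \<in> U" for i using V.span_base[of "e i" "range e"] by auto
  with hyperbolic_exists[OF assms e(1)] e(2) show ?thesis by blast
qed

lemma OGr_maximal:
  assumes U: "U \<in> OGr" and x: "\<And>u. u \<in> U \<Longrightarrow> polar u x = 0"
  shows "x \<in> U"
proof -
  obtain e f where h: "hyperbolic e f" "V.span (range e) = U" using OGr_basis[OF U] by blast
  have "polar x (e i) = 0" for i
    using x[of "e i"] h(2) V.span_base[of "e i" "range e"] polar_commute[of x "e i"] by auto
  then have "x = (\<Sum>i\<in>UNIV. sV (polar x (f i)) (e i))"
    using hyperbolic_expansion[OF h(1), of x] by simp
  also have "\<dots> \<in> V.span (range e)" by (intro V.sum_fam_in_subspace V.subspace_span) (auto intro: V.span_base)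
  finally show ?thesis using h(2) by simp
qed

text \<open>The reflection of \<open>U\<close> in the isotropic vector \<open>v\<close> is the maximal isotropic subspace through \<open>v\<close> that
  meets \<open>U\<close> in a hyperplane.\<close>

lemma OGr_reflect:
  assumes U: "U \<in> OGr" and v: "q v = 0" "v \<notin> U"
  shows "\<exists>W\<in>OGr. v \<in> W \<and> (\<forall>w\<in>W. \<exists>u\<in>U. \<exists>c. polar u v = 0 \<and> w = u + sV c v)"
proof -
  let ?H = "U \<inter> {u. polar u v = 0}"
  let ?W = "{u + w |u w. u \<in> ?H \<and> w \<in> V.span {v}}"
  have H: "V.subspace ?H" by (rule V.subspace_kernel[OF linear_form_polar(2) OGr_D(1)[OF U]])
  obtain u0 where u0: "u0 \<in> U" "polar u0 v \<noteq> 0" using OGr_maximal[OF U, of v] v(2) by blast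
  have dH: "V.dim ?H = 4"
    using V.dim_kernel_less[OF OGr_D(1)[OF U] linear_form_polar(2) u0] OGr_D(2)[OF U] by simp
  have W: "?W = V.span (insert v ?H)"
  proof -
    have "V.span (insert v ?H) = {x + y |x y. x \<in> V.span {v} \<and> y \<in> V.span ?H}"
      using V.span_Un[of "{v}" ?H] by simp
    moreover have "V.span ?H = ?H" using H by (simp only: V.span_eq_iff)
    ultimately show ?thesis by (auto simp: add.commute) (metis add.commute)+
  qed
  have "v \<notin> V.span ?H" using v(2) H by (simp only: V.span_eq_iff[THEN iffD2]) simp
  then have dW: "V.dim ?W = 5" unfolding W V.dim_span using dH by (simp add: V.dim_insert)
  have mem: "\<exists>u\<in>U. \<exists>c. polar u v = 0 \<and> w = u + sV c v" if "w \<in> ?W" for w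
    using that by (auto simp: V.span_singleton)
  have "?W \<in> OGr"
  proof (rule OGr_I)
    show "V.subspace ?W" unfolding W by simp
    fix w assume "w \<in> ?W"
    then obtain u c where u: "u \<in> U" "polar u v = 0" "w = u + sV c v" using mem by blast
    have "polar v u = 0" using u(2) polar_commute[of v u] by simp
    then show "polar w w = 0"
      unfolding u(3) polar_linear using OGr_D(3)[OF U u(1) u(1)] u(2) polar_self[of v] v(1)
      by simp
  qed (rule dW)
  moreover have "v \<in> ?W" unfolding W by (auto intro: V.span_base)
  ultimately show ?thesis using mem by (intro bexI[of _ ?W]) auto
qed

text \<open>The subspace \<open>I\<close> is contained in its orthogonal complement, which has complementary dimension.\<close>

lemma isotropic_dim_le:
  assumes I: "V.subspace I" and iso: "\<And>x y. x \<in> I \<Longrightarrow> y \<in> I \<Longrightarrow> polar x y = 0"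
  shows "V.dim I \<le> 5"
proof -
  define n where "n = V.dim I"
  have "\<exists>e. V.indep_fam {..<n} e \<and> V.span (e ` {..<n}) = I"
    by (rule V.exists_fam[OF I]) (simp_all add: n_def)
  then obtain e where e: "V.indep_fam {..<n} e" "V.span (e ` {..<n}) = I" by blast
  have eI: "e i \<in> I" if "i < n" for i using e(2) that V.span_base[of "e i" "e ` {..<n}"] by auto
  have "\<exists>d. \<forall>j\<in>{..<n}. d j \<in> UNIV \<and> (\<forall>i\<in>{..<n}. polar (e i) (d j) = (if i = j then 1 else 0))"
    by (rule dual_family[OF _ e(1)]) (auto intro: polar_nondegenerate)
  then obtain d where d: "\<And>i j. i < n \<Longrightarrow> j < n \<Longrightarrow> polar (e i) (d j) = (if i = j then 1 else 0)" by blast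
  have dind: "V.indep_fam {..<n} d"
    unfolding V.indep_fam_def
  proof (intro allI impI ballI)
    fix c i assume "(\<Sum>j<n. sV (c j) (d j)) = 0" and i: "i \<in> {..<n}"
    then have "polar (e i) (\<Sum>j<n. sV (c j) (d j)) = 0" by simp
    then have "(\<Sum>j<n. c j * polar (e i) (d j)) = 0" unfolding polar_sum .
    moreover have "(\<Sum>j<n. c j * polar (e i) (d j)) = (\<Sum>j<n. if i = j then c j else 0)"
      using i by (intro sum.cong) (simp_all add: d)
    ultimately show "c i = 0" using i by simp
  qed
  let ?P = "UNIV \<inter> {x. \<forall>i\<in>{..<n}. polar (e i) x = 0}"
  have P: "V.dim UNIV \<le> V.dim ?P + card {..<n}" "V.subspace ?P"
    by (rule V.dim_common_kernel_ge; simp add: linear_form_polar del: V.dim_UNIV)+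
  have "I \<subseteq> ?P" using eI iso by auto
  then have "n \<le> V.dim ?P" unfolding n_def by (rule V.dim_subset)
  have "V.dim {x + y |x y. x \<in> ?P \<and> y \<in> V.span (d ` {..<n})} + V.dim (?P \<inter> V.span (d ` {..<n}))
      = V.dim ?P + V.dim (V.span (d ` {..<n}))"
    by (rule V.dim_sums_Int) (use P in auto)
  moreover have "?P \<inter> V.span (d ` {..<n}) = {0}"
  proof -
    have "x = 0" if x: "x \<in> ?P" "x \<in> V.span (d ` {..<n})" for x
    proof -
      obtain c where c: "x = (\<Sum>j<n. sV (c j) (d j))" using x(2) V.in_span_fam_iff[of "{..<n}" x d] by auto
      have "c i = 0" if i: "i < n" for i
      proof -
        have "(\<Sum>j<n. c j * polar (e i) (d j)) = 0" using x(1) i unfolding c polar_sum[symmetric] by blast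
        moreover have "(\<Sum>j<n. c j * polar (e i) (d j)) = (\<Sum>j<n. if i = j then c j else 0)"
          using i by (intro sum.cong) (simp_all add: d)
        ultimately show ?thesis using i by simp
      qed
      then show "x = 0" by (simp add: c)
    qed
    moreover have "0 \<in> ?P" using P(2) V.subspace_0 by blast
    ultimately show ?thesis using V.span_zero by blast
  qed
  moreover have "V.dim (V.span (d ` {..<n})) = n" using V.dim_span_indep_fam[OF _ dind] by simp
  moreover have "V.dim {x + y |x y. x \<in> ?P \<and> y \<in> V.span (d ` {..<n})} \<le> V.dim UNIV"
    by (rule V.dim_subset) simp
  ultimately have "V.dim ?P + n \<le> 10" using dim_V by (simp del: V.dim_UNIV)
  with \<open>n \<le> V.dim ?P\<close> show ?thesis unfolding n_def by linarith
qed

text \<open>The orthogonal complement has dimension at least \<open>6\<close> if \<open>dim I < 5\<close>, so there is a pencil of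
  vectors orthogonal to \<open>I\<close> and independent modulo \<open>I\<close>; a quadratic form in two variables has a zero.\<close>

lemma isotropic_extend_step:
  assumes I: "V.subspace I" and iso: "\<And>x y. x \<in> I \<Longrightarrow> y \<in> I \<Longrightarrow> polar x y = 0" and d: "V.dim I < 5"
  shows "\<exists>z. z \<notin> I \<and> q z = 0 \<and> (\<forall>x\<in>I. polar x z = 0)"
proof -
  obtain e where e: "V.indep_fam {..<V.dim I} e" "V.span (e ` {..<V.dim I}) = I"
    using V.exists_fam[OF I, of "{..<V.dim I}"] by auto
  let ?P = "UNIV \<inter> {x. \<forall>i\<in>{..<V.dim I}. polar (e i) x = 0}"
  have "V.dim UNIV \<le> V.dim ?P + card {..<V.dim I}" and sP: "V.subspace ?P"
    by (rule V.dim_common_kernel_ge; simp add: linear_form_polar del: V.dim_UNIV)+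
  then have dP: "6 \<le> V.dim ?P" using d by simp
  have perp: "polar x z = 0" if "x \<in> I" "z \<in> ?P" for x z
  proof (rule V.linear_form_zero_span[OF linear_form_polar(2)])
    show "x \<in> V.span (e ` {..<V.dim I})" using that e(2) by simp
  qed (use that in auto)
  obtain x where x: "x \<in> ?P" "x \<notin> V.span I" using V.exists_notin_span[of I ?P] dP d by auto
  have "V.dim (insert x I) < V.dim ?P" using V.dim_insert_le[of x I] dP d by linarith
  then obtain y where y: "y \<in> ?P" "y \<notin> V.span (insert x I)" using V.exists_notin_span by blast
  have spI: "V.span I = I" using I by (simp only: V.span_eq_iff)
  show ?thesis
  proof (cases "q x = 0")
    case True
    then show ?thesis using x perp spI by auto
  next
    case False
    then have "degree [:q y, polar y x, q x:] > 0" by simp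
    from alg_closed_imp_poly_has_root[OF this] obtain c where c: "q y + c * polar y x + c\<^sup>2 * q x = 0"
      by (auto simp: power2_eq_square algebra_simps)
    define z where "z = y + sV c x"
    have "q z = q y + q (sV c x) + polar y (sV c x)" unfolding z_def by (rule q_add)
    also have "\<dots> = 0" unfolding polar_linear q_scale using c by (simp only: ac_simps)
    finally have "q z = 0" .
    moreover have "z \<in> ?P" unfolding z_def using x y sP by (intro V.subspace_add V.subspace_scale)
    moreover have "z \<notin> I"
    proof
      assume "z \<in> I"
      then have "z - sV c x \<in> V.span (insert x I)"
        by (intro V.span_diff V.span_scale) (auto intro: V.span_base)
      with y(2) show False by (simp add: z_def)
    qed
    ultimately show ?thesis using perp by blast
  qed
qed

lemma isotropic_extend:
  assumes "V.subspace I" "\<And>x y. x \<in> I \<Longrightarrow> y \<in> I \<Longrightarrow> polar x y = 0"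
  shows "\<exists>U\<in>OGr. I \<subseteq> U"
  using assms
proof (induction "5 - V.dim I" arbitrary: I)
  case 0
  then have "V.dim I = 5" using isotropic_dim_le[OF 0(2,3)] by simp
  then have "I \<in> OGr" using 0 by (intro OGr_I)
  then show ?case by blast
next
  case (Suc n)
  then obtain z where z: "z \<notin> I" "q z = 0" "\<And>x. x \<in> I \<Longrightarrow> polar x z = 0"
    using isotropic_extend_step[OF Suc.prems(1)] Suc.prems(2) Suc.hyps(2)
    by (metis (no_types) zero_less_Suc zero_less_diff)
  have zI: "z \<notin> V.span I" using z(1) V.span_eq_iff[of I] Suc.prems(1) by blast
  have iso: "polar x y = 0" if x: "x \<in> V.span (insert z I)" and y: "y \<in> V.span (insert z I)" for x y
  proof (rule polar_span[OF _ x y])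
    fix a b assume "a \<in> insert z I" "b \<in> insert z I"
    then consider "a = z" "b = z" | "a = z" "b \<in> I" | "a \<in> I" "b = z" | "a \<in> I" "b \<in> I" by blast
    then show "polar a b = 0"
    proof cases
      case 1 then show ?thesis using z(2) polar_self[of z] by simp
    next
      case 2 then show ?thesis using z(3)[of b] polar_commute[of z b] by simp
    qed (use z Suc.prems in auto)
  qed
  have "n = 5 - V.dim (V.span (insert z I))" using Suc.hyps(2) zI by (simp add: V.dim_insert)
  from Suc.hyps(1)[OF this _ iso] show ?case using V.span_superset[of "insert z I"] by auto
qed

text \<open>Starting from any nonzero spinor, multiply by one isotropic vector after another whenever the product
  is not zero; orthogonal vectors anticommute, so nothing achieved before is lost. The two cases record the parity.\<close>

lemma vacuum_exists:
  assumes "finite A" and iso: "\<And>x y. x \<in> A \<Longrightarrow> y \<in> A \<Longrightarrow> polar x y = 0"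
  shows "(\<exists>s. s \<noteq> 0 \<and> (\<forall>x\<in>A. cl x s = 0)) \<or> (\<exists>t. t \<noteq> 0 \<and> (\<forall>x\<in>A. cl' x t = 0))"
  using assms
proof (induction A rule: finite_induct)
  case empty
  have "\<exists>s\<in>UNIV. s \<noteq> (0::'s)" by (rule S.dim_pos_imp_nonzero) simp
  then show ?case by blast
next
  case (insert x A)
  have qx: "q x = 0" using insert.prems[of x x] q_eq_0_iff by blast
  have px: "polar a x = 0" if "a \<in> A" for a using insert.prems that by blast
  have IH: "(\<exists>s. s \<noteq> 0 \<and> (\<forall>x\<in>A. cl x s = 0)) \<or> (\<exists>t. t \<noteq> 0 \<and> (\<forall>x\<in>A. cl' x t = 0))"
    using insert by blast
  then show ?case
  proof (elim disjE exE conjE)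
    fix s assume s: "s \<noteq> 0" "\<forall>a\<in>A. cl a s = 0"
    have "\<forall>a\<in>A. cl' a (cl x s) = 0" using s px by (auto simp: cl_anticommute)
    moreover have "cl' x (cl x s) = 0" by (simp add: clifford qx)
    ultimately show ?thesis using s by (cases "cl x s = 0") auto
  next
    fix t assume t: "t \<noteq> 0" "\<forall>a\<in>A. cl' a t = 0"
    have "\<forall>a\<in>A. cl a (cl' x t) = 0" using t px by (auto simp: cl'_anticommute)
    moreover have "cl x (cl' x t) = 0" by (simp add: clifford' qx)
    ultimately show ?thesis using t by (cases "cl' x t = 0") auto
  qed
qed

section \<open>Pure spinors\<close>

text \<open>The spinor \<open>s\<close> is pure, with associated maximal isotropic subspace \<open>U\<close>.\<close>

definition annihilates :: "'v set \<Rightarrow> 's \<Rightarrow> bool" where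
  "annihilates U s \<longleftrightarrow> s \<noteq> 0 \<and> U \<in> OGr \<and> (\<forall>u\<in>U. cl u s = 0)"

interpretation dual: half_spinors sV sS' sS q cl' cl "\<lambda>t s. pairing s t"
  by (rule dual_half_spinors)

lemma annihilates_dichotomy:
  assumes "U \<in> OGr" shows "(\<exists>s. annihilates U s) \<or> (\<exists>t. dual.annihilates U t)"
proof -
  obtain e f where h: "hyperbolic e f" "V.span (range e) = U" using OGr_basis[OF assms] by blast
  have "(\<exists>s. s \<noteq> 0 \<and> (\<forall>x\<in>range e. cl x s = 0)) \<or> (\<exists>t. t \<noteq> 0 \<and> (\<forall>x\<in>range e. cl' x t = 0))"
    by (rule vacuum_exists) (use h(1) in \<open>auto simp: hyperbolic_def\<close>)
  then show ?thesis
    unfolding annihilates_def dual.annihilates_def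
    using assms cl_zero_span[of "range e"] cl'_zero_span[of "range e"] h(2) by metis
qed

text \<open>Clifford multiplication by an isotropic vector reflects the isotropic subspace of a pure
  spinor and changes its parity.\<close>

lemma annihilates_reflect:
  assumes "annihilates U s" and v: "q v = 0" "cl v s \<noteq> 0"
  shows "\<exists>W. v \<in> W \<and> dual.annihilates W (cl v s) \<and> (\<forall>w\<in>W. \<exists>u\<in>U. \<exists>c. polar u v = 0 \<and> w = u + sV c v)"
proof -
  have U: "U \<in> OGr" "\<And>u. u \<in> U \<Longrightarrow> cl u s = 0" using assms(1) by (auto simp: annihilates_def)
  have "v \<notin> U" using U v by blast
  from OGr_reflect[OF U(1) v(1) this] obtain W where W: "W \<in> OGr" "v \<in> W"
    "\<And>w. w \<in> W \<Longrightarrow> \<exists>u\<in>U. \<exists>c. polar u v = 0 \<and> w = u + sV c v" by blast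
  have "cl' w (cl v s) = 0" if w: "w \<in> W" for w
  proof -
    obtain u c where u: "u \<in> U" "polar u v = 0" "w = u + sV c v" using W(3)[OF w] by blast
    show ?thesis unfolding u(3) cl'_linear clifford v(1) cl_anticommute[of u] u(2) by (simp add: U(2)[OF u(1)])
  qed
  with W v(2) show ?thesis unfolding dual.annihilates_def by blast
qed

lemma frame_of_annihilates:
  assumes "annihilates U s" and "hyperbolic e f" "\<And>i. e i \<in> U"
  shows "spinor_frame sV sS sS' q cl cl' pairing e f s"
proof (intro spinor_frame.intro[OF half_spinors_axioms] spinor_frame_axioms.intro)
qed (use assms in \<open>auto simp: annihilates_def hyperbolic_def\<close>)

end

context spinor_frame
begin

lemma hyperbolic_frame: "hyperbolic e f"
  unfolding hyperbolic_def using polar_e_e polar_f_f polar_e_f by blast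

lemma annihilates_Om: "annihilates (V.span (range e)) Om"
proof -
  have "cl u Om = 0" if "u \<in> V.span (range e)" for u
    by (rule cl_zero_span[OF _ that]) (auto simp: e_Om)
  then show ?thesis using Om_nonzero hyperbolic_OGr[OF hyperbolic_frame] by (simp add: annihilates_def)
qed

lemma coords_Om: "a_coord Om = 1" "b_coord Om i j = 0" "c_coord Om i = 0"
  using kappa_nonzero
  by (simp_all add: a_coord_def b_coord_def c_coord_def pairing_Om_ee pairing_Om_small pairing_Om_tau)

lemma coords_f_f:
  "a_coord (cl' (f i) (cl (f j) Om)) = 0"
  "b_coord (cl' (f i) (cl (f j) Om)) k l = (if i = k \<and> j = l then 1 else 0) - (if i = l \<and> j = k then 1 else 0)"
  "c_coord (cl' (f i) (cl (f j) Om)) k = 0"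
proof -
  show "a_coord (cl' (f i) (cl (f j) Om)) = 0"
    unfolding a_coord_def pairing_adjoint f_tau by simp
  show "c_coord (cl' (f i) (cl (f j) Om)) k = 0"
    unfolding c_coord_def pairing_adjoint pairing_Om_small by simp
  have fe: "cl' (f m) (cl (e k) y) = (if m = k then y else 0) - cl' (e k) (cl (f m) y)"
    "cl (f m) (cl' (e k) t) = (if m = k then t else 0) - cl (e k) (cl' (f m) t)" for m k y t
    by (simp_all add: cl_anticommute[of "f m"] cl'_anticommute[of "f m"] polar_f_e)
  show "b_coord (cl' (f i) (cl (f j) Om)) k l = (if i = k \<and> j = l then 1 else 0) - (if i = l
      \<and> j = k then 1 else 0)"
  proof -
    have 1: "cl' (f i) (cl (e k) (cl' (e l) tau)) =
        (if i = k then cl' (e l) tau else 0) - (if i = l then cl' (e k) tau else 0)"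
      by (simp add: fe f_tau)
    have 2: "pairing Om (cl (f j) (cl' (e m) tau)) = (if j = m then kappa else 0)" for m
      by (simp add: fe f_tau pairing_Om_tau)
    have "pairing (cl' (f i) (cl (f j) Om)) (cl (e k) (cl' (e l) tau)) =
        (if i = k then pairing Om (cl (f j) (cl' (e l) tau)) else 0)
        - (if i = l then pairing Om (cl (f j) (cl' (e k) tau)) else 0)"
      unfolding pairing_adjoint 1 cl_diff pairing_diff by simp
    then show ?thesis
      unfolding b_coord_def 2 using kappa_nonzero by (cases "i = k"; cases "i = l") auto
  qed
qed

lemma coords_zero_imp:
  assumes "a_coord s = 0" "\<And>i j. b_coord s i j = 0" "\<And>i. c_coord s i = 0"
  shows "s = 0"
  by (subst spinor_expansion[of s]) (simp add: assms)

text \<open>The coordinates of positive degree are pairings with products beginning with some \<open>e m\<close>, which can be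
  moved to \<open>s\<close>.\<close>

lemma vacuum_unique:
  assumes "\<And>i. cl (e i) s = 0" shows "s = sS (a_coord s) Om"
proof -
  have b: "b_coord s i j = 0" for i j
  proof -
    have "pairing s (cl (e i) (cl' (e j) tau)) = pairing (cl' (e j) (cl (e i) s)) tau"
      by (rule pairing_adjoint[symmetric])
    then show ?thesis by (simp add: b_coord_def assms)
  qed
  have c: "c_coord s i = 0" for i
  proof -
    obtain m where m: "m \<noteq> i" using another_index by blast
    have "cl (f i) Om = cl (e m) (cl' (f m) (cl (f i) Om))"
      using m by (simp add: e_f_commute e_Om)
    then have "pairing s (cl (f i) Om) = pairing (cl' (f m) (cl (e m) s)) (cl (f i) Om)"
      by (simp add: pairing_adjoint)
    then show ?thesis by (simp add: c_coord_def assms)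
  qed
  show ?thesis
    by (subst spinor_expansion[of s]) (simp add: b c)
qed

lemma tau_unique:
  assumes "\<And>i. cl' (f i) t = 0" shows "\<exists>c. t = sS' c tau"
proof -
  interpret dual: spinor_frame sV sS' sS q cl' cl "\<lambda>t s. pairing s t" f e tau
    by (rule dual_spinor_frame)
  show ?thesis using dual.vacuum_unique[OF assms] by blast
qed

lemma pf_commute: "pf m b d = pf m d b"
  by (cases m) (simp_all add: algebra_simps)

text \<open>The polarization of the identity that \<open>b\<close> contracted with \<open>b \<and> b\<close> vanishes for a skew matrix
  \<open>b\<close> of size 5.\<close>

lemma pf_contract:
  assumes b: "\<And>i j. b j i = - b i j" and d: "\<And>i j. d j i = - d i j"
  shows "(\<Sum>j\<in>UNIV. d i j * pf j b b + 2 * (b i j * pf j b d)) = 0"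
proof -
  have diag: "b i i = 0" "d i i = 0" for i using b[of i i] d[of i i] by (simp_all add: equation_minus_iff)
  note sk = b[of A1 A0] b[of A2 A0] b[of A3 A0] b[of A4 A0] b[of A2 A1] b[of A3 A1] b[of A4 A1]
    b[of A3 A2] b[of A4 A2] b[of A4 A3]
    d[of A1 A0] d[of A2 A0] d[of A3 A0] d[of A4 A0] d[of A2 A1] d[of A3 A1] d[of A4 A1]
    d[of A3 A2] d[of A4 A2] d[of A4 A3]
  show ?thesis
    by (cases i) (simp_all only: sum_five pf.simps sk diag, simp_all add: algebra_simps)
qed

lemma quadric_expansion:
  "pairing s (cl v s') = (\<Sum>i\<in>UNIV. polar v (f i) * pairing s (cl (e i) s'))
    + (\<Sum>i\<in>UNIV. polar v (e i) * pairing s (cl (f i) s'))"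
  by (subst hyperbolic_expansion[OF hyperbolic_frame, of v])
     (simp only: V.linear_form_add[OF quadric_form_linear(3)] V.linear_form_sum[OF quadric_form_linear(3)])

lemma quadric_symmetric: "pairing s (cl v s') = pairing s' (cl v s)"
proof -
  have e: "pairing s (cl (e i) s') = pairing s' (cl (e i) s)" for i
    by (simp add: quadric_e algebra_simps)
  have f: "pairing s (cl (f i) s') = pairing s' (cl (f i) s)" for i
    by (simp add: quadric_f pf_commute[of i "b_coord s"] algebra_simps)
  show ?thesis by (simp only: quadric_expansion[of s v s'] quadric_expansion[of s' v s] e f)
qed

lemma quadric_Om: "pairing Om (cl v Om) = 0"
  unfolding quadric_expansion[of Om v] by (simp add: e_Om pairing_Om_small)

text \<open>By the quadrics of \<open>f\<close>, the coordinates \<open>c\<close> are determined by \<open>a\<close> and \<open>b\<close>, and the spinor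
  is \<open>a exp (b / a) Om\<close>. It is annihilated by the vectors \<open>e i\<close> transformed by the same unipotent element.\<close>

lemma annihilates_if_a_coord:
  assumes a: "a_coord s \<noteq> 0" and f: "\<And>m. pairing s (cl (f m) s) = 0"
  shows "\<exists>U. annihilates U s"
proof -
  define w where "w i = e i + (\<Sum>j\<in>UNIV. sV (- (b_coord s i j / a_coord s)) (f j))" for i
  have h: "hyperbolic w f"
    unfolding hyperbolic_def
  proof (intro allI conjI)
    fix i j
    have wf: "polar (w i) (f j) = (if i = j then 1 else 0)" for i j
      unfolding w_def polar_linear polar_sum(2) polar_f_f polar_e_f by simp
    show "polar (w i) (f j) = (if i = j then 1 else 0)" by (rule wf)
    show "polar (f i) (f j) = 0" by (rule polar_f_f)
    have "polar (w i) (w j) = polar (w i) (e j) + (\<Sum>k\<in>UNIV. - (b_coord s j k / a_coord s) * polar (w i) (f k))"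
      by (simp only: w_def[of j] polar_linear polar_sum)
    also have "(\<Sum>k\<in>UNIV. - (b_coord s j k / a_coord s) * polar (w i) (f k)) = - (b_coord s j i / a_coord s)"
      by (simp only: wf if_distrib[of "\<lambda>x. _ * x"] mult_1_right mult_zero_right) (simp add: sum.delta)
    also have "polar (w i) (e j) = (\<Sum>k\<in>UNIV. - (b_coord s i k / a_coord s) * (if k = j then 1 else 0))"
      unfolding w_def polar_linear polar_sum(2) polar_e_e polar_f_e by simp
    also have "\<dots> = - (b_coord s i j / a_coord s)"
      by (simp only: if_distrib[of "\<lambda>x. _ * x"] mult_1_right mult_zero_right) (simp add: sum.delta)
    finally show "polar (w i) (w j) = 0" using b_coord_skew[of s i j] by simp
  qed
  have c: "2 * a_coord s * c_coord s m = pf m (b_coord s) (b_coord s)" for m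
    using f[of m] kappa_nonzero unfolding quadric_f by (simp add: algebra_simps)
  have bc: "(\<Sum>j\<in>UNIV. b_coord s i j * c_coord s j) = 0" for i
  proof -
    have "(\<Sum>j\<in>UNIV. b_coord s i j * pf j (b_coord s) (b_coord s)
        + 2 * (b_coord s i j * pf j (b_coord s) (b_coord s))) = 0"
      by (rule pf_contract) (rule b_coord_skew)+
    then have "6 * a_coord s * (\<Sum>j\<in>UNIV. b_coord s i j * c_coord s j) = 0"
      unfolding c[symmetric] by (simp add: sum_distrib_left algebra_simps sum.distrib[symmetric])
    with a show ?thesis by simp
  qed
  have kill: "cl (w i) s = 0" for i
  proof (rule pairing_nondegenerate')
    fix s'
    have "(\<Sum>j\<in>UNIV. b_coord s' i j * pf j (b_coord s) (b_coord s)
        + 2 * (b_coord s i j * pf j (b_coord s) (b_coord s'))) = 0"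
      by (rule pf_contract) (rule b_coord_skew)+
    then have "2 * (a_coord s * (\<Sum>j\<in>UNIV. b_coord s' i j * c_coord s j)
        + (\<Sum>j\<in>UNIV. b_coord s i j * pf j (b_coord s) (b_coord s'))) = 0"
      unfolding c[symmetric] by (simp add: sum_distrib_left sum.distrib algebra_simps)
    then have id: "a_coord s * (\<Sum>j\<in>UNIV. b_coord s' i j * c_coord s j) =
        - (\<Sum>j\<in>UNIV. b_coord s i j * pf j (b_coord s) (b_coord s'))"
      unfolding mult_eq_0_iff eq_neg_iff_add_eq_0 by simp
    have "pairing s' (cl (w i) s) = pairing s' (cl (e i) s)
        + (\<Sum>j\<in>UNIV. - (b_coord s i j / a_coord s) * pairing s' (cl (f j) s))"
      unfolding w_def cl_linear pairing_linear
      by (subst V.linear_form_sum[of "\<lambda>v. pairing s' (cl v s)"])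
         (auto intro!: V.linear_formI simp: cl_linear pairing_linear)
    also have "(\<Sum>j\<in>UNIV. - (b_coord s i j / a_coord s) * pairing s' (cl (f j) s))
        = - (\<Sum>j\<in>UNIV. b_coord s i j * pairing s' (cl (f j) s)) / a_coord s"
      by (simp add: sum_negf sum_divide_distrib)
    finally have "a_coord s * pairing s' (cl (w i) s) = a_coord s * pairing s' (cl (e i) s)
        - (\<Sum>j\<in>UNIV. b_coord s i j * pairing s' (cl (f j) s))"
      using a by (simp add: field_simps)
    also have "pairing s' (cl (e i) s) = kappa * ((\<Sum>j\<in>UNIV. b_coord s' i j * c_coord s j)
        + (\<Sum>j\<in>UNIV. b_coord s i j * c_coord s' j))"
      by (simp only: quadric_e sum.distrib)
    also have "(\<Sum>j\<in>UNIV. b_coord s i j * pairing s' (cl (f j) s)) =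
        kappa * (a_coord s' * (\<Sum>j\<in>UNIV. b_coord s i j * c_coord s j)
          + a_coord s * (\<Sum>j\<in>UNIV. b_coord s i j * c_coord s' j)
          - (\<Sum>j\<in>UNIV. b_coord s i j * pf j (b_coord s) (b_coord s')))"
    proof -
      have "b_coord s i j * pairing s' (cl (f j) s) = kappa * (a_coord s' * (b_coord s i j * c_coord s j)
          + a_coord s * (b_coord s i j * c_coord s' j) - b_coord s i j * pf j (b_coord s) (b_coord s'))" for j
        unfolding quadric_f pf_commute[of j "b_coord s'"] by (simp add: algebra_simps)
      then show ?thesis by (simp only: sum.distrib sum_subtractf sum_distrib_left[symmetric])
    qed
    also have "a_coord s * (kappa * ((\<Sum>j\<in>UNIV. b_coord s' i j * c_coord s j)
          + (\<Sum>j\<in>UNIV. b_coord s i j * c_coord s' j)))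
        - kappa * (a_coord s' * (\<Sum>j\<in>UNIV. b_coord s i j * c_coord s j)
          + a_coord s * (\<Sum>j\<in>UNIV. b_coord s i j * c_coord s' j)
          - (\<Sum>j\<in>UNIV. b_coord s i j * pf j (b_coord s) (b_coord s')))
        = kappa * (a_coord s * (\<Sum>j\<in>UNIV. b_coord s' i j * c_coord s j)
        + (\<Sum>j\<in>UNIV. b_coord s i j * pf j (b_coord s) (b_coord s'))
        - a_coord s' * (\<Sum>j\<in>UNIV. b_coord s i j * c_coord s j))"
      by (simp only: ring_distribs ac_simps) (simp only: algebra_simps)
    also have "\<dots> = 0" unfolding bc id by simp
    finally show "pairing s' (cl (w i) s) = 0" using a by simp
  qed
  have "cl u s = 0" if "u \<in> V.span (range w)" for u
    by (rule cl_zero_span[OF _ that]) (auto simp: kill)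
  moreover have "s \<noteq> 0" using a by (auto simp: a_coord_def)
  ultimately show ?thesis
    using hyperbolic_OGr[OF h] unfolding annihilates_def by blast
qed

text \<open>The hypothesis gives \<open>c = 0\<close>, and every term of the quadrics of \<open>e\<close> contains a coordinate \<open>c\<close>.\<close>

lemma quadric_e_span_vanishes:
  assumes "\<And>v. pairing s (cl v Om) = 0" and u: "u \<in> V.span (range e)"
  shows "pairing s (cl u s) = 0"
proof (rule V.linear_form_zero_span[OF quadric_form_linear(3) _ u])
  fix v assume "v \<in> range e"
  moreover have "c_coord s i = 0" for i by (simp add: c_coord_def assms)
  ultimately show "pairing s (cl v s) = 0" by (auto simp: quadric_e)
qed

end

context half_spinors
begin

interpretation dual: half_spinors sV sS' sS q cl' cl "\<lambda>t s. pairing s t"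
  by (rule dual_half_spinors)

lemma frame_of_dual_annihilates:
  assumes F: "dual.annihilates F t" and h: "hyperbolic e f" and f: "\<And>i. f i \<in> F"
  shows "\<exists>Om. spinor_frame sV sS sS' q cl cl' pairing e f Om"
proof -
  interpret D: spinor_frame sV sS' sS q cl' cl "\<lambda>t s. pairing s t" f e t
    by (rule dual.frame_of_annihilates[OF F hyperbolic_commute[OF h] f])
  show ?thesis using D.dual_spinor_frame by blast
qed

text \<open>The opposite isotropic subspace of a frame has a pure spinor of the other parity, so it does not matter in
  which half-spinor representation the vacuum of a given subspace lies.\<close>

lemma frame_exists: "\<exists>e f Om. spinor_frame sV sS sS' q cl cl' pairing e f Om"
proof -
  obtain U where U: "U \<in> OGr" using isotropic_extend[of "{0}"] by (auto simp: V.subspace_single_0)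
  obtain e f where h: "hyperbolic e f" "V.span (range e) = U" using OGr_basis[OF U] by blast
  have e: "e i \<in> U" for i using h(2) V.span_base[of "e i" "range e"] by auto
  from annihilates_dichotomy[OF U] show ?thesis
  proof
    assume "\<exists>s. annihilates U s"
    then show ?thesis using frame_of_annihilates[OF _ h(1) e] by blast
  next
    assume "\<exists>t. dual.annihilates U t"
    then show ?thesis using frame_of_dual_annihilates[OF _ hyperbolic_commute[OF h(1)] e] by blast
  qed
qed

lemma quadric_commute: "pairing s (cl v s') = pairing s' (cl v s)"
proof -
  obtain e f Om where "spinor_frame sV sS sS' q cl cl' pairing e f Om" using frame_exists by blast
  then interpret spinor_frame sV sS sS' q cl cl' pairing e f Om .
  show ?thesis by (rule quadric_symmetric)
qed

lemma frame_at:
  assumes "annihilates U s"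
  shows "\<exists>e f. V.span (range e) = U \<and> spinor_frame sV sS sS' q cl cl' pairing e f s"
proof -
  have "U \<in> OGr" using assms by (simp add: annihilates_def)
  then obtain e f where h: "hyperbolic e f" "V.span (range e) = U" using OGr_basis by blast
  have e: "e i \<in> U" for i using h(2) V.span_base[of "e i" "range e"] by auto
  from frame_of_annihilates[OF assms h(1) e] h(2) show ?thesis by blast
qed

lemma frame_at_dual:
  assumes "dual.annihilates F t"
  shows "\<exists>e f Om. V.span (range f) = F \<and> spinor_frame sV sS sS' q cl cl' pairing e f Om"
proof -
  have "F \<in> OGr" using assms by (simp add: dual.annihilates_def)
  then obtain e f where h: "hyperbolic e f" "V.span (range e) = F" using OGr_basis by blast
  have e: "e i \<in> F" for i using h(2) V.span_base[of "e i" "range e"] by auto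
  from frame_of_dual_annihilates[OF assms hyperbolic_commute[OF h(1)] e] h(2) show ?thesis by blast
qed

lemma annihilates_quadric: "annihilates U s \<Longrightarrow> pairing s (cl v s) = 0"
  using frame_at spinor_frame.quadric_Om by metis

lemma annihilates_if_pairing:
  assumes F: "dual.annihilates F t" and st: "pairing s t \<noteq> 0"
    and f0: "\<And>v. v \<in> F \<Longrightarrow> pairing s (cl v s) = 0"
  shows "\<exists>U. annihilates U s"
proof -
  obtain e f Om where fr: "V.span (range f) = F" "spinor_frame sV sS sS' q cl cl' pairing e f Om"
    using frame_at_dual[OF F] by blast
  interpret spinor_frame sV sS sS' q cl cl' pairing e f Om by (rule fr(2))
  have f: "f i \<in> F" for i using fr(1) V.span_base[of "f i" "range f"] by auto
  then have "cl' (f i) t = 0" for i using F by (simp add: dual.annihilates_def)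
  from tau_unique[OF this] obtain c where "t = sS' c tau" by blast
  with st have "pairing s tau \<noteq> 0" by (auto simp: pairing_linear)
  then have "a_coord s \<noteq> 0" using kappa_nonzero by (simp add: a_coord_def)
  then show ?thesis using annihilates_if_a_coord f0 f by blast
qed

text \<open>The quadrics of all \<open>v\<close> cut out the pure spinors. All coordinates are pairings with pure spinors, so some
  pure spinor \<open>t\<close> of \<open>S'\<close> has nonzero pairing with \<open>s\<close>; in a frame at \<open>t\<close> this is, up to a scalar, the coordinate \<open>a\<close>.\<close>

lemma annihilates_if_null:
  assumes s: "s \<noteq> 0" and null: "\<And>v. pairing s (cl v s) = 0"
  shows "\<exists>U. annihilates U s"
proof -
  obtain e f Om where fr: "spinor_frame sV sS sS' q cl cl' pairing e f Om" using frame_exists by blast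
  interpret spinor_frame sV sS sS' q cl cl' pairing e f Om by (rule fr)
  note Om = annihilates_Om
  have tau: "dual.annihilates (V.span (range f)) tau"
    by (rule spinor_frame.annihilates_Om[OF dual_spinor_frame])
  have "\<exists>t. pairing s t \<noteq> 0 \<and> (\<exists>F. dual.annihilates F t)"
  proof (rule ccontr)
    assume "\<not> ?thesis"
    then have z: "pairing s t = 0" if "dual.annihilates F t" for F t using that by blast
    have "s = 0"
    proof (rule coords_zero_imp)
      show "a_coord s = 0" using z[OF tau] by (simp add: a_coord_def)
      fix i j
      show "b_coord s i j = 0"
      proof (cases "cl (e i) (cl' (e j) tau) = 0")
        case True
        then show ?thesis unfolding b_coord_def by (simp only: pairing_0 div_0)
      next
        case False
        then have nz: "cl' (e j) tau \<noteq> 0" by auto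
        obtain W where W: "annihilates W (cl' (e j) tau)"
          using dual.annihilates_reflect[OF tau q_e nz] by blast
        from annihilates_reflect[OF W q_e False] z show ?thesis unfolding b_coord_def by (metis div_0)
      qed
      show "c_coord s i = 0"
      proof (cases "cl (f i) Om = 0")
        case True
        then show ?thesis by (simp add: c_coord_def)
      next
        case False
        from annihilates_reflect[OF Om q_f False] z show ?thesis unfolding c_coord_def by (metis div_0)
      qed
    qed
    with s show False ..
  qed
  then obtain t F where t: "pairing s t \<noteq> 0" "dual.annihilates F t" by blast
  from annihilates_if_pairing[OF t(2,1)] null show ?thesis by blast
qed

lemma quadric_vanishes_on_annihilator:
  assumes U: "annihilates U s0" and s: "\<And>v. pairing s (cl v s0) = 0" and u: "u \<in> U"
  shows "pairing s (cl u s) = 0"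
proof -
  obtain e f where fr: "V.span (range e) = U" "spinor_frame sV sS sS' q cl cl' pairing e f s0"
    using frame_at[OF U] by blast
  interpret spinor_frame sV sS sS' q cl cl' pairing e f s0 by (rule fr(2))
  show ?thesis using quadric_e_span_vanishes[OF s] u fr(1) by blast
qed

lemma pure_line_eq:
  assumes U: "annihilates U s" shows "pure_line U = S.span {s}"
proof -
  obtain e f where fr: "V.span (range e) = U" "spinor_frame sV sS sS' q cl cl' pairing e f s"
    using frame_at[OF U] by blast
  interpret spinor_frame sV sS sS' q cl cl' pairing e f s by (rule fr(2))
  show ?thesis
  proof (intro subset_antisym subsetI)
    fix x assume "x \<in> pure_line U"
    then have "cl (e i) x = 0" for i
      using fr(1) V.span_base[of "e i" "range e"] by (auto simp: pure_line_def)
    from vacuum_unique[OF this] show "x \<in> S.span {s}" by (metis S.span_singleton rangeI)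
  next
    fix x assume "x \<in> S.span {s}"
    then obtain c where "x = sS c s" by (auto simp: S.span_singleton)
    then show "x \<in> pure_line U" using U by (auto simp: pure_line_def annihilates_def cl_linear)
  qed
qed

lemma X_iff: "L \<in> X \<longleftrightarrow> (\<exists>U s. annihilates U s \<and> L = S.span {s})"
proof
  assume "L \<in> X"
  then obtain U where U: "U \<in> OGr" "pure_line U \<noteq> {0}" "L = pure_line U"
    by (auto simp: X_def OGr_plus_def)
  have "0 \<in> pure_line U" by (simp add: pure_line_def)
  with U(2) obtain s where "s \<in> pure_line U" "s \<noteq> 0" by blast
  then have "annihilates U s" using U(1) by (simp add: annihilates_def pure_line_def)
  with U(3) pure_line_eq show "\<exists>U s. annihilates U s \<and> L = S.span {s}" by blast
next
  assume "\<exists>U s. annihilates U s \<and> L = S.span {s}"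
  then obtain U s where U: "annihilates U s" "L = S.span {s}" by blast
  then have "s \<in> pure_line U" "s \<noteq> 0" "U \<in> OGr" by (auto simp: annihilates_def pure_line_def)
  then have "U \<in> OGr_plus" by (auto simp: OGr_plus_def)
  then show "L \<in> X" using U pure_line_eq by (auto simp: X_def)
qed

end

section \<open>Pencils of decomposable bivectors\<close>

text \<open>The polarized Pluecker relation. For \<open>b = d\<close> it says that the alternating form \<open>b\<close> has rank at most two; the relations for the pairs
  \<open>b b\<close>, \<open>b d\<close> and \<open>d d\<close> together say this of all combinations of \<open>b\<close> and \<open>d\<close>.\<close>

definition plucker_relation ::
  "('v \<Rightarrow> 'v \<Rightarrow> 'k::comm_ring_1) \<Rightarrow> ('v \<Rightarrow> 'v \<Rightarrow> 'k) \<Rightarrow> 'v \<Rightarrow> 'v \<Rightarrow> 'v \<Rightarrow> 'v \<Rightarrow> bool" where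
  "plucker_relation b d x y z w \<longleftrightarrow> b x y * d z w + d x y * b z w - b x z * d y w - d x z * b y w
     + b x w * d y z + d x w * b y z = 0"

context fin_vs
begin

text \<open>Two independent alternating forms all of whose combinations have rank two share a linear factor:
  they are \<open>x0 \<and> x1\<close> and \<open>x0 \<and> x2\<close> up to scalars, in suitable coordinates.

  Let \<open>b x y \<noteq> 0\<close> and let \<open>?G\<close> be the orthogonal complement of \<open>x\<close> and \<open>y\<close> for \<open>b\<close>. By the Pluecker
  relations both forms vanish on \<open>?G\<close>. If \<open>x\<close> and \<open>y\<close> were also orthogonal to \<open>?G\<close> for \<open>d\<close>, then
  \<open>d\<close> would be a multiple of \<open>b\<close>. So there are \<open>p\<close> among \<open>x, y\<close> and \<open>g\<close> in \<open>?G\<close> with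
  \<open>d p g \<noteq> 0\<close>, and the basis is \<open>p\<close>, the other vector \<open>p'\<close> made orthogonal for \<open>d\<close>, then
  \<open>g\<close>, and two vectors in the kernels of both forms.\<close>

lemma pencil_normal_form:
  fixes b d :: "'b \<Rightarrow> 'b \<Rightarrow> 'a"
  assumes two: "(2::'a) \<noteq> 0" and W: "subspace W"
    and lin: "\<And>x. linear_form (b x)" "\<And>x. linear_form (d x)"
    and skew: "\<And>x y. x \<in> W \<Longrightarrow> y \<in> W \<Longrightarrow> b y x = - b x y" "\<And>x y. x \<in> W \<Longrightarrow> y \<in> W \<Longrightarrow> d y x = - d x y"
    and pl: "\<And>x y z w. x \<in> W \<Longrightarrow> y \<in> W \<Longrightarrow> z \<in> W \<Longrightarrow> w \<in> W \<Longrightarrow> plucker_relation b b x y z w"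
      "\<And>x y z w. x \<in> W \<Longrightarrow> y \<in> W \<Longrightarrow> z \<in> W \<Longrightarrow> w \<in> W \<Longrightarrow> plucker_relation b d x y z w"
      "\<And>x y z w. x \<in> W \<Longrightarrow> y \<in> W \<Longrightarrow> z \<in> W \<Longrightarrow> w \<in> W \<Longrightarrow> plucker_relation d d x y z w"
    and ind: "\<And>r s. (\<And>x y. x \<in> W \<Longrightarrow> y \<in> W \<Longrightarrow> r * b x y + s * d x y = 0) \<Longrightarrow> r = 0 \<and> s = 0"
    and dimW: "dim W = 5"
  shows "\<exists>e. indep_fam UNIV e \<and> (\<forall>i. e i \<in> W) \<and> b (e A0) (e A1) \<noteq> 0 \<and> d (e A0) (e A2) \<noteq> 0 \<and>
    (\<forall>i j. \<not> (i = A0 \<and> j = A1 \<or> i = A1 \<and> j = A0) \<longrightarrow> b (e i) (e j) = 0) \<and> (\<forall>i j. \<not> (i = A0 \<and> j = A2 \<or> i = A2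
        \<and> j = A0) \<longrightarrow> d (e i) (e j) = 0)"
proof -
  have alt: "b x x = 0" "d x x = 0" if "x \<in> W" for x
  proof -
    have "b x x + b x x = 0" "d x x + d x x = 0" using skew[OF that that] by (simp_all add: eq_neg_iff_add_eq_0)
    then have "2 * b x x = 0" "2 * d x x = 0" by (simp_all only: mult_2)
    with two show "b x x = 0" "d x x = 0" by auto
  qed
  obtain x y where xy: "x \<in> W" "y \<in> W" "b x y \<noteq> 0" using ind[of 1 0] by auto
  let ?G = "W \<inter> {z. b x z = 0} \<inter> {z. b y z = 0}"
  have sG1: "subspace (W \<inter> {z. b x z = 0})" by (rule subspace_kernel[OF lin(1) W])
  have sG: "subspace ?G" by (rule subspace_kernel[OF lin(1) sG1])
  have dimG: "dim ?G \<ge> 3"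
    using dim_kernel_ge[OF W lin(1)[of x]] dim_kernel_ge[OF sG1 lin(1)[of y]] dimW by linarith
  have bG: "b z w = 0" if "z \<in> ?G" "w \<in> ?G" for z w
  proof -
    have "plucker_relation b b x y z w" by (rule pl(1)) (use xy that in auto)
    moreover have "b x z = 0" "b y z = 0" "b x w = 0" "b y w = 0" using that by auto
    ultimately have "b x y * b z w + b x y * b z w = 0" by (simp add: plucker_relation_def)
    then have "2 * (b x y * b z w) = 0" by (simp only: mult_2)
    with two xy(3) show ?thesis by auto
  qed
  have dG: "d z w = 0" if "z \<in> ?G" "w \<in> ?G" for z w
  proof -
    have "plucker_relation b d x y z w" by (rule pl(2)) (use xy that in auto)
    moreover have "b x z = 0" "b y z = 0" "b x w = 0" "b y w = 0" using that by auto
    ultimately have "b x y * d z w = 0" using bG[OF that] by (simp add: plucker_relation_def)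
    with xy(3) show ?thesis by auto
  qed
  have "\<exists>z\<in>?G. d x z \<noteq> 0 \<or> d y z \<noteq> 0"
  proof (rule ccontr)
    assume "\<not> ?thesis"
    then have dz: "d x z = 0" "d y z = 0" if "z \<in> ?G" for z using that by auto
    have dec: "\<exists>r s. \<exists>g\<in>?G. u = scale r x + scale s y + g" if u: "u \<in> W" for u
    proof -
      define r s where "r = b u y / b x y" and "s = b x u / b x y"
      define g where "g = u - (scale r x + scale s y)"
      have gW: "g \<in> W" unfolding g_def using u xy W by (intro subspace_diff subspace_add subspace_scale)
      have "b x g = b x u - (r * b x x + s * b x y)"
        by (simp add: g_def linear_form_diff[OF lin(1)] linear_form_add[OF lin(1)] linear_form_scale[OF lin(1)])
      then have "b x g = 0" using alt xy by (simp add: s_def)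
      moreover have "b y g = b y u - (r * b y x + s * b y y)"
        by (simp add: g_def linear_form_diff[OF lin(1)] linear_form_add[OF lin(1)] linear_form_scale[OF lin(1)])
      then have "b y g = 0" using alt xy skew(1)[OF xy(1,2)] skew(1)[OF u xy(2)] by (simp add: r_def)
      ultimately have "g \<in> ?G" using gW by simp
      then show ?thesis unfolding g_def by (intro exI[of _ r] exI[of _ s] bexI[of _
          "u - (scale r x + scale s y)"]) auto
    qed
    have val: "c u w = (r * s' - s * r') * c x y"
      if c: "\<And>x. linear_form (c x)" "\<And>x y. x \<in> W \<Longrightarrow> y \<in> W \<Longrightarrow> c y x = - c x y"
        "\<And>z. z \<in> ?G \<Longrightarrow> c x z = 0 \<and> c y z = 0" "\<And>z w. z \<in> ?G \<Longrightarrow> w \<in> ?G \<Longrightarrow> c z w = 0"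
        "\<And>x. x \<in> W \<Longrightarrow> c x x = 0"
        and u: "u = scale r x + scale s y + g" "g \<in> ?G" and w: "w = scale r' x + scale s' y + h" "h \<in> ?G"
      for c :: "'b \<Rightarrow> 'b \<Rightarrow> 'a" and u w r s r' s' g h
    proof -
      have uW: "u \<in> W" unfolding u(1) using u(2) xy W by (intro subspace_add subspace_scale) auto
      have xu: "c x u = s * c x y" "c y u = - r * c x y" "c h u = 0"
        unfolding u(1) linear_form_add[OF c(1)] linear_form_scale[OF c(1)]
        using c(3)[OF u(2)] c(3)[OF w(2)] c(4)[OF w(2) u(2)] c(5)[of x] c(5)[of y] c(2)[of x y] c(2)[of x h]
            c(2)[of y h] xy w(2)
        by auto
      have "c u w = r' * c u x + s' * c u y + c u h"
        by (simp add: w(1) linear_form_add[OF c(1)] linear_form_scale[OF c(1)])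
      also have "\<dots> = r' * - c x u + s' * - c y u - c h u"
        using c(2)[of x u] c(2)[of y u] c(2)[of h u] uW xy w(2) by simp
      finally show ?thesis unfolding xu by (simp add: algebra_simps)
    qed
    have "d x y * b u w + (- b x y) * d u w = 0" if uw: "u \<in> W" "w \<in> W" for u w
    proof -
      obtain r s g where u: "u = scale r x + scale s y + g" "g \<in> ?G" using dec[OF uw(1)] by blast
      obtain r' s' h where w: "w = scale r' x + scale s' y + h" "h \<in> ?G" using dec[OF uw(2)] by blast
      have val_b: "b u w = (r * s' - s * r') * b x y"
        by (rule val[OF lin(1) skew(1) _ bG alt(1) u w]) auto
      have val_d: "d u w = (r * s' - s * r') * d x y"
        by (rule val[OF lin(2) skew(2) _ dG alt(2) u w]) (auto simp: dz)
      show ?thesis unfolding val_b val_d by (simp add: algebra_simps)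
    qed
    then have "- b x y = 0" using ind by blast
    with xy(3) show False by simp
  qed
  then obtain p p' g where pp: "p \<in> W" "p' \<in> W" "b p p' \<noteq> 0" and g: "g \<in> ?G" "d p g \<noteq> 0"
    and G: "\<And>z. z \<in> ?G \<Longrightarrow> b p z = 0 \<and> b p' z = 0"
  proof (elim bexE disjE)
    fix z assume "z \<in> ?G" "d x z \<noteq> 0"
    then show thesis using that[of x y z] xy by blast
  next
    fix z assume z: "z \<in> ?G" "d y z \<noteq> 0"
    have "b y x \<noteq> 0" using skew(1)[OF xy(1,2)] xy(3) by simp
    with z show thesis using that[of y x z] xy by blast
  qed
  have gW: "g \<in> W" using g by simp
  \<comment> \<open>With this \<open>k\<close> and \<open>m\<close>, \<open>e1\<close> is in the kernel of \<open>d\<close>: orthogonal to \<open>g\<close> and to \<open>p\<close>, and to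
    the rest of \<open>?G\<close> by the Pluecker relation for \<open>d\<close>.\<close>
  define k m where "k = d p' g / d p g" and "m = d p p' / d p g"
  define e1 where "e1 = p' - scale k p - scale m g"
  have e1W: "e1 \<in> W" unfolding e1_def using pp gW W by (intro subspace_diff subspace_scale)
  have sk: "b z e1 = b z p' - k * b z p - m * b z g" "d z e1 = d z p' - k * d z p - m * d z g" for z
    by (simp_all add: e1_def linear_form_diff[OF lin(1)] linear_form_scale[OF lin(1)]
        linear_form_diff[OF lin(2)] linear_form_scale[OF lin(2)])
  have be1: "b p e1 = b p p'" using alt(1)[OF pp(1)] G[OF g(1)] by (simp add: sk)
  have de1: "d p e1 = 0" using alt(2)[OF pp(1)] g(2) by (simp add: sk m_def)
  have be1G: "b e1 z = 0" if "z \<in> ?G" for z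
  proof -
    have "b z e1 = 0" using G[OF that] bG[OF that g(1)] skew(1)[of p' z] skew(1)[of p z] pp that by (simp add: sk)
    then show ?thesis using skew(1)[of z e1] e1W that by simp
  qed
  have de1G: "d e1 z = 0" if z: "z \<in> ?G" for z
  proof -
    have "plucker_relation d d p p' z g" by (rule pl(3)) (use pp z gW in auto)
    then have "2 * (d p g * d p' z) = 2 * (d p z * d p' g)"
      using dG[OF z g(1)] by (simp add: plucker_relation_def algebra_simps)
    then have "d p g * d p' z = d p z * d p' g" using two by simp
    then have "d p' z = k * d p z" using g(2) by (simp add: k_def field_simps)
    then have "d z e1 = 0"
      using dG[OF z g(1)] skew(2)[of p' z] skew(2)[of p z] pp z by (simp add: sk)
    then show ?thesis using skew(2)[of z e1] e1W z by simp
  qed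
  let ?Z = "?G \<inter> {z. d p z = 0}"
  have dimZ: "dim ?Z \<ge> 2" using dim_kernel_ge[OF sG lin(2)[of p]] dimG by linarith
  have "\<exists>w\<in>?Z. w \<noteq> 0" by (rule dim_pos_imp_nonzero) (use dimZ in linarith)
  then obtain z1 where z1: "z1 \<in> ?Z" "z1 \<noteq> 0" by blast
  have "dim {z1} < dim ?Z" using dim_insert_le[of z1 "{}"] dimZ unfolding dim_empty by linarith
  from exists_notin_span[OF this] obtain z2 where z2: "z2 \<in> ?Z" "z2 \<notin> span {z1}" by blast
  define e where "e i = (case i of A0 \<Rightarrow> p | A1 \<Rightarrow> e1 | A2 \<Rightarrow> g | A3 \<Rightarrow> z1 | A4 \<Rightarrow> z2)" for i
  have eG: "g \<in> ?G" "z1 \<in> ?G" "z2 \<in> ?G" using g z1 z2 by auto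
  have bG': "b p z = 0" "b z p = 0" "b e1 z = 0" "b z e1 = 0" if "z \<in> ?G" for z
    using G[OF that] be1G[OF that] skew(1)[of p z] skew(1)[of e1 z] pp e1W that by auto
  have dG': "d e1 z = 0" "d z e1 = 0" if "z \<in> ?G" for z
    using de1G[OF that] skew(2)[of e1 z] e1W that by auto
  have dz12: "d p z1 = 0" "d p z2 = 0" "d z1 p = 0" "d z2 p = 0" "d e1 p = 0"
    using z1 z2 skew(2)[of p z1] skew(2)[of p z2] skew(2)[of p e1] pp e1W de1 by auto
  have "indep_fam UNIV e"
    unfolding indep_fam_def
  proof (intro allI impI ballI)
    fix c i assume "(\<Sum>i\<in>UNIV. scale (c i) (e i)) = 0"
    then have z: "scale (c A0) p + scale (c A1) e1 + scale (c A2) g + scale (c A3) z1 + scale (c A4) z2 = 0"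
      by (simp add: sum_five e_def)
    have bz: "c A0 * b v p + c A1 * b v e1 + c A2 * b v g + c A3 * b v z1 + c A4 * b v z2 = 0" for v
      using arg_cong[OF z, of "b v"] by (simp add: linear_form_add[OF lin(1)] linear_form_scale[OF lin(1)]
          linear_form_0[OF lin(1)])
    have dz: "c A0 * d v p + c A1 * d v e1 + c A2 * d v g + c A3 * d v z1 + c A4 * d v z2 = 0" for v
      using arg_cong[OF z, of "d v"] by (simp add: linear_form_add[OF lin(2)] linear_form_scale[OF lin(2)]
          linear_form_0[OF lin(2)])
    have c1: "c A1 = 0" using bz[of p] alt(1)[OF pp(1)] bG'[OF eG(1)] bG'[OF eG(2)] bG'[OF eG(3)] be1 pp(3) by simp
    have "b e1 p = - b p p'" using skew(1)[of p e1] pp e1W be1 by simp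
    then have c0: "c A0 = 0" using bz[of e1] alt(1)[OF e1W] bG'[OF eG(1)] bG'[OF eG(2)] bG'[OF eG(3)] pp(3) by simp
    have c2: "c A2 = 0" using dz[of p] c0 c1 dz12 g(2) by simp
    have "scale (c A3) z1 + scale (c A4) z2 = 0" using z c0 c1 c2 by simp
    then have "c A3 = 0" "c A4 = 0" using independent_pairI[OF z1(2) z2(2)] by blast+
    with c0 c1 c2 show "c i = 0" by (cases i) auto
  qed
  moreover have "e i \<in> W" for i using pp e1W eG by (cases i) (auto simp: e_def)
  moreover have "b (e A0) (e A1) \<noteq> 0" "d (e A0) (e A2) \<noteq> 0" using be1 pp g by (simp_all add: e_def)
  moreover have "b (e i) (e j) = 0" if "\<not> (i = A0 \<and> j = A1 \<or> i = A1 \<and> j = A0)" for i j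
  proof -
    note z = alt(1)[OF pp(1)] alt(1)[OF e1W] bG'[OF eG(1)] bG'[OF eG(2)] bG'[OF eG(3)]
      bG[OF eG(1) eG(1)] bG[OF eG(1) eG(2)] bG[OF eG(1) eG(3)] bG[OF eG(2) eG(1)] bG[OF eG(2) eG(2)]
      bG[OF eG(2) eG(3)] bG[OF eG(3) eG(1)] bG[OF eG(3) eG(2)] bG[OF eG(3) eG(3)]
    show ?thesis using that by (cases i; cases j) (simp_all add: e_def z)
  qed
  moreover have "d (e i) (e j) = 0" if "\<not> (i = A0 \<and> j = A2 \<or> i = A2 \<and> j = A0)" for i j
  proof -
    note z = alt(2)[OF pp(1)] alt(2)[OF e1W] dG'[OF eG(1)] dG'[OF eG(2)] dG'[OF eG(3)] de1 dz12
      dG[OF eG(1) eG(1)] dG[OF eG(1) eG(2)] dG[OF eG(1) eG(3)] dG[OF eG(2) eG(1)] dG[OF eG(2) eG(2)]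
      dG[OF eG(2) eG(3)] dG[OF eG(3) eG(1)] dG[OF eG(3) eG(2)] dG[OF eG(3) eG(3)]
    show ?thesis using that by (cases i; cases j) (simp_all add: e_def z)
  qed
  ultimately show ?thesis by (intro exI[of _ e] conjI allI impI)
qed

lemma plucker_relation_span:
  assumes b: "\<And>x. linear_form (b x)" "\<And>y. linear_form (\<lambda>x. b x y)"
    and d: "\<And>x. linear_form (d x)" "\<And>y. linear_form (\<lambda>x. d x y)"
    and gen: "\<And>x y z w. x \<in> A \<Longrightarrow> y \<in> A \<Longrightarrow> z \<in> A \<Longrightarrow> w \<in> A \<Longrightarrow> plucker_relation b d x y z w"
    and mem: "x \<in> span A" "y \<in> span A" "z \<in> span A" "w \<in> span A"
  shows "plucker_relation b d x y z w"
proof -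
  define P where "P x y z w = b x y * d z w + d x y * b z w - b x z * d y w - d x z * b y w
     + b x w * d y z + d x w * b y z" for x y z w
  note add = linear_form_add[OF b(1)] linear_form_add[OF b(2)] linear_form_add[OF d(1)] linear_form_add[OF d(2)]
  note sc = linear_form_scale[OF b(1)] linear_form_scale[OF b(2)] linear_form_scale[OF d(1)] linear_form_scale[OF
      d(2)]
  have P: "linear_form (\<lambda>x. P x y z w)" "linear_form (\<lambda>y. P x y z w)" "linear_form (\<lambda>z. P x y z w)"
    "linear_form (\<lambda>w. P x y z w)" for x y z w
    by (rule linear_formI; simp add: P_def add sc algebra_simps)+
  have "P x y z w = 0" if "x \<in> A" "y \<in> A" "z \<in> A" "w \<in> A" for x y z w
    using gen[OF that] by (simp add: plucker_relation_def P_def)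
  then have "P x' y' z' w = 0" if "x' \<in> A" "y' \<in> A" "z' \<in> A" for x' y' z'
    by (intro linear_form_zero_span[OF P(4) _ mem(4)]) (use that in simp)
  then have "P x' y' z w = 0" if "x' \<in> A" "y' \<in> A" for x' y'
    by (intro linear_form_zero_span[OF P(3) _ mem(3)]) (use that in simp)
  then have "P x' y z w = 0" if "x' \<in> A" for x'
    by (intro linear_form_zero_span[OF P(2) _ mem(2)]) (use that in simp)
  then have "P x y z w = 0"
    by (intro linear_form_zero_span[OF P(1) _ mem(1)])
  then show ?thesis by (simp add: plucker_relation_def P_def)
qed

end

context spinor_frame
begin

lemma bform_linear:
  "V.linear_form (\<lambda>w. pairing s (cl u (cl' w t)))" "V.linear_form (\<lambda>u. pairing s (cl u (cl' w t)))"
  by (auto intro!: V.linear_formI simp: cl_linear cl'_linear pairing_linear)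

text \<open>The five Pfaffians are the Pluecker relations with increasing indices; the relation is alternating
  in its four indices.\<close>

lemma pf_plucker:
  assumes b: "\<And>i j. b j i = - b i j" and d: "\<And>i j. d j i = - d i j" and pf: "\<And>m. pf m b d = 0"
  shows "plucker_relation b d i j k l"
proof -
  define P where "P i j k l = b i j * d k l + d i j * b k l - b i k * d j l - d i k * b j l
     + b i l * d j k + d i l * b j k" for i j k l
  have diag: "b i i = 0" "d i i = 0" for i using b[of i i] d[of i i] by (simp_all add: equation_minus_iff)
  have swap: "P j i k l = - P i j k l" "P i k j l = - P i j k l" "P i j l k = - P i j k l" for i j k l
    unfolding P_def b[of i j] d[of i j] b[of j k] d[of j k] b[of k l] d[of k l] by (simp_all add: algebra_simps)
  have eq: "P i i k l = 0" "P i j j l = 0" "P i j k k = 0" for i j k l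
    unfolding P_def by (simp_all add: diag b[of k i] d[of k i] b[of i j] d[of i j] algebra_simps)
  have base: "P A0 A1 A2 A3 = 0" "P A0 A1 A2 A4 = 0" "P A0 A1 A3 A4 = 0" "P A0 A2 A3 A4 = 0" "P A1 A2 A3 A4 = 0"
    using pf[of A0] pf[of A1] pf[of A2] pf[of A3] pf[of A4] by (simp_all add: P_def algebra_simps)
  note sort =
    swap(1)[of A1 A0] swap(1)[of A2 A0] swap(1)[of A2 A1] swap(1)[of A3 A0] swap(1)[of A3 A1]
    swap(1)[of A3 A2] swap(1)[of A4 A0] swap(1)[of A4 A1] swap(1)[of A4 A2] swap(1)[of A4 A3]
    swap(2)[of _ A1 A0] swap(2)[of _ A2 A0] swap(2)[of _ A2 A1] swap(2)[of _ A3 A0] swap(2)[of _ A3 A1] swap(2)[of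
        _ A3 A2] swap(2)[of _ A4 A0] swap(2)[of _ A4 A1] swap(2)[of _ A4 A2]
    swap(2)[of _ A4 A3] swap(3)[of _ _ A1 A0] swap(3)[of _ _ A2 A0] swap(3)[of _ _ A2 A1]
    swap(3)[of _ _ A3 A0] swap(3)[of _ _ A3 A1] swap(3)[of _ _ A3 A2] swap(3)[of _ _ A4 A0]
    swap(3)[of _ _ A4 A1] swap(3)[of _ _ A4 A2] swap(3)[of _ _ A4 A3]
  have "P i j k l = 0"
    by (cases i; cases j; cases k; cases l) (simp_all only: sort eq base minus_zero)
  then show ?thesis unfolding plucker_relation_def P_def .
qed

lemma null_if_frame:
  assumes "\<And>i. pairing s (cl (e i) s) = 0" "\<And>i. pairing s (cl (f i) s) = 0"
  shows "pairing s (cl v s) = 0"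
  unfolding quadric_expansion[of s v] assms by simp

text \<open>The frame is changed so that the vacuum and the opposite subspace stay the same, and the bivectors of
  two given spinors take the normal form. Since \<open>tau\<close> changes by a scalar, vanishing of the coordinates \<open>b\<close>
  can be tested with the old \<open>tau\<close>.\<close>

lemma adapted_frame:
  assumes a: "a_coord s1 = 0" "a_coord s2 = 0"
    and pf: "\<And>m. pf m (b_coord s1) (b_coord s1) = 0" "\<And>m. pf m (b_coord s1) (b_coord s2) = 0"
      "\<And>m. pf m (b_coord s2) (b_coord s2) = 0"
    and ind: "\<And>r t. (\<And>i j. r * b_coord s1 i j + t * b_coord s2 i j = 0) \<Longrightarrow> r = 0 \<and> t = 0"
  shows "\<exists>e' f' c. spinor_frame sV sS sS' q cl cl' pairing e' f' Om \<and> (\<forall>i. f' i \<in> V.span (range f)) \<and>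
    spinor_frame.tau cl cl' f' Om = sS' c tau \<and>
    pairing s1 (cl (e' A0) (cl' (e' A1) tau)) \<noteq> 0 \<and> pairing s2 (cl (e' A0) (cl' (e' A2) tau)) \<noteq> 0 \<and>
    (\<forall>i j. \<not> (i = A0 \<and> j = A1 \<or> i = A1 \<and> j = A0) \<longrightarrow> pairing s1 (cl (e' i) (cl' (e' j) tau)) = 0) \<and>
    (\<forall>i j. \<not> (i = A0 \<and> j = A2 \<or> i = A2 \<and> j = A0) \<longrightarrow> pairing s2 (cl (e' i) (cl' (e' j) tau)) = 0)"
proof -
  let ?W = "V.span (range e)"
  define B where "B s u w = pairing s (cl u (cl' w tau))" for s u w
  have lin: "V.linear_form (B s u)" "V.linear_form (\<lambda>u. B s u w)" for s u w
    unfolding B_def by (rule bform_linear)+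
  have Be: "B s (e i) (e j) = kappa * b_coord s i j" for s i j
    using kappa_nonzero by (simp add: B_def b_coord_def)
  have W: "?W \<in> OGr" by (rule hyperbolic_OGr[OF hyperbolic_frame])
  have skew: "B s y x = - B s x y" if "x \<in> ?W" "y \<in> ?W" for s x y
    using OGr_D(3)[OF W that(2,1)] by (simp add: B_def cl'_anticommute[of y x] pairing_minus)
  have pl: "plucker_relation (B s) (B s') x y z w"
    if p: "\<And>m. pf m (b_coord s) (b_coord s') = 0" and xyzw: "x \<in> ?W" "y \<in> ?W" "z \<in> ?W" "w \<in> ?W" for s s' x y z w
  proof (rule V.plucker_relation_span[OF lin lin _ xyzw])
    fix x y z w assume "x \<in> range e" "y \<in> range e" "z \<in> range e" "w \<in> range e"
    then obtain i j k l where "x = e i" "y = e j" "z = e k" "w = e l" by blast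
    moreover have "plucker_relation (b_coord s) (b_coord s') i j k l"
      by (rule pf_plucker) (rule b_coord_skew b_coord_skew p)+
    then have "kappa * kappa * (b_coord s i j * b_coord s' k l + b_coord s' i j * b_coord s k l
        - b_coord s i k * b_coord s' j l - b_coord s' i k * b_coord s j l
        + b_coord s i l * b_coord s' j k + b_coord s' i l * b_coord s j k) = 0"
      by (simp add: plucker_relation_def)
    ultimately show "plucker_relation (B s) (B s') x y z w"
      by (simp add: plucker_relation_def Be algebra_simps)
  qed
  have indB: "r = 0 \<and> t = 0" if z: "\<And>x y. x \<in> ?W \<Longrightarrow> y \<in> ?W \<Longrightarrow> r * B s1 x y + t * B s2 x y = 0" for r t
  proof (rule ind)
    fix i j
    have "r * B s1 (e i) (e j) + t * B s2 (e i) (e j) = 0" by (rule z) (auto intro: V.span_base)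
    then have "kappa * (r * b_coord s1 i j + t * b_coord s2 i j) = 0" by (simp add: Be algebra_simps)
    then show "r * b_coord s1 i j + t * b_coord s2 i j = 0" using kappa_nonzero by simp
  qed
  have "\<exists>e'. V.indep_fam UNIV e' \<and> (\<forall>i. e' i \<in> ?W) \<and> B s1 (e' A0) (e' A1) \<noteq> 0 \<and> B s2 (e' A0) (e' A2) \<noteq> 0 \<and>
    (\<forall>i j. \<not> (i = A0 \<and> j = A1 \<or> i = A1 \<and> j = A0) \<longrightarrow> B s1 (e' i) (e' j) = 0) \<and>
    (\<forall>i j. \<not> (i = A0 \<and> j = A2 \<or> i = A2 \<and> j = A0) \<longrightarrow> B s2 (e' i) (e' j) = 0)"
    by (rule V.pencil_normal_form[OF _ OGr_D(1)[OF W] lin(1) lin(1) skew skew pl pl pl indB OGr_D(2)[OF W]])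
       (simp_all add: pf)
  then obtain e' where e': "V.indep_fam UNIV e'" "\<forall>i. e' i \<in> ?W"
    and B: "B s1 (e' A0) (e' A1) \<noteq> 0 \<and> B s2 (e' A0) (e' A2) \<noteq> 0 \<and>
      (\<forall>i j. \<not> (i = A0 \<and> j = A1 \<or> i = A1 \<and> j = A0) \<longrightarrow> B s1 (e' i) (e' j) = 0) \<and>
      (\<forall>i j. \<not> (i = A0 \<and> j = A2 \<or> i = A2 \<and> j = A0) \<longrightarrow> B s2 (e' i) (e' j) = 0)" by blast
  obtain f' where f': "\<forall>i. f' i \<in> V.span (range f)" "hyperbolic e' f'"
    using hyperbolic_rebase[OF hyperbolic_frame e'(1)] e'(2) by blast
  note Om = annihilates_Om
  have fr: "spinor_frame sV sS sS' q cl cl' pairing e' f' Om"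
    by (rule frame_of_annihilates[OF Om f'(2)]) (use e'(2) in blast)
  interpret new: spinor_frame sV sS sS' q cl cl' pairing e' f' Om by (rule fr)
  have ff: "f i \<in> V.span (range f')" for i
  proof -
    have "V.span (range f') = V.span (range f)"
    proof (rule V.span_fam_eq_subspace)
      show "V.indep_fam UNIV f'" by (rule hyperbolic_indep[OF hyperbolic_commute[OF f'(2)]])
      show "V.dim (V.span (range f)) \<le> card (UNIV :: five set)"
        using OGr_D(2)[OF hyperbolic_OGr[OF hyperbolic_commute[OF hyperbolic_frame]]] card_five by simp
    qed (use f'(1) in auto)
    then show ?thesis by (auto intro: V.span_base)
  qed
  obtain c where "new.tau = sS' c tau" using tau_unique[of new.tau] cl'_zero_span[OF _ ff] new.f_tau by blast
  then show ?thesis using fr f'(1) B unfolding B_def by blast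
qed

lemma b_coord_cong_tau:
  assumes "spinor_frame.tau cl cl' f Om = sS' c t" and "c \<noteq> 0"
  shows "b_coord s i j = 0 \<longleftrightarrow> pairing s (cl (e i) (cl' (e j) t)) = 0"
  using assms kappa_nonzero by (simp add: b_coord_def cl_linear cl'_linear pairing_linear)

text \<open>The bivectors of \<open>N\<close> are decomposable with all their sums, i.e. they are lines in projective
  4-space any two of which meet. If two of the lines are \<open>01\<close> and \<open>02\<close>, then all lines pass through the
  point \<open>0\<close> or all lie in the plane \<open>012\<close>.\<close>

lemma star_or_plane:
  assumes N: "\<And>s s' m. s \<in> N \<Longrightarrow> s' \<in> N \<Longrightarrow> pf m (b_coord s) (b_coord s') = 0"
    and s1: "s1 \<in> N" "b_coord s1 A0 A1 \<noteq> 0"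
      "\<And>i j. \<not> (i = A0 \<and> j = A1 \<or> i = A1 \<and> j = A0) \<Longrightarrow> b_coord s1 i j = 0"
    and s2: "s2 \<in> N" "b_coord s2 A0 A2 \<noteq> 0"
      "\<And>i j. \<not> (i = A0 \<and> j = A2 \<or> i = A2 \<and> j = A0) \<Longrightarrow> b_coord s2 i j = 0"
  shows "(\<forall>s\<in>N. \<forall>i j. i \<noteq> A0 \<and> j \<noteq> A0 \<longrightarrow> b_coord s i j = 0) \<or>
    (\<forall>s\<in>N. \<forall>i j. i \<in> {A3, A4} \<or> j \<in> {A3, A4} \<longrightarrow> b_coord s i j = 0)"
proof -
  have van: "b_coord s A3 A4 = 0" "b_coord s A2 A4 = 0" "b_coord s A2 A3 = 0" "b_coord s A1 A4 = 0"
      "b_coord s A1 A3 = 0"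
    if s: "s \<in> N" for s
    using N[OF s1(1) s, of A2] N[OF s1(1) s, of A3] N[OF s1(1) s, of A4]
      N[OF s2(1) s, of A3] N[OF s2(1) s, of A4] s1(2) s2(2)
    by (simp_all add: s1(3) s2(3))
  have rel: "b_coord s A0 A3 * b_coord s' A1 A2 + b_coord s' A0 A3 * b_coord s A1 A2 = 0"
    "b_coord s A0 A4 * b_coord s' A1 A2 + b_coord s' A0 A4 * b_coord s A1 A2 = 0"
    if "s \<in> N" "s' \<in> N" for s s'
    using N[OF that, of A4] N[OF that, of A3] van[OF that(1)] van[OF that(2)]
    by (simp_all add: neg_eq_iff_add_eq_0)
  show ?thesis
  proof (cases "\<forall>s\<in>N. b_coord s A1 A2 = 0")
    case True
    have "b_coord s i j = 0" if s: "s \<in> N" and ij: "i \<noteq> A0 \<and> j \<noteq> A0" for s i j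
      using ij van[OF s] True[rule_format, OF s]
        b_coord_skew[of s A1 A2] b_coord_skew[of s A1 A3] b_coord_skew[of s A1 A4]
        b_coord_skew[of s A2 A3] b_coord_skew[of s A2 A4] b_coord_skew[of s A3 A4]
      by (cases i; cases j) simp_all
    then show ?thesis by blast
  next
    case False
    then obtain t where t: "t \<in> N" "b_coord t A1 A2 \<noteq> 0" by blast
    have t0: "b_coord t A0 A3 = 0" "b_coord t A0 A4 = 0" using rel[OF t(1) t(1)] t(2) by simp_all
    have z: "b_coord s A0 A3 = 0" "b_coord s A0 A4 = 0" if s: "s \<in> N" for s
      using rel[OF s t(1)] t0 t(2) by simp_all
    have "b_coord s i j = 0" if s: "s \<in> N" and ij: "i \<in> {A3, A4} \<or> j \<in> {A3, A4}" for s i j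
      using ij van[OF s] z[OF s]
        b_coord_skew[of s A0 A3] b_coord_skew[of s A0 A4] b_coord_skew[of s A1 A3] b_coord_skew[of s A1 A4]
        b_coord_skew[of s A2 A3] b_coord_skew[of s A2 A4] b_coord_skew[of s A3 A4]
      by (cases i; cases j) simp_all
    then show ?thesis by blast
  qed
qed

end

section \<open>Linear spaces of spinors\<close>

context half_spinors
begin

interpretation dual: half_spinors sV sS' sS q cl' cl "\<lambda>t s. pairing s t"
  by (rule dual_half_spinors)

lemma quadric_polarize:
  assumes K: "S.subspace K" and z: "\<And>s. s \<in> K \<Longrightarrow> pairing s (cl v s) = 0" and ss: "s \<in> K" "s' \<in> K"
  shows "pairing s (cl v s') = 0"
proof -
  have "pairing (s + s') (cl v (s + s')) = 0" by (intro z S.subspace_add K ss)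
  then have "pairing s (cl v s') + pairing s' (cl v s) = 0"
    using z[OF ss(1)] z[OF ss(2)] by (simp add: pairing_linear cl_linear add.commute)
  then have "2 * pairing s (cl v s') = 0" by (simp add: quadric_commute[of s' v s])
  then show ?thesis by simp
qed

text \<open>In a frame at a point \<open>s0\<close> of \<open>M\<close>, all points have \<open>c = 0\<close> since the quadrics vanish on \<open>M\<close> together
  with their bilinear forms, and their bivectors satisfy the hypothesis of \<open>star_or_plane\<close>. A plane gives only dimension
  \<open>1 + 3\<close>, so \<open>M\<close> consists of all \<open>a + f 0 \<and> x\<close>, which is \<open>V t\<close> for the pure spinor
  \<open>t = f 0 s0\<close>.\<close>

lemma linear_family_in_X:
  assumes M: "S.subspace M" "S.dim M = 5" and pure: "\<And>s. s \<in> M \<Longrightarrow> s \<noteq> 0 \<Longrightarrow> \<exists>U. annihilates U s"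
  shows "\<exists>W t. dual.annihilates W t \<and> (\<forall>v. cl' v t \<in> M)"
proof -
  have null1: "pairing s (cl v s) = 0" if "s \<in> M" for s v
  proof (cases "s = 0")
    case False
    then show ?thesis using pure[OF that] annihilates_quadric by blast
  qed simp
  have null: "pairing s (cl v s') = 0" if "s \<in> M" "s' \<in> M" for s s' v
    by (rule quadric_polarize[OF M(1) null1 that])
  have "\<exists>s\<in>M. s \<noteq> 0" by (rule S.dim_pos_imp_nonzero) (simp add: M)
  then obtain s0 where s0: "s0 \<in> M" "s0 \<noteq> 0" by blast
  obtain U where U: "annihilates U s0" using pure[OF s0] by blast
  obtain e f where fr: "spinor_frame sV sS sS' q cl cl' pairing e f s0" using frame_at[OF U] by blast
  interpret fr: spinor_frame sV sS sS' q cl cl' pairing e f s0 by (rule fr)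
  have c0: "fr.c_coord s i = 0" if "s \<in> M" for s i
    by (simp add: fr.c_coord_def null[OF that s0(1)])
  have pf0: "fr.pf m (fr.b_coord s) (fr.b_coord s') = 0" if "s \<in> M" "s' \<in> M" for s s' m
    using null[OF that, of "f m"] fr.kappa_nonzero by (simp add: fr.quadric_f c0 that)
  have la: "S.linear_form fr.a_coord"
    by (rule S.linear_formI) (simp_all add: fr.coord_linear)
  let ?N = "M \<inter> {s. fr.a_coord s = 0}"
  have N: "S.subspace ?N" by (rule S.subspace_kernel[OF la M(1)])
  have "2 \<le> S.dim ?N" using S.dim_kernel_ge[OF M(1) la] M(2) by linarith
  then obtain s1 s2 where s12: "s1 \<in> ?N" "s2 \<in> ?N"
    and ind: "\<And>r t. sS r s1 + sS t s2 = 0 \<Longrightarrow> r = 0 \<and> t = 0"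
    using S.exists_independent_pair[OF N] by blast
  have s12M: "s1 \<in> M" "s2 \<in> M" "fr.a_coord s1 = 0" "fr.a_coord s2 = 0" using s12 by auto
  have indb: "r = 0 \<and> t = 0" if z: "\<And>i j. r * fr.b_coord s1 i j + t * fr.b_coord s2 i j = 0" for r t
  proof (rule ind, rule fr.coords_zero_imp)
    show "fr.a_coord (sS r s1 + sS t s2) = 0" using s12M by (simp add: fr.coord_linear)
    show "fr.b_coord (sS r s1 + sS t s2) i j = 0" for i j by (simp add: fr.coord_linear z)
    show "fr.c_coord (sS r s1 + sS t s2) i = 0" for i using c0 s12M by (simp add: fr.coord_linear)
  qed
  obtain e' f' c where fr': "spinor_frame sV sS sS' q cl cl' pairing e' f' s0"
    and tau': "spinor_frame.tau cl cl' f' s0 = sS' c fr.tau"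
    and b1: "pairing s1 (cl (e' A0) (cl' (e' A1) fr.tau)) \<noteq> 0" and b2:
        "pairing s2 (cl (e' A0) (cl' (e' A2) fr.tau)) \<noteq> 0"
    and b1z: "\<forall>i j. \<not> (i = A0 \<and> j = A1 \<or> i = A1 \<and> j = A0) \<longrightarrow> pairing s1 (cl (e' i) (cl' (e' j) fr.tau)) = 0"
    and b2z: "\<forall>i j. \<not> (i = A0 \<and> j = A2 \<or> i = A2 \<and> j = A0) \<longrightarrow> pairing s2 (cl (e' i) (cl' (e' j) fr.tau)) = 0"
    using fr.adapted_frame[OF s12M(3,4) pf0[OF s12M(1,1)] pf0[OF s12M(1,2)] pf0[OF s12M(2,2)] indb] by blast
  interpret fn: spinor_frame sV sS sS' q cl cl' pairing e' f' s0 by (rule fr')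
  have "c \<noteq> 0" using tau' fn.tau_nonzero by auto
  note bt = fn.b_coord_cong_tau[OF tau' this]
  have c: "fn.c_coord s i = 0" if "s \<in> M" for s i
    by (simp add: fn.c_coord_def null[OF that s0(1)])
  have pf: "fn.pf m (fn.b_coord s) (fn.b_coord s') = 0" if "s \<in> M" "s' \<in> M" for s s' m
    using null[OF that, of "f' m"] fn.kappa_nonzero by (simp add: fn.quadric_f c that)
  have dich: "(\<forall>s\<in>M. \<forall>i j. i \<noteq> A0 \<and> j \<noteq> A0 \<longrightarrow> fn.b_coord s i j = 0) \<or>
    (\<forall>s\<in>M. \<forall>i j. i \<in> {A3, A4} \<or> j \<in> {A3, A4} \<longrightarrow> fn.b_coord s i j = 0)"
    by (rule fn.star_or_plane[OF pf s12M(1) _ _ s12M(2)]) (use b1 b2 b1z b2z in \<open>auto simp: bt\<close>)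
  let ?m = "\<lambda>i j. cl' (f' i) (cl (f' j) s0)"
  have not_plane: "\<not> (\<forall>s\<in>M. \<forall>i j. i \<in> {A3, A4} \<or> j \<in> {A3, A4} \<longrightarrow> fn.b_coord s i j = 0)"
  proof
    assume z: "\<forall>s\<in>M. \<forall>i j. i \<in> {A3, A4} \<or> j \<in> {A3, A4} \<longrightarrow> fn.b_coord s i j = 0"
    have "M \<subseteq> S.span {s0, ?m A0 A1, ?m A0 A2, ?m A1 A2}"
    proof
      fix s assume s: "s \<in> M"
      have b: "fn.b_coord s i A3 = 0" "fn.b_coord s i A4 = 0" for i using z s by blast+
      have "s = sS (fn.a_coord s) s0 + sS (fn.b_coord s A0 A1) (?m A0 A1)
          + sS (fn.b_coord s A0 A2) (?m A0 A2) + sS (fn.b_coord s A1 A2) (?m A1 A2)"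
        by (subst fn.spinor_expansion[of s]) (simp add: b c s)
      also have "\<dots> \<in> S.span {s0, ?m A0 A1, ?m A0 A2, ?m A1 A2}"
        by (intro S.span_add S.span_scale S.span_base) simp_all
      finally show "s \<in> S.span {s0, ?m A0 A1, ?m A0 A2, ?m A1 A2}" .
    qed
    from S.dim_le_card[OF this] have "S.dim M \<le> card {s0, ?m A0 A1, ?m A0 A2, ?m A1 A2}" by simp
    also have "\<dots> \<le> 4" by (simp add: card_insert_if)
    finally show False using M(2) by simp
  qed
  with dich have star: "fn.b_coord s i j = 0" if "s \<in> M" "i \<noteq> A0" "j \<noteq> A0" for s i j using that by blast
  let ?A = "{s0, ?m A0 A1, ?m A0 A2, ?m A0 A3, ?m A0 A4}"
  have MA: "M \<subseteq> S.span ?A"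
  proof
    fix s assume s: "s \<in> M"
    have "s = sS (fn.a_coord s) s0 + sS (fn.b_coord s A0 A1) (?m A0 A1)
        + sS (fn.b_coord s A0 A2) (?m A0 A2) + sS (fn.b_coord s A0 A3) (?m A0 A3) + sS (fn.b_coord s A0 A4) (?m A0
            A4)"
      by (subst fn.spinor_expansion[of s]) (simp add: star c s)
    also have "\<dots> \<in> S.span ?A"
      by (intro S.span_add S.span_scale S.span_base) simp_all
    finally show "s \<in> S.span ?A" .
  qed
  have "S.dim (S.span ?A) \<le> card ?A" by (rule S.dim_le_card) simp_all
  also have "card ?A \<le> 5" by (simp add: card_insert_if)
  finally have "M = S.span ?A"
    by (intro S.subspace_dim_equal[OF M(1) _ MA]) (simp_all only: M(2) S.subspace_span)
  then have mM: "s0 \<in> M" "?m A0 i \<in> M" for i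
    using S.span_base[of _ ?A] S.subspace_0[OF M(1)] by (auto, cases i) (auto simp: fn.f_square)
  let ?t = "cl (f' A0) s0"
  have "cl' (e' A0) ?t = s0" by (simp add: fn.e_f_commute fn.e_Om)
  then have tnz: "?t \<noteq> 0" using s0(2) by auto
  obtain W where W: "dual.annihilates W ?t" using annihilates_reflect[OF U fn.q_f tnz] by blast
  have te: "cl' (e' i) ?t \<in> M" for i
    using mM(1) S.subspace_0[OF M(1)] by (simp add: fn.e_f_commute fn.e_Om)
  have tf: "cl' (f' i) ?t \<in> M" for i
    unfolding fn.f_f_commute(1)[of i] using S.subspace_neg[OF M(1) mM(2)] by simp
  have sum: "cl' (\<Sum>i\<in>J. sV (k i) (g i)) ?t \<in> M" if "\<And>i. cl' (g i) ?t \<in> M" for k and g :: "five \<Rightarrow> 'v" and J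
    by (induction J rule: infinite_finite_induct)
       (auto simp: cl'_linear that intro!: S.subspace_add S.subspace_scale S.subspace_0 M)
  have "cl' v ?t \<in> M" for v
    by (subst hyperbolic_expansion[OF fn.hyperbolic_frame, of v])
       (simp only: cl'_linear, intro S.subspace_add M sum te tf)
  with W show ?thesis by blast
qed

lemma quadric_combination:
  "pairing (sS x s + sS y s') (cl v (sS x s + sS y s')) =
    pairing s (cl v s) * x\<^sup>2 + 2 * pairing s (cl v s') * (x * y) + pairing s' (cl v s') * y\<^sup>2"
  by (simp add: cl_linear pairing_linear quadric_commute[of s' v s] power2_eq_square algebra_simps)

text \<open>In a frame where \<open>F\<close> is spanned by \<open>f\<close>, a spinor with \<open>a \<noteq> 0\<close> is pure by
  \<open>annihilates_if_a_coord\<close>. So let \<open>a = 0\<close> on \<open>K\<close>. Then the bivectors \<open>b\<close> satisfy the Pluecker relations, and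
  a common zero of the contractions of \<open>b\<close> with \<open>c\<close> is needed. If \<open>b\<close> is not injective on \<open>K\<close>,
  a nonzero spinor with \<open>b = 0\<close> will do. If all \<open>b\<close> have the factor \<open>f 0\<close>, then all components of the contraction except the first are
  multiples of \<open>c 0\<close>; the condition \<open>c 0 = 0\<close> leaves one quadratic form in two variables. If all \<open>b\<close> lie in a plane, the contraction is the cross product of \<open>c\<close> with the vector
  corresponding to \<open>b\<close>, and some spinor has these two vectors proportional, because a pencil of square matrices has a
  degenerate member.\<close>

lemma net_contains_pure:
  assumes F: "dual.annihilates F t" and K: "S.subspace K" "S.dim K = 3"
    and FK: "\<And>s v. s \<in> K \<Longrightarrow> v \<in> F \<Longrightarrow> pairing s (cl v s) = 0"
  shows "\<exists>s\<in>K. \<exists>U. annihilates U s"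
proof (rule ccontr)
  assume none: "\<not> ?thesis"
  obtain e f Om where fr: "V.span (range f) = F" "spinor_frame sV sS sS' q cl cl' pairing e f Om"
    using frame_at_dual[OF F] by blast
  interpret fr: spinor_frame sV sS sS' q cl cl' pairing e f Om by (rule fr(2))
  have tau: "dual.annihilates F fr.tau"
    using spinor_frame.annihilates_Om[OF fr.dual_spinor_frame] fr(1) by simp
  have pairing_tau: "pairing s fr.tau = 0" if "s \<in> K" for s
  proof (rule ccontr)
    assume "pairing s fr.tau \<noteq> 0"
    from annihilates_if_pairing[OF tau this FK[OF that]] none that show False by blast
  qed
  have not_null: "s = 0" if s: "s \<in> K" and "\<And>v. pairing s (cl v s) = 0" for s
    using annihilates_if_null[of s] that none by blast
  have FK2: "pairing s (cl v s') = 0" if "s \<in> K" "s' \<in> K" "v \<in> F" for s s' v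
    by (rule quadric_polarize[OF K(1) _ that(1,2)]) (rule FK[OF _ that(3)])
  have fF: "f i \<in> F" for i using fr(1) V.span_base[of "f i" "range f"] by auto
  have a0: "fr.a_coord s = 0" if "s \<in> K" for s using pairing_tau[OF that] by (simp add: fr.a_coord_def)
  have pf0: "fr.pf m (fr.b_coord s) (fr.b_coord s') = 0" if "s \<in> K" "s' \<in> K" for s s' m
    using FK2[OF that fF, of m] fr.kappa_nonzero by (simp add: fr.quadric_f a0 that)
  have "2 \<le> S.dim K" using K(2) by simp
  then obtain s1 s2 where s12: "s1 \<in> K" "s2 \<in> K"
    and ind: "\<And>r t. sS r s1 + sS t s2 = 0 \<Longrightarrow> r = 0 \<and> t = 0"
    using S.exists_independent_pair[OF K(1)] by blast
  have indb: "r = 0 \<and> t = 0" if z: "\<And>i j. r * fr.b_coord s1 i j + t * fr.b_coord s2 i j = 0" for r t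
  proof (rule ind, rule not_null)
    show sK: "sS r s1 + sS t s2 \<in> K" by (intro S.subspace_add S.subspace_scale K s12)
    have b: "fr.b_coord (sS r s1 + sS t s2) i j = 0" for i j by (simp add: fr.coord_linear z)
    show "pairing (sS r s1 + sS t s2) (cl v (sS r s1 + sS t s2)) = 0" for v
      by (rule fr.null_if_frame) (simp add: fr.quadric_e b, rule FK[OF sK fF])
  qed
  obtain e' f' c where fr': "spinor_frame sV sS sS' q cl cl' pairing e' f' Om"
    and f'F: "\<forall>i. f' i \<in> V.span (range f)"
    and tau': "spinor_frame.tau cl cl' f' Om = sS' c fr.tau"
    and b1: "pairing s1 (cl (e' A0) (cl' (e' A1) fr.tau)) \<noteq> 0" and b2:
        "pairing s2 (cl (e' A0) (cl' (e' A2) fr.tau)) \<noteq> 0"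
    and b1z: "\<forall>i j. \<not> (i = A0 \<and> j = A1 \<or> i = A1 \<and> j = A0) \<longrightarrow> pairing s1 (cl (e' i) (cl' (e' j) fr.tau)) = 0"
    and b2z: "\<forall>i j. \<not> (i = A0 \<and> j = A2 \<or> i = A2 \<and> j = A0) \<longrightarrow> pairing s2 (cl (e' i) (cl' (e' j) fr.tau)) = 0"
    using fr.adapted_frame[OF a0[OF s12(1)] a0[OF s12(2)] pf0[OF s12(1,1)] pf0[OF s12(1,2)] pf0[OF s12(2,2)] indb]
        by blast
  interpret fn: spinor_frame sV sS sS' q cl cl' pairing e' f' Om by (rule fr')
  have "c \<noteq> 0" using tau' fn.tau_nonzero by auto
  note bt = fn.b_coord_cong_tau[OF tau' this]
  have f'F: "f' i \<in> F" for i using f'F fr(1) by simp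
  have a: "fn.a_coord s = 0" if "s \<in> K" for s
    using pairing_tau[OF that] by (simp add: fn.a_coord_def tau' pairing_linear)
  have pf: "fn.pf m (fn.b_coord s) (fn.b_coord s') = 0" if "s \<in> K" "s' \<in> K" for s s' m
    using FK2[OF that f'F, of m] fn.kappa_nonzero by (simp add: fn.quadric_f a that)
  have qf: "pairing s (cl (f' i) s) = 0" if "s \<in> K" for s i by (rule FK[OF that f'F])
  have dich: "(\<forall>s\<in>K. \<forall>i j. i \<noteq> A0 \<and> j \<noteq> A0 \<longrightarrow> fn.b_coord s i j = 0) \<or>
    (\<forall>s\<in>K. \<forall>i j. i \<in> {A3, A4} \<or> j \<in> {A3, A4} \<longrightarrow> fn.b_coord s i j = 0)"
    by (rule fn.star_or_plane[OF pf s12(1) _ _ s12(2)]) (use b1 b2 b1z b2z in \<open>auto simp: bt\<close>)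
  have "\<exists>s\<in>K. s \<noteq> 0 \<and> (\<forall>i. pairing s (cl (e' i) s) = 0)"
    using dich
  proof
    assume star: "\<forall>s\<in>K. \<forall>i j. i \<noteq> A0 \<and> j \<noteq> A0 \<longrightarrow> fn.b_coord s i j = 0"
    have lc: "S.linear_form (\<lambda>s. fn.c_coord s A0)"
      by (rule S.linear_formI) (simp_all add: fn.coord_linear)
    let ?N = "K \<inter> {s. fn.c_coord s A0 = 0}"
    have N: "S.subspace ?N" by (rule S.subspace_kernel[OF lc K(1)])
    have "2 \<le> S.dim ?N" using S.dim_kernel_ge[OF K(1) lc] K(2) by linarith
    then obtain k1 k2 where k: "k1 \<in> ?N" "k2 \<in> ?N"
      and indk: "\<And>r t. sS r k1 + sS t k2 = 0 \<Longrightarrow> r = 0 \<and> t = 0"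
      using S.exists_independent_pair[OF N] by blast
    obtain x y where xy: "x \<noteq> 0 \<or> y \<noteq> 0"
      "pairing k1 (cl (e' A0) k1) * x\<^sup>2 + 2 * pairing k1 (cl (e' A0) k2) * (x * y)
          + pairing k2 (cl (e' A0) k2) * y\<^sup>2 = 0"
      using quadratic_form_root by blast
    define s where "s = sS x k1 + sS y k2"
    have sN: "s \<in> ?N" unfolding s_def by (intro S.subspace_add[OF N] S.subspace_scale[OF N] k)
    have q0: "pairing s (cl (e' A0) s) = 0" unfolding s_def quadric_combination by (rule xy(2))
    have "pairing s (cl (e' i) s) = 0" for i
    proof (cases "i = A0")
      case False
      have "fn.b_coord s i j * fn.c_coord s j + fn.b_coord s i j * fn.c_coord s j = 0" for j
        using sN star False by (cases "j = A0") auto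
      then show ?thesis unfolding fn.quadric_e by (simp only: sum.neutral_const mult_zero_right)
    qed (simp add: q0)
    moreover have "s \<noteq> 0" using indk xy(1) unfolding s_def by blast
    ultimately show ?thesis using sN by blast
  next
    assume plane: "\<forall>s\<in>K. \<forall>i j. i \<in> {A3, A4} \<or> j \<in> {A3, A4} \<longrightarrow> fn.b_coord s i j = 0"
    obtain k where k: "S.indep_fam {0, 1, 2::nat} k" "S.span (k ` {0, 1, 2}) = K"
      using S.exists_fam[OF K(1), of "{0, 1, 2::nat}"] K(2) by auto
    have kK: "k i \<in> K" if "i \<in> {0, 1, 2}" for i using k(2) that S.span_base[of "k i" "k ` {0, 1, 2}"] by blast
    \<comment> \<open>The rows of \<open>C\<close> and \<open>D\<close> are the vectors of \<open>c\<close> and of \<open>b\<close> for a basis of \<open>K\<close>, the latter with the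
      signs of the isomorphism of bivectors and vectors in dimension 3.\<close>
    define C where "C m n = fn.c_coord (k m) (if n = 0 then A0 else if n = 1 then A1 else A2)" for m n :: nat
    define D where "D m n = (if n = 0 then fn.b_coord (k m) A1 A2 else if n = 1 then - fn.b_coord (k m) A0 A2
      else fn.b_coord (k m) A0 A1)" for m n :: nat
    obtain x y where xy: "x \<noteq> 0 \<or> y \<noteq> 0" "det3 (\<lambda>m n. x * C m n + y * D m n) 0 1 2 = 0"
      using det3_pencil[of C D 0 1 2] by blast
    obtain r0 r1 r2 where r: "r0 \<noteq> 0 \<or> r1 \<noteq> 0 \<or> r2 \<noteq> 0"
      and rk: "\<And>n. n \<in> {0, 1, 2} \<Longrightarrow> r0 * (x * C 0 n + y * D 0 n) + r1 * (x * C 1 n + y * D 1 n) + r2 * (x * C 2 n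
          + y * D 2 n) = 0"
      using det3_zero_kernel[OF xy(2)] by blast
    define s where "s = sS r0 (k 0) + sS r1 (k 1) + sS r2 (k 2)"
    have sK: "s \<in> K" unfolding s_def by (intro S.subspace_add S.subspace_scale K kK) simp_all
    have "s \<noteq> 0"
    proof
      assume "s = 0"
      define d where "d i = (if i = 0 then r0 else if i = 1 then r1 else r2)" for i :: nat
      have "(\<Sum>i\<in>{0, 1, 2}. sS (d i) (k i)) = 0" using \<open>s = 0\<close> by (simp add: s_def d_def add.assoc)
      then have "d i = 0" if "i \<in> {0, 1, 2}" for i using S.indep_famD[OF k(1) _ that] by blast
      from this[of 0] this[of 1] this[of 2] r show False by (simp add: d_def)
    qed
    have rel: "x * fn.c_coord s A0 + y * fn.b_coord s A1 A2 = 0" "x * fn.c_coord s A1 - y * fn.b_coord s A0 A2 = 0"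
      "x * fn.c_coord s A2 + y * fn.b_coord s A0 A1 = 0"
      using rk[of 0] rk[of 1] rk[of 2] by (simp_all add: s_def C_def D_def fn.coord_linear algebra_simps)
    have b34: "fn.b_coord s i A3 = 0" "fn.b_coord s A3 i = 0" "fn.b_coord s i A4 = 0" "fn.b_coord s A4 i = 0" for i
      using plane sK by blast+
    have "x \<noteq> 0"
    proof
      assume "x = 0"
      with xy(1) rel have z: "fn.b_coord s A1 A2 = 0" "fn.b_coord s A0 A2 = 0" "fn.b_coord s A0 A1 = 0" by auto
      have "fn.b_coord s i j = 0" for i j
        using z b34 fn.b_coord_skew[of s A0 A1] fn.b_coord_skew[of s A0 A2] fn.b_coord_skew[of s A1 A2]
        by (cases i; cases j) simp_all
      then have "pairing s (cl (e' i) s) = 0" for i by (simp add: fn.quadric_e)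
      then have "pairing s (cl v s) = 0" for v by (rule fn.null_if_frame) (rule qf[OF sK])
      with not_null[OF sK] \<open>s \<noteq> 0\<close> show False by blast
    qed
    define u where "u = y / x"
    have c: "fn.c_coord s A0 = - (u * fn.b_coord s A1 A2)" "fn.c_coord s A1 = u * fn.b_coord s A0 A2"
      "fn.c_coord s A2 = - (u * fn.b_coord s A0 A1)"
    proof -
      have xu: "x * (u * b) = y * b" for b using \<open>x \<noteq> 0\<close> by (simp add: u_def)
      have "x * fn.c_coord s A0 = x * - (u * fn.b_coord s A1 A2)"
        "x * fn.c_coord s A1 = x * (u * fn.b_coord s A0 A2)"
        "x * fn.c_coord s A2 = x * - (u * fn.b_coord s A0 A1)"
        unfolding mult_minus_right xu using rel by (simp_all only: eq_neg_iff_add_eq_0 right_minus_eq)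
      with \<open>x \<noteq> 0\<close> show "fn.c_coord s A0 = - (u * fn.b_coord s A1 A2)" "fn.c_coord s A1 = u * fn.b_coord s A0 A2"
        "fn.c_coord s A2 = - (u * fn.b_coord s A0 A1)" by (simp_all only: mult_left_cancel not_False_eq_True)
    qed
    have "pairing s (cl (e' i) s) = 0" for i
      using b34 fn.b_coord_skew[of s A0 A1] fn.b_coord_skew[of s A0 A2] fn.b_coord_skew[of s A1 A2]
      by (cases i) (simp_all add: fn.quadric_e sum_five c algebra_simps)
    with \<open>s \<noteq> 0\<close> sK show ?thesis by blast
  qed
  then obtain s where s: "s \<in> K" "s \<noteq> 0" "\<And>i. pairing s (cl (e' i) s) = 0" by blast
  have "pairing s (cl v s) = 0" for v by (rule fn.null_if_frame) (rule s qf[OF s(1)])+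
  with not_null[OF s(1)] s(2) show False by blast
qed

text \<open>If the pure spinor of \<open>U\<close> is in \<open>S'\<close>, \<open>net_contains_pure\<close> applies to any hyperplane in \<open>K\<close>.
  Otherwise \<open>U\<close> is reflected in a vector \<open>v\<close> of the opposite subspace: the quadrics of the new
  subspace vanish wherever those of \<open>U\<close> and the quadric of \<open>v\<close> do. By \<open>corank_two_member\<close> there is such a \<open>v\<close>
  whose quadric has a kernel of dimension two in \<open>K\<close>. It vanishes on the span of this kernel and of one more
  isotropic vector.\<close>

lemma web_contains_pure:
  assumes U: "U \<in> OGr" and K: "S.subspace K" "S.dim K = 4"
    and UK: "\<And>s v. s \<in> K \<Longrightarrow> v \<in> U \<Longrightarrow> pairing s (cl v s) = 0"
  shows "\<exists>s\<in>K. \<exists>W. annihilates W s"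
proof -
  obtain k where k: "S.indep_fam {..<4::nat} k" "S.span (k ` {..<4}) = K"
    using S.exists_fam[OF K(1), of "{..<4::nat}"] K(2) by auto
  have kK: "k i \<in> K" if "i < 4" for i using k(2) that S.span_base[of "k i" "k ` {..<4}"] by blast
  from annihilates_dichotomy[OF U] show ?thesis
  proof
    assume "\<exists>t. dual.annihilates U t"
    then obtain t where t: "dual.annihilates U t" by blast
    have k': "inj_on k {..<4}" "S.independent (k ` {..<4})"
      using k(1) unfolding S.indep_fam_iff[OF finite_lessThan] by auto
    have "S.independent (k ` {..<3})" by (rule S.independent_mono[OF k'(2)]) auto
    moreover have "inj_on k {..<3}" by (rule inj_on_subset[OF k'(1)]) auto
    ultimately have ind: "S.indep_fam {..<3} k" unfolding S.indep_fam_iff[OF finite_lessThan] by blast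
    have sub: "S.span (k ` {..<3}) \<subseteq> K" by (rule S.span_minimal[OF _ K(1)]) (use kK in auto)
    have "S.dim (S.span (k ` {..<3})) = 3" using S.dim_span_indep_fam[OF finite_lessThan ind] by simp
    then show ?thesis using net_contains_pure[OF t S.subspace_span] UK sub by (meson subsetD)
  next
    assume "\<exists>s. annihilates U s"
    then obtain Om where Om: "annihilates U Om" by blast
    obtain e f where fr: "V.span (range e) = U" "spinor_frame sV sS sS' q cl cl' pairing e f Om"
      using frame_at[OF Om] by blast
    interpret fr: spinor_frame sV sS sS' q cl cl' pairing e f Om by (rule fr(2))
    define ix where "ix = nth [A0, A1, A2, A3, A4]"
    define A where "A i m n = pairing (k m) (cl (f (ix i)) (k n))" for i m n
    interpret web: quadric_web A by unfold_locales (simp add: A_def quadric_commute)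
    obtain l x y where l: "\<exists>i<5. l i \<noteq> 0" and x: "web.singular_at l x" and y: "web.singular_at l y"
      and ind: "\<And>r s. (\<forall>m<4. r * x m + s * y m = 0) \<Longrightarrow> r = 0 \<and> s = 0"
      using web.corank_two_member unfolding web.corank_two_member_def by blast
    define v where "v = (\<Sum>i<5. sV (l i) (f (ix i)))"
    have vG: "pairing (k m) (cl v (k n)) = web.G l m n" for m n
      unfolding v_def by (simp add: V.linear_form_sum[OF quadric_form_linear(3)] web.G_def A_def)
    define X Y where "X = (\<Sum>m<4. sS (x m) (k m))" and "Y = (\<Sum>m<4. sS (y m) (k m))"
    have vec: "pairing (\<Sum>m<4. sS (z m) (k m)) (cl v s) = 0" if z: "web.singular_at l z" and s: "s \<in> K" for z s
    proof (rule S.linear_form_zero_span[OF quadric_form_linear(2)])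
      show "s \<in> S.span (k ` {..<4})" using s k(2) by simp
      fix b assume "b \<in> k ` {..<4}"
      then obtain n where n: "n < 4" "b = k n" by auto
      show "pairing (\<Sum>m<4. sS (z m) (k m)) (cl v b) = 0"
        using z n by (simp add: S.linear_form_sum[OF quadric_form_linear(1)] vG web.singular_at_def)
    qed
    have XY: "X \<in> K" "Y \<in> K" unfolding X_def Y_def by (auto intro!: S.sum_fam_in_subspace K kK)
    have XYk: "pairing X (cl v s) = 0" "pairing Y (cl v s) = 0" if "s \<in> K" for s
      unfolding X_def Y_def by (intro vec x y that)+
    have indXY: "r = 0 \<and> t = 0" if "sS r X + sS t Y = 0" for r t
    proof (rule ind, intro allI impI)
      fix m :: nat assume m: "m < 4"
      have "(\<Sum>m<4. sS (r * x m + t * y m) (k m)) = 0"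
        using that by (simp add: X_def Y_def S.scale_sum_right S.scale_left_distrib sum.distrib)
      from S.indep_famD[OF k(1) this] m show "r * x m + t * y m = 0" by simp
    qed
    have "S.dim (insert X {Y}) \<le> S.dim {Y} + 1" "S.dim {Y} \<le> S.dim {} + 1" by (rule S.dim_insert_le)+
    then have dXY: "S.dim {X, Y} < S.dim K" using K(2) unfolding S.dim_empty by linarith
    obtain z1 where z1: "z1 \<in> K" "z1 \<notin> S.span {X, Y}" using S.exists_notin_span[OF dXY] by blast
    have "S.dim (insert z1 {X, Y}) < S.dim K"
      using S.dim_insert_le[of z1 "{X, Y}"] S.dim_insert_le[of X "{Y}"] S.dim_insert_le[of Y "{}"] K(2)
      unfolding S.dim_empty by linarith
    then obtain z2 where z2: "z2 \<in> K" "z2 \<notin> S.span (insert z1 {X, Y})" using S.exists_notin_span by blast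
    obtain c d where cd: "c \<noteq> 0 \<or> d \<noteq> 0"
      "pairing z1 (cl v z1) * c\<^sup>2 + 2 * pairing z1 (cl v z2) * (c * d) + pairing z2 (cl v z2) * d\<^sup>2 = 0"
      using quadratic_form_root by blast
    define z where "z = sS c z1 + sS d z2"
    have zK: "z \<in> K" unfolding z_def by (intro S.subspace_add S.subspace_scale K z1 z2)
    have zv: "pairing z (cl v z) = 0" unfolding z_def quadric_combination by (rule cd(2))
    have zn: "z \<notin> S.span {X, Y}"
    proof
      assume zs: "z \<in> S.span {X, Y}"
      show False
      proof (cases "d = 0")
        case True
        then have "sS (1 / c) z = z1" using cd(1) by (simp add: z_def)
        with S.span_scale[OF zs, of "1 / c"] z1(2) show False by simp
      next
        case False
        have "z \<in> S.span (insert z1 {X, Y})" using zs S.span_mono[of "{X, Y}" "insert z1 {X, Y}"] by blast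
        moreover have "sS c z1 \<in> S.span (insert z1 {X, Y})" by (intro S.span_scale S.span_base) simp
        ultimately have "z - sS c z1 \<in> S.span (insert z1 {X, Y})" by (rule S.span_diff)
        then have "sS d z2 \<in> S.span (insert z1 {X, Y})" by (simp add: z_def)
        from S.span_scale[OF this, of "1 / d"] False z2(2) show False by simp
      qed
    qed
    let ?K3 = "S.span {X, Y, z}"
    have sub: "?K3 \<subseteq> K" by (rule S.span_minimal[OF _ K(1)]) (use XY zK in auto)
    have Xn: "X \<noteq> 0" using indXY[of 1 0] by auto
    have Yn: "Y \<notin> S.span {X}"
    proof
      assume "Y \<in> S.span {X}"
      then obtain r where "Y = sS r X" by (auto simp: S.span_singleton)
      then show False using indXY[of "- r" 1] by simp
    qed
    have indep: "S.independent {Y, X}" by (rule S.independent_insertI[OF Yn]) (simp add: Xn)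
    have "S.independent {z, Y, X}" by (rule S.independent_insertI) (use zn indep in \<open>auto simp: insert_commute\<close>)
    moreover have "card {z, Y, X} = 3"
      using zn Yn by (auto simp: card_insert_if S.span_base)
    moreover have "{X, Y, z} = {z, Y, X}" by auto
    ultimately have dK3: "S.dim ?K3 = 3" using S.dim_span_eq_card_independent by simp
    have v0: "pairing s (cl v s) = 0" if "s \<in> ?K3" for s
    proof -
      have 1: "pairing a (cl v b) = 0" if "a \<in> {X, Y, z}" "b \<in> {X, Y, z}" for a b
        using that XYk[OF XY(1)] XYk[OF XY(2)] XYk[OF zK] zv
          quadric_commute[of X v z] quadric_commute[of Y v z] quadric_commute[of X v Y] by auto
      have "pairing a (cl v s) = 0" if "a \<in> {X, Y, z}" for a
        by (rule S.linear_form_zero_span[OF quadric_form_linear(2) 1[OF that] \<open>s \<in> ?K3\<close>])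
      then show ?thesis
        by (rule S.linear_form_zero_span[OF quadric_form_linear(1) _ \<open>s \<in> ?K3\<close>])
    qed
    have vspan: "v \<in> V.span (range f)"
      unfolding v_def by (intro V.sum_fam_in_subspace V.subspace_span) (auto intro: V.span_base)
    have qv: "q v = 0"
      using OGr_D(4)[OF hyperbolic_OGr[OF hyperbolic_commute[OF fr.hyperbolic_frame]] vspan] .
    obtain i where i: "i < 5" "l i \<noteq> 0" using l by blast
    have "polar (e (ix i)) v = (\<Sum>j<5. l j * polar (e (ix i)) (f (ix j)))" unfolding v_def polar_sum ..
    also have "\<dots> = (\<Sum>j<5. if i = j then l j else 0)"
    proof (rule sum.cong)
      fix j :: nat assume "j \<in> {..<5}"
      then have "ix i = ix j \<longleftrightarrow> i = j" using i(1) unfolding ix_def by (subst nth_eq_iff_index_eq) auto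
      then show "l j * polar (e (ix i)) (f (ix j)) = (if i = j then l j else 0)" by (simp add: fr.polar_e_f)
    qed simp
    also have "\<dots> = l i" using i(1) by simp
    finally have "cl' (e (ix i)) (cl v Om) = sS (l i) Om" by (simp add: cl_anticommute[of "e (ix i)"] fr.e_Om)
    then have "cl v Om \<noteq> 0" using i(2) fr.Om_nonzero by auto
    from annihilates_reflect[OF Om qv this] obtain W where W: "dual.annihilates W (cl v Om)"
      "\<And>w. w \<in> W \<Longrightarrow> \<exists>u\<in>U. \<exists>c. polar u v = 0 \<and> w = u + sV c v" by blast
    have "\<exists>s\<in>?K3. \<exists>U. annihilates U s"
    proof (rule net_contains_pure[OF W(1) S.subspace_span dK3])
      fix s w assume s: "s \<in> ?K3" and w: "w \<in> W"
      obtain u c where u: "u \<in> U" "w = u + sV c v" using W(2)[OF w] by blast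
      have "pairing s (cl u s) = 0" by (rule UK[OF subsetD[OF sub s] u(1)])
      then show "pairing s (cl w s) = 0" unfolding u(2) by (simp add: cl_linear pairing_linear v0[OF s])
    qed
    then show ?thesis using sub by blast
  qed
qed

end

section \<open>Pluecker forms\<close>

locale fin_vs_geometry = vector_space_geometry scale + fin_vs scale
  for scale :: "'a::field \<Rightarrow> 'b::ab_group_add \<Rightarrow> 'b"
begin

lemma pluecker_form_scale:
  assumes "pluecker_form k d f" shows "pluecker_form k d (\<lambda>w. c * f w)"
proof -
  have "pluecker_form k (0 + d) (\<lambda>w. c * f w)"
    by (rule pluecker_form.mult[OF pluecker_form.const assms])
  then show ?thesis by simp
qed

text \<open>Sums of forms need the zero form in every degree; it is a multiple of a power of a minor.\<close>

lemma pluecker_form_zero: "pluecker_form k d (\<lambda>_. 0)"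
proof -
  have "\<exists>f. pluecker_form k d f"
  proof (induction d)
    case 0
    show ?case using pluecker_form.const by blast
  next
    case (Suc d)
    then obtain f where "pluecker_form k d f" by blast
    moreover have "pluecker_form k 1 (\<lambda>w. det (mat k k (\<lambda>(i, j). (\<lambda>_ _. 0) i (w j))))"
      by (rule pluecker_form.minor) (simp add: linear_form_iff)
    ultimately have "\<exists>h. pluecker_form k (d + 1) h" by (blast intro: pluecker_form.mult)
    then show ?case by simp
  qed
  then show ?thesis using pluecker_form_scale[of k d _ 0] by auto
qed

lemma pluecker_form_sum:
  "finite I \<Longrightarrow> (\<And>i. i \<in> I \<Longrightarrow> pluecker_form k d (f i)) \<Longrightarrow> pluecker_form k d (\<lambda>w. \<Sum>i\<in>I. f i w)"
proof (induction I rule: finite_induct)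
  case empty
  show ?case by (simp add: pluecker_form_zero)
next
  case (insert i I)
  then have "pluecker_form k d (\<lambda>w. f i w + (\<Sum>i\<in>I. f i w))"
    by (intro pluecker_form.add) auto
  then show ?case using insert by simp
qed

lemma pluecker_form_prod:
  "finite I \<Longrightarrow> (\<And>i. i \<in> I \<Longrightarrow> pluecker_form k d (f i)) \<Longrightarrow> pluecker_form k (card I * d) (\<lambda>w. \<Prod>i\<in>I. f i w)"
proof (induction I rule: finite_induct)
  case empty
  show ?case using pluecker_form.const[of k 1] by simp
next
  case (insert i I)
  then have "pluecker_form k (d + card I * d) (\<lambda>w. f i w * (\<Prod>i\<in>I. f i w))"
    by (intro pluecker_form.mult) auto
  then show ?case using insert by simp
qed

lemma pluecker_form_det:
  assumes "\<And>i j. i < n \<Longrightarrow> j < n \<Longrightarrow> pluecker_form k d (\<lambda>w. m w i j)"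
  shows "pluecker_form k (n * d) (\<lambda>w. det (mat n n (\<lambda>(i, j). m w i j)))"
  unfolding det_leibniz
proof (intro pluecker_form_sum pluecker_form_scale finite_permutations)
  fix p assume "p \<in> {p. p permutes {0..<n}}"
  then have "pluecker_form k (card {0..<n} * d) (\<lambda>w. \<Prod>i = 0..<n. m w i (p i))"
    by (intro pluecker_form_prod assms) (auto dest: permutes_in_image)
  then show "pluecker_form k (n * d) (\<lambda>w. \<Prod>i = 0..<n. m w i (p i))" by simp
qed simp

text \<open>Up to the factor \<open>det (l i (w m))\<close>, this is the basis of the span of \<open>w\<close> dual to the linear forms
  \<open>l\<close>, by Cramer's rule. Each linear form of it is a minor, so a polynomial function of the vectors of a basis, which
  need not be a Pluecker form itself, can be tested on a subspace by a Pluecker form.\<close>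

definition cramer :: "nat \<Rightarrow> (nat \<Rightarrow> 'b \<Rightarrow> 'a) \<Rightarrow> (nat \<Rightarrow> 'b) \<Rightarrow> nat \<Rightarrow> 'b" where
  "cramer k l w j = (\<Sum>m<k. scale (cofactor (mat k k (\<lambda>(i, m). l i (w m))) j m) (w m))"

lemma form_cramer:
  assumes h: "linear_form h" and j: "j < k"
  shows "h (cramer k l w j) = det (mat k k (\<lambda>(i, m). (l(j := h)) i (w m)))"
proof -
  let ?M = "mat k k (\<lambda>(i, m). l i (w m))" and ?N = "mat k k (\<lambda>(i, m). (l(j := h)) i (w m))"
  have "mat_delete ?N j m = mat_delete ?M j m" if "m < k" for m
    using j that by (intro eq_matI) (auto simp: mat_delete_def)
  then have co: "cofactor ?N j m = cofactor ?M j m" if "m < k" for m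
    using that by (simp add: cofactor_def)
  have "det ?N = (\<Sum>m<k. ?N $$ (j, m) * cofactor ?N j m)"
    by (rule laplace_expansion_row) (use j in auto)
  also have "\<dots> = (\<Sum>m<k. cofactor ?M j m * h (w m))"
  proof (rule sum.cong)
    fix m assume "m \<in> {..<k}"
    then have m: "m < k" by simp
    show "?N $$ (j, m) * cofactor ?N j m = cofactor ?M j m * h (w m)"
      unfolding co[OF m] using j m by simp
  qed simp
  also have "\<dots> = h (cramer k l w j)"
    unfolding cramer_def by (simp add: linear_form_sum[OF h])
  finally show ?thesis by simp
qed

lemma pluecker_form_cramer:
  assumes "linear_form h" "j < k" "\<And>i. i < k \<Longrightarrow> linear_form (l i)"
  shows "pluecker_form k 1 (\<lambda>w. h (cramer k l w j))"
  unfolding form_cramer[OF assms(1,2)] by (rule pluecker_form.minor) (use assms in auto)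

lemma pluecker_form_cramer_bilinear:
  assumes b: "\<And>x. linear_form (b x)" "\<And>y. linear_form (\<lambda>x. b x y)"
    and j: "i < k" "j < k" "\<And>i. i < k \<Longrightarrow> linear_form (l i)"
  shows "pluecker_form k 2 (\<lambda>w. b (cramer k l w i) (cramer k l w j))"
proof -
  note ind = independent_Basis and sp = span_Basis
  have fin: "finite some_basis" using some_basis by blast
  have rep: "x = (\<Sum>g\<in>some_basis. scale (representation some_basis x g) g)" for x
    by (rule sum_representation_eq[symmetric, OF ind _ fin]) (simp_all add: sp)
  have lin: "linear_form (\<lambda>x. representation some_basis x g)" for g
    using ind sp by (intro linear_formI) (simp_all add: representation_add representation_scale)
  have expand: "b x y = (\<Sum>g\<in>some_basis. \<Sum>g'\<in>some_basis.
      b g g' * (representation some_basis x g * representation some_basis y g'))" for x y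
  proof -
    have "b x y = (\<Sum>g\<in>some_basis. representation some_basis x g * b g y)"
      by (subst rep[of x]) (rule linear_form_sum[OF b(2)])
    also have "\<dots> = (\<Sum>g\<in>some_basis. representation some_basis x g *
        (\<Sum>g'\<in>some_basis. representation some_basis y g' * b g g'))"
    proof -
      have "b g y = (\<Sum>g'\<in>some_basis. representation some_basis y g' * b g g')" for g
        by (subst rep[of y]) (rule linear_form_sum[OF b(1)])
      then show ?thesis by (simp only:)
    qed
    finally show ?thesis by (simp add: sum_distrib_left algebra_simps)
  qed
  have "pluecker_form k (1 + 1) (\<lambda>w. \<Sum>g\<in>some_basis. \<Sum>g'\<in>some_basis.
      b g g' * (representation some_basis (cramer k l w i) g * representation some_basis (cramer k l w j) g'))"
    by (intro pluecker_form_sum fin pluecker_form_scale pluecker_form.mult pluecker_form_cramer lin j)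
  then show ?thesis unfolding one_add_one expand[symmetric] .
qed

lemma cramer_in_subspace:
  assumes "subspace K" "\<And>m. m < k \<Longrightarrow> w m \<in> K" shows "cramer k l w j \<in> K"
  unfolding cramer_def
proof (rule sum_fam_in_subspace[OF assms(1)])
  show "w m \<in> K" if "m \<in> {..<k}" for m using assms(2) that by simp
qed

lemma cramer_of_dual_basis:
  assumes l: "\<And>i. i < k \<Longrightarrow> linear_form (l i)"
    and t: "\<And>i j. i < k \<Longrightarrow> j < k \<Longrightarrow> l i (t j) = (if i = j then 1 else 0)"
    and w: "span (w ` {..<k}) = span (t ` {..<k})"
  shows "\<exists>c. c \<noteq> 0 \<and> (\<forall>j<k. cramer k l w j = scale c (t j))"
proof -
  let ?M = "mat k k (\<lambda>(i, m). l i (w m))"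
  have "\<exists>c. t j = (\<Sum>m<k. scale (c m) (w m))" if "j < k" for j
  proof -
    have "t j \<in> span (w ` {..<k})" unfolding w using that by (intro span_base) auto
    then show ?thesis using in_span_fam_iff[of "{..<k}"] by auto
  qed
  then have "\<forall>j. \<exists>c. j < k \<longrightarrow> t j = (\<Sum>m<k. scale (c m) (w m))" by blast
  from choice[OF this] obtain C where C: "\<And>j. j < k \<Longrightarrow> t j = (\<Sum>m<k. scale (C j m) (w m))" by blast
  have "?M * mat k k (\<lambda>(m, j). C j m) = 1\<^sub>m k"
  proof (rule eq_matI)
    fix i j assume "i < dim_row (1\<^sub>m k :: 'a mat)" "j < dim_col (1\<^sub>m k :: 'a mat)"
    then have ij: "i < k" "j < k" by auto
    have "(?M * mat k k (\<lambda>(m, j). C j m)) $$ (i, j) = (\<Sum>m<k. C j m * l i (w m))"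
      using ij by (simp add: scalar_prod_def atLeast0LessThan mult.commute)
    also have "\<dots> = l i (t j)" unfolding C[OF ij(2)] by (simp only: linear_form_sum[OF l[OF ij(1)]])
    finally show "(?M * mat k k (\<lambda>(m, j). C j m)) $$ (i, j) = 1\<^sub>m k $$ (i, j)" using ij t by simp
  qed simp_all
  then have "det ?M * det (mat k k (\<lambda>(m, j). C j m)) = 1"
    using det_mult[of ?M k "mat k k (\<lambda>(m, j). C j m)"] by simp
  then have nz: "det ?M \<noteq> 0" by auto
  have wK: "w m \<in> span (t ` {..<k})" if "m < k" for m
    using that unfolding w[symmetric] by (intro span_base) auto
  have "cramer k l w j = scale (det ?M) (t j)" if j: "j < k" for j
  proof -
    have "cramer k l w j \<in> span (t ` {..<k})" by (rule cramer_in_subspace[OF subspace_span]) (rule wK)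
    then obtain c where c: "cramer k l w j = (\<Sum>m<k. scale (c m) (t m))"
      using in_span_fam_iff[of "{..<k}" _ t] by auto
    have ci: "c i = (if i = j then det ?M else 0)" if i: "i < k" for i
    proof -
      have "l i (cramer k l w j) = (\<Sum>m<k. c m * l i (t m))"
        unfolding c by (rule linear_form_sum[OF l[OF i]])
      also have "\<dots> = (\<Sum>m<k. if i = m then c m else 0)" using i by (intro sum.cong) (auto simp: t)
      also have "\<dots> = c i" using i by simp
      finally have "c i = det (mat k k (\<lambda>(i', m). (l(j := l i)) i' (w m)))"
        by (simp only: form_cramer[OF l[OF i] j])
      also have "\<dots> = (if i = j then det ?M else 0)"
      proof (cases "i = j")
        case True
        then have "l(j := l i) = l" by auto
        with True show ?thesis by simp
      next
        case False
        have "det (mat k k (\<lambda>(i', m). (l(j := l i)) i' (w m))) = 0"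
          by (rule det_identical_rows[of _ k i j]) (use False i j in \<open>auto intro!: eq_vecI\<close>)
        with False show ?thesis by simp
      qed
      finally show ?thesis .
    qed
    have "(\<Sum>m<k. scale (c m) (t m)) = (\<Sum>m<k. if m = j then scale (det ?M) (t j) else 0)"
      by (intro sum.cong) (auto simp: ci)
    with c j show ?thesis by simp
  qed
  with nz show ?thesis by blast
qed

lemma dual_forms_exist:
  fixes t :: "nat \<Rightarrow> 'b"
  assumes "indep_fam {..<k} t"
  shows "\<exists>l. (\<forall>i<k. linear_form (l i)) \<and> (\<forall>i<k. \<forall>j<k. l i (t j) = (if i = j then 1 else 0))"
proof -
  have inj: "inj_on t {..<k}" and ind: "independent (t ` {..<k})"
    using assms unfolding indep_fam_iff[OF finite_lessThan] by auto
  interpret pair: vector_space_pair scale "(*) :: 'a \<Rightarrow> 'a \<Rightarrow> 'a"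
    by (intro vector_space_pair.intro vector_space_axioms vector_space_mult)
  have "\<exists>g. linear_form g \<and> (\<forall>x\<in>t ` {..<k}. g x = (if t i = x then 1 else 0))" for i
    by (rule pair.linear_independent_extend[OF ind])
  then have "\<forall>i. \<exists>g. linear_form g \<and> (\<forall>x\<in>t ` {..<k}. g x = (if t i = x then 1 else 0))" by blast
  from choice[OF this] obtain l where l: "\<And>i. linear_form (l i)"
    "\<And>i x. x \<in> t ` {..<k} \<Longrightarrow> l i x = (if t i = x then 1 else 0)" by blast
  have "l i (t j) = (if i = j then 1 else 0)" if "i < k" "j < k" for i j
    using l(2)[of "t j" i] that inj_onD[OF inj, of i j] by auto
  with l(1) show ?thesis by blast
qed

lemma openin_zariski_nonvanishing:
  assumes "pluecker_form k d f"
  shows "openin (zariski k) {U \<in> Gr k. \<forall>w. span (w ` {..<k}) = U \<longrightarrow> f w \<noteq> 0}"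
  unfolding zariski_def 
  by (rule topology_generated_by_Basis, rule CollectI, rule exI[of _ f])
     (intro conjI refl exI[of _ d] assms)

lemma Gr_iff: "U \<in> Gr k \<longleftrightarrow> subspace U \<and> dim U = k"
  by (simp add: Gr_def)

lemma Gr_spanning_family:
  assumes "U \<in> Gr k" shows "\<exists>t. indep_fam {..<k} t \<and> span (t ` {..<k}) = U"
proof (rule exists_fam)
  show "subspace U" "dim U = card {..<k}" using assms by (simp_all add: Gr_iff)
qed simp

text \<open>For \<open>k = 1\<close> the Pluecker forms are polynomials on the vector space, here differentiated at \<open>x\<close>.\<close>

lemma pluecker_form_derivative:
  assumes "pluecker_form 1 d f"
  shows "\<exists>D. linear_form D \<and> (\<forall>t. \<exists>p. (\<forall>c. poly p c = f (\<lambda>_. x + scale c t)) \<and> coeff p 1 = D t)"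
  using assms
proof (induction rule: pluecker_form.induct)
  case (const c)
  show ?case
    by (rule exI[of _ "\<lambda>_. 0"]) (auto intro!: linear_formI exI[of _ "[:c:]"])
next
  case (minor l)
  then have l: "linear_form (l 0)" by simp
  have "det (mat 1 1 (\<lambda>(i, j). l i (x + scale c t))) = l 0 x + c * l 0 t" for c t
    by (subst det_single) (simp_all add: linear_form_add[OF l] linear_form_scale[OF l])
  then show ?case
    by (intro exI[of _ "l 0"] conjI l allI, rule_tac x = "[:l 0 x, l 0 t:]" in exI) simp
next
  case (add d f g)
  then obtain D E where D: "linear_form D" "\<And>t. \<exists>p. (\<forall>c. poly p c = f (\<lambda>_. x + scale c t)) \<and> coeff p 1 = D t"
    and E: "linear_form E" "\<And>t. \<exists>p. (\<forall>c. poly p c = g (\<lambda>_. x + scale c t)) \<and> coeff p 1 = E t" by blast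
  show ?case
  proof (intro exI[of _ "\<lambda>t. D t + E t"] conjI allI)
    show "linear_form (\<lambda>t. D t + E t)"
      by (rule linear_formI) (simp_all add: linear_form_add[OF D(1)] linear_form_add[OF E(1)]
          linear_form_scale[OF D(1)] linear_form_scale[OF E(1)] algebra_simps)
    fix t
    obtain p q where "\<And>c. poly p c = f (\<lambda>_. x + scale c t)" "coeff p 1 = D t"
      "\<And>c. poly q c = g (\<lambda>_. x + scale c t)" "coeff q 1 = E t" using D(2) E(2) by metis
    then show "\<exists>p. (\<forall>c. poly p c = f (\<lambda>_. x + scale c t) + g (\<lambda>_. x + scale c t)) \<and> coeff p 1 = D t + E t"
      by (intro exI[of _ "p + q"]) simp
  qed
next
  case (mult d f e g)
  then obtain D E where D: "linear_form D" "\<And>t. \<exists>p. (\<forall>c. poly p c = f (\<lambda>_. x + scale c t)) \<and> coeff p 1 = D t"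
    and E: "linear_form E" "\<And>t. \<exists>p. (\<forall>c. poly p c = g (\<lambda>_. x + scale c t)) \<and> coeff p 1 = E t" by blast
  show ?case
  proof (intro exI[of _ "\<lambda>t. f (\<lambda>_. x) * E t + g (\<lambda>_. x) * D t"] conjI allI)
    show "linear_form (\<lambda>t. f (\<lambda>_. x) * E t + g (\<lambda>_. x) * D t)"
      by (rule linear_formI) (simp_all add: linear_form_add[OF D(1)] linear_form_add[OF E(1)]
          linear_form_scale[OF D(1)] linear_form_scale[OF E(1)] algebra_simps)
    fix t
    obtain p q where p: "\<And>c. poly p c = f (\<lambda>_. x + scale c t)" "coeff p 1 = D t"
      and q: "\<And>c. poly q c = g (\<lambda>_. x + scale c t)" "coeff q 1 = E t" using D(2) E(2) by metis
    have "coeff p 0 = f (\<lambda>_. x)" "coeff q 0 = g (\<lambda>_. x)"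
      using p(1)[of 0] q(1)[of 0] by (simp_all add: poly_0_coeff_0)
    then have "coeff (p * q) 1 = f (\<lambda>_. x) * E t + g (\<lambda>_. x) * D t"
      using p(2) q(2) by (simp add: coeff_mult algebra_simps)
    then show "\<exists>p. (\<forall>c. poly p c = f (\<lambda>_. x + scale c t) * g (\<lambda>_. x + scale c t)) \<and>
        coeff p 1 = f (\<lambda>_. x) * E t + g (\<lambda>_. x) * D t"
      using p(1) q(1) by (intro exI[of _ "p * q"]) simp
  qed
qed

end

section \<open>The quadrics on a general 4-dimensional subspace\<close>

context half_spinors
begin

sublocale V: fin_vs_geometry sV ..
sublocale S: fin_vs_geometry sS ..
sublocale S': fin_vs_geometry sS' ..

end

context spinor_frame
begin

lemma coords_quadruple:
  "a_coord (cl' (f i) (cl (f j) (cl' (f k) (cl (f l) Om)))) = 0"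
  "b_coord (cl' (f i) (cl (f j) (cl' (f k) (cl (f l) Om)))) x y = 0"
proof -
  show "a_coord (cl' (f i) (cl (f j) (cl' (f k) (cl (f l) Om)))) = 0"
    unfolding a_coord_def pairing_adjoint f_tau by simp
  have fe: "cl' (f m) (cl (e k) y) = (if m = k then y else 0) - cl' (e k) (cl (f m) y)" for m k y
    by (simp add: cl_anticommute[of "f m"] polar_f_e)
  have 1: "cl' (f i) (cl (e x) (cl' (e y) tau)) =
      (if i = x then cl' (e y) tau else 0) - (if i = y then cl' (e x) tau else 0)" for i x y
    by (simp add: fe f_tau cl'_anticommute[of "f i"] polar_f_e)
  have 2: "cl (f j) (cl' (e y) tau) = (if j = y then tau else 0)" for j y
    by (simp add: f_tau cl'_anticommute[of "f j"] polar_f_e)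
  have 3: "pairing (cl' (f k) (cl (f l) Om)) tau = 0"
    unfolding pairing_adjoint f_tau by simp
  show "b_coord (cl' (f i) (cl (f j) (cl' (f k) (cl (f l) Om)))) x y = 0"
    unfolding b_coord_def pairing_adjoint[of "f i"] 1 cl_diff pairing_diff by (auto simp: 2 3)
qed

lemma c_coord_quadruple:
  "c_coord (ff A1 A2 (ff A3 A4 Om)) m = (if m = A0 then 1 else 0)"
  "c_coord (ff A0 A2 (ff A3 A4 Om)) m = (if m = A1 then - 1 else 0)"
  "c_coord (ff A0 A1 (ff A2 A4 Om)) m = (if m = A3 then - 1 else 0)"
  using kappa_nonzero
  by (cases m; simp add: c_coord_def frame_simps frame_pairing_simps)+

text \<open>Four sparse spinors for which the ten products each involve at most two coordinates of \<open>v\<close>, so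
  that these coordinates can be eliminated one by one.\<close>

lemma web_with_injective_quadrics:
  "\<exists>T :: nat \<Rightarrow> 's. S.indep_fam {..<4} T \<and>
    (\<forall>v. (\<forall>i<4. \<forall>j<4. pairing (T i) (cl v (T j)) = 0) \<longrightarrow> v = 0)"
proof -
  define T0 where "T0 = ff A0 A1 Om + ff A3 A4 Om"
  define T1 where "T1 = ff A2 A3 Om + sS (- 1) (ff A0 A1 (ff A2 A4 Om))"
  define T2 where "T2 = ff A0 A4 Om + ff A1 A2 (ff A3 A4 Om)
    + sS (- 1) (ff A0 A2 (ff A3 A4 Om))"
  define T3 where "T3 = ff A1 A3 Om + ff A2 A4 Om"
  note defs = T0_def T1_def T2_def T3_def
  define T where "T = nth [T0, T1, T2, T3]"
  have less4: "{..<4} = {0, 1, 2, 3::nat}" by auto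
  have a: "a_coord T0 = 0" "a_coord T1 = 0" "a_coord T2 = 0" "a_coord T3 = 0"
    by (simp_all only: defs coord_linear coords_f_f coords_quadruple) simp_all
  have c: "c_coord T0 i = 0" "c_coord T1 i = (if i = A3 then 1 else 0)"
    "c_coord T2 i = (if i = A0 \<or> i = A1 then 1 else 0)" "c_coord T3 i = 0" for i
    by (simp_all only: defs coord_linear coords_f_f c_coord_quadruple) simp_all
  have b: "b_coord T0 i j = (if i = A0 \<and> j = A1 \<or> i = A3 \<and> j = A4 then 1 else if i = A1 \<and> j = A0 \<or> i = A4
      \<and> j = A3 then - 1 else 0)"
    "b_coord T1 i j = (if i = A2 \<and> j = A3 then 1 else if i = A3 \<and> j = A2 then - 1 else 0)"
    "b_coord T2 i j = (if i = A0 \<and> j = A4 then 1 else if i = A4 \<and> j = A0 then - 1 else 0)"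
    "b_coord T3 i j = (if i = A1 \<and> j = A3 \<or> i = A2 \<and> j = A4 then 1 else if i = A3 \<and> j = A1 \<or> i = A4
        \<and> j = A2 then - 1 else 0)" for i j
    by (simp_all only: defs coord_linear coords_f_f coords_quadruple) (cases i; cases j; simp)+
  have "S.indep_fam {..<4} T"
    unfolding S.indep_fam_def
  proof (intro allI impI ballI)
    fix x i assume "(\<Sum>i<4. sS (x i) (T i)) = 0" and i: "i \<in> {..<4::nat}"
    then have z: "sS (x 0) T0 + (sS (x 1) T1 + (sS (x 2) T2 + sS (x 3) T3)) = 0"
      unfolding less4 by (simp add: T_def numeral_2_eq_2 numeral_3_eq_3)
    have b0: "b_coord 0 i j = 0" for i j by (simp add: b_coord_def)
    have bz: "x 0 * b_coord T0 i j + (x 1 * b_coord T1 i j + (x 2 * b_coord T2 i j + x 3 * b_coord T3 i j)) = 0"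
        for i j
      using arg_cong[OF z, of "\<lambda>s. b_coord s i j"] by (simp add: coord_linear b0)
    show "x i = 0"
      using bz[of A0 A1] bz[of A2 A3] bz[of A0 A4] bz[of A1 A3] i unfolding less4 by (auto simp: b)
  qed
  moreover have "v = 0" if v: "\<forall>i<4. \<forall>j<4. pairing (T i) (cl v (T j)) = 0" for v
  proof -
    define p w where "p = (\<lambda>i. polar v (e i))" and "w = (\<lambda>i. polar v (f i))"
    have ex: "v = (\<Sum>i\<in>UNIV. sV (w i) (e i)) + (\<Sum>i\<in>UNIV. sV (p i) (f i))"
      unfolding p_def w_def by (rule hyperbolic_expansion[OF hyperbolic_frame])
    have val: "pairing s (cl v s') = (\<Sum>i\<in>UNIV. w i * pairing s (cl (e i) s'))
        + (\<Sum>i\<in>UNIV. p i * pairing s (cl (f i) s'))" for s s'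
      unfolding p_def w_def by (rule quadric_expansion)
    have vT: "pairing (T i) (cl v (T j)) = 0" if "i < 4" "j < 4" for i j using v that by blast
    note q = vT[unfolded val quadric_e quadric_f sum_five]
    have T: "T 0 = T0" "T (Suc 0) = T1" "T 2 = T2" "T 3 = T3"
        by (simp_all add: T_def numeral_2_eq_2 numeral_3_eq_3)
    note rules = T a b c kappa_nonzero
    have z1: "p A2 = 0" using q[of 0 0] by (simp add: rules)
    have z2: "p A3 = 0" using q[of 0 3] by (simp add: rules)
    have z3: "w A2 = 0" using q[of 1 1] by (simp add: rules)
    have z4: "p A1 = 0" using q[of 1 2] by (simp add: rules)
    have z5: "w A1 = 0" using q[of 1 3] by (simp add: rules)
    have z6: "w A4 = 0" using q[of 2 2] by (simp add: rules)
    have z7: "p A0 = 0" using q[of 3 3] by (simp add: rules)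
    have z8: "p A4 = 0" using q[of 0 1] z6 by (simp add: rules)
    have z9: "w A0 = 0" using q[of 0 2] z5 by (simp add: rules)
    have z10: "w A3 = 0" using q[of 2 3] z1 by (simp add: rules)
    show "v = 0" by (subst ex) (simp add: sum_five z1 z2 z3 z4 z5 z6 z7 z8 z9 z10)
  qed
  ultimately show ?thesis by blast
qed

end

context half_spinors
begin

text \<open>A quadric on a 4-dimensional space is determined by its ten values on pairs of basis vectors; ten is also
  the dimension of \<open>V\<close>.\<close>

definition unordered_pairs :: "(nat \<times> nat) list" where
  "unordered_pairs = [(0, 0), (0, 1), (0, 2), (0, 3), (1, 1), (1, 2), (1, 3), (2, 2), (2, 3), (3, 3)]"

lemma unordered_pairs_less:
  assumes "p < 10" shows "fst (unordered_pairs ! p) < 4 \<and> snd (unordered_pairs ! p) < 4"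
proof -
  have "\<forall>x\<in>set unordered_pairs. fst x < 4 \<and> snd x < 4" by (simp add: unordered_pairs_def)
  moreover have "unordered_pairs ! p \<in> set unordered_pairs"
    using assms by (intro nth_mem) (simp add: unordered_pairs_def)
  ultimately show ?thesis by blast
qed

definition quadric_matrix :: "(nat \<Rightarrow> 'v) \<Rightarrow> (nat \<Rightarrow> 's) \<Rightarrow> 'k mat" where
  "quadric_matrix b r = mat 10 10 (\<lambda>(p, j).
      pairing (r (fst (unordered_pairs ! p))) (cl (b j) (r (snd (unordered_pairs ! p)))))"

lemma det_quadric_matrix_zero_iff:
  assumes b: "V.indep_fam {..<10} b" "V.span (b ` {..<10}) = UNIV"
  shows "det (quadric_matrix b r) = 0 \<longleftrightarrow>
    (\<exists>v. v \<noteq> 0 \<and> (\<forall>i<4. \<forall>j<4. pairing (r i) (cl v (r j)) = 0))"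
proof -
  have carrier: "quadric_matrix b r \<in> carrier_mat 10 10" by (simp add: quadric_matrix_def)
  have entry: "(quadric_matrix b r *\<^sub>v x) $ p = pairing (r (fst (unordered_pairs ! p)))
      (cl (\<Sum>j<10. sV (x $ j) (b j)) (r (snd (unordered_pairs ! p))))"
    if "p < 10" "x \<in> carrier_vec 10" for x p
    using that by (simp add: quadric_matrix_def scalar_prod_def V.linear_form_sum[OF quadric_form_linear(3)]
        atLeast0LessThan mult.commute)
  have pairs: "\<exists>p<10. unordered_pairs ! p = (i, j) \<or> unordered_pairs ! p = (j, i)" if "i < 4" "j < 4" for i j
  proof -
    have "\<forall>i\<in>{0, 1, 2, 3}. \<forall>j\<in>{0, 1, 2, 3}. (i, j) \<in> set unordered_pairs \<or> (j, i) \<in> set unordered_pairs"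
      by (simp add: unordered_pairs_def)
    moreover have "i \<in> {0, 1, 2, 3}" "j \<in> {0, 1, 2, 3}" using that by auto
    ultimately have "(i, j) \<in> set unordered_pairs \<or> (j, i) \<in> set unordered_pairs" by blast
    moreover have "length unordered_pairs = 10" by (simp add: unordered_pairs_def)
    ultimately show ?thesis by (auto simp: in_set_conv_nth)
  qed
  show ?thesis
    unfolding det_0_iff_vec_prod_zero_field[OF carrier]
  proof
    assume "\<exists>x. x \<in> carrier_vec 10 \<and> x \<noteq> 0\<^sub>v 10 \<and> quadric_matrix b r *\<^sub>v x = 0\<^sub>v 10"
    then obtain x where x: "x \<in> carrier_vec 10" "x \<noteq> 0\<^sub>v 10" "quadric_matrix b r *\<^sub>v x = 0\<^sub>v 10" by blast
    define v where "v = (\<Sum>j<10. sV (x $ j) (b j))"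
    have "v \<noteq> 0"
    proof
      assume "v = 0"
      then have "x $ j = 0" if "j < 10" for j
        using V.indep_famD[OF b(1), of "\<lambda>j. x $ j" j] that by (simp add: v_def)
      then have "x = 0\<^sub>v 10" using x(1) by (intro eq_vecI) auto
      with x(2) show False ..
    qed
    moreover have "pairing (r i) (cl v (r j)) = 0" if ij: "i < 4" "j < 4" for i j
    proof -
      obtain p where p: "p < 10" "unordered_pairs ! p = (i, j) \<or> unordered_pairs ! p = (j, i)"
        using pairs[OF ij] by blast
      have "(quadric_matrix b r *\<^sub>v x) $ p = 0" using x(3) p(1) by simp
      then show ?thesis
        using p(2) quadric_commute[of "r i" v "r j"] unfolding entry[OF p(1) x(1)] v_def[symmetric] by auto
    qed
    ultimately show "\<exists>v. v \<noteq> 0 \<and> (\<forall>i<4. \<forall>j<4. pairing (r i) (cl v (r j)) = 0)" by blast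
  next
    assume "\<exists>v. v \<noteq> 0 \<and> (\<forall>i<4. \<forall>j<4. pairing (r i) (cl v (r j)) = 0)"
    then obtain v where v: "v \<noteq> 0" "\<And>i j. i < 4 \<Longrightarrow> j < 4 \<Longrightarrow> pairing (r i) (cl v (r j)) = 0" by blast
    obtain c where c: "v = (\<Sum>j<10. sV (c j) (b j))"
      using V.in_span_fam_iff[of "{..<10::nat}" v b] b(2) by auto
    define x where "x = vec 10 c"
    have x: "x \<in> carrier_vec 10" "v = (\<Sum>j<10. sV (x $ j) (b j))" by (simp_all add: x_def c)
    have "x \<noteq> 0\<^sub>v 10"
    proof
      assume "x = 0\<^sub>v 10"
      then have "v = 0" unfolding x(2) by simp
      with v(1) show False ..
    qed
    moreover have "quadric_matrix b r *\<^sub>v x = 0\<^sub>v 10"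
    proof (rule eq_vecI)
      fix p assume "p < dim_vec (0\<^sub>v 10 :: 'k vec)"
      then have p: "p < 10" by simp
      show "(quadric_matrix b r *\<^sub>v x) $ p = 0\<^sub>v 10 $ p"
        unfolding entry[OF p x(1)] x(2)[symmetric] using v(2) unordered_pairs_less[OF p] p by simp
    qed (simp add: quadric_matrix_def)
    ultimately show "\<exists>x. x \<in> carrier_vec 10 \<and> x \<noteq> 0\<^sub>v 10 \<and> quadric_matrix b r *\<^sub>v x = 0\<^sub>v 10"
      using x(1) by blast
  qed
qed

text \<open>The determinant of the map from \<open>V\<close> to the quadrics on the subspace, in a basis given by Cramer's rule,
  is a Pluecker form of degree \<open>10 * 2\<close>. It is not zero at \<open>web_with_injective_quadrics\<close>. The linear forms \<open>l\<close> are
  dual to this subspace; where they are dependent on a subspace, the Cramer vectors are dependent and the determinant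
  vanishes as well.\<close>

theorem generic_quadrics_injective:
  "\<exists>G. openin (S.zariski 4) G \<and> G \<noteq> {} \<and> (\<forall>K\<in>G. K \<in> S.Gr 4 \<and>
     (\<forall>v. (\<forall>s\<in>K. \<forall>s'\<in>K. pairing s (cl v s') = 0) \<longrightarrow> v = 0))"
proof -
  obtain e f Om where fr: "spinor_frame sV sS sS' q cl cl' pairing e f Om" using frame_exists by blast
  obtain T :: "nat \<Rightarrow> 's" where T: "S.indep_fam {..<4} T"
    and Tinj: "\<And>v. (\<forall>i<4. \<forall>j<4. pairing (T i) (cl v (T j)) = 0) \<Longrightarrow> v = 0"
    using spinor_frame.web_with_injective_quadrics[OF fr] by blast
  obtain l where l: "\<And>i. i < 4 \<Longrightarrow> S.linear_form (l i)"
    and lT: "\<And>i j. i < 4 \<Longrightarrow> j < 4 \<Longrightarrow> l i (T j) = (if i = j then 1 else 0)"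
    using S.dual_forms_exist[OF T] by blast
  have "\<exists>b. V.indep_fam {..<10::nat} b \<and> V.span (b ` {..<10}) = UNIV"
    by (rule V.exists_fam) simp_all
  then obtain b where b: "V.indep_fam {..<10::nat} b" "V.span (b ` {..<10}) = UNIV" by blast
  define F where "F w = det (quadric_matrix b (S.cramer 4 l w))" for w
  define G where "G = {U \<in> S.Gr 4. \<forall>w. S.span (w ` {..<4}) = U \<longrightarrow> F w \<noteq> 0}"
  have "S.pluecker_form 4 (10 * 2) F"
    unfolding F_def quadric_matrix_def
  proof (rule S.pluecker_form_det)
    fix p j :: nat assume "p < 10" "j < 10"
    then have "fst (unordered_pairs ! p) < 4" "snd (unordered_pairs ! p) < 4"
      using unordered_pairs_less by blast+
    then show "S.pluecker_form 4 2 (\<lambda>w. pairing (S.cramer 4 l w (fst (unordered_pairs ! p)))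
        (cl (b j) (S.cramer 4 l w (snd (unordered_pairs ! p)))))"
      by (rule S.pluecker_form_cramer_bilinear[OF quadric_form_linear(2) quadric_form_linear(1) _ _ l])
  qed
  then have "openin (S.zariski 4) G" unfolding G_def by (rule S.openin_zariski_nonvanishing)
  moreover have "S.span (T ` {..<4}) \<in> G"
    unfolding G_def
  proof (intro CollectI conjI allI impI)
    show "S.span (T ` {..<4}) \<in> S.Gr 4"
      using S.dim_span_indep_fam[OF finite_lessThan T] by (simp add: S.Gr_iff)
    fix w :: "nat \<Rightarrow> 's" assume w: "S.span (w ` {..<4}) = S.span (T ` {..<4})"
    obtain c where c: "c \<noteq> 0" "\<And>j. j < 4 \<Longrightarrow> S.cramer 4 l w j = sS c (T j)"
      using S.cramer_of_dual_basis[OF l lT w] by blast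
    show "F w \<noteq> 0"
    proof
      assume "F w = 0"
      then obtain v where v: "v \<noteq> 0"
        "\<And>i j. i < 4 \<Longrightarrow> j < 4 \<Longrightarrow> pairing (S.cramer 4 l w i) (cl v (S.cramer 4 l w j)) = 0"
        unfolding F_def det_quadric_matrix_zero_iff[OF b] by blast
      have "pairing (T i) (cl v (T j)) = 0" if "i < 4" "j < 4" for i j
        using v(2)[OF that] c(1) by (simp add: c(2) that cl_linear pairing_linear)
      with Tinj v(1) show False by blast
    qed
  qed
  moreover have "v = 0" if K: "K \<in> G" and v: "\<forall>s\<in>K. \<forall>s'\<in>K. pairing s (cl v s') = 0" for K v
  proof (rule ccontr)
    assume "v \<noteq> 0"
    have Gr: "K \<in> S.Gr 4" using K by (simp add: G_def)
    obtain w :: "nat \<Rightarrow> 's" where w: "S.span (w ` {..<4}) = K" using S.Gr_spanning_family[OF Gr] by blast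
    have "S.cramer 4 l w i \<in> K" for i
      by (rule S.cramer_in_subspace) (use Gr w in \<open>auto simp: S.Gr_iff intro: S.span_base\<close>)
    then have "F w = 0" unfolding F_def det_quadric_matrix_zero_iff[OF b] using v \<open>v \<noteq> 0\<close> by blast
    with K w show False by (simp add: G_def)
  qed
  moreover have "K \<in> S.Gr 4" if "K \<in> G" for K using that by (simp add: G_def)
  ultimately show ?thesis by blast
qed

section \<open>Subspaces with isotropic quadric vectors\<close>

text \<open>The map \<open>Q\<close> with \<open>polar v (Q s) = pairing s (cl v s)\<close>, in terms of a hyperbolic basis.\<close>

definition quadric_vector :: "(five \<Rightarrow> 'v) \<Rightarrow> (five \<Rightarrow> 'v) \<Rightarrow> 's \<Rightarrow> 'v" where
  "quadric_vector e f s = (\<Sum>i\<in>UNIV. sV (pairing s (cl (f i) s)) (e i))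
      + (\<Sum>i\<in>UNIV. sV (pairing s (cl (e i) s)) (f i))"

lemma polar_quadric_vector:
  assumes h: "hyperbolic e f" shows "polar v (quadric_vector e f s) = pairing s (cl v s)"
proof -
  have "polar v (quadric_vector e f s) = (\<Sum>i\<in>UNIV. pairing s (cl (f i) s) * polar v (e i))
      + (\<Sum>i\<in>UNIV. pairing s (cl (e i) s) * polar v (f i))"
    unfolding quadric_vector_def polar_linear polar_sum ..
  also have "\<dots> = pairing s (cl ((\<Sum>i\<in>UNIV. sV (polar v (f i)) (e i)) + (\<Sum>i\<in>UNIV. sV (polar v (e i)) (f i))) s)"
    by (simp add: V.linear_form_add[OF quadric_form_linear(3)] V.linear_form_sum[OF quadric_form_linear(3)]
        mult.commute)
  also have "\<dots> = pairing s (cl v s)" by (simp only: hyperbolic_expansion[OF h, symmetric])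
  finally show ?thesis .
qed

lemma polar_quadric_vectors:
  assumes h: "hyperbolic e f"
  shows "polar (quadric_vector e f s) (quadric_vector e f s') =
    (\<Sum>i\<in>UNIV. pairing s (cl (f i) s) * pairing s' (cl (e i) s')) + (\<Sum>i\<in>UNIV. pairing s (cl (e i) s) * pairing s'
        (cl (f i) s'))"
  unfolding polar_quadric_vector[OF h]
  by (simp add: quadric_vector_def V.linear_form_add[OF quadric_form_linear(3)] V.linear_form_sum[OF
      quadric_form_linear(3)])

lemma quadric_vector_scale: "quadric_vector e f (sS c s) = sV (c\<^sup>2) (quadric_vector e f s)"
  by (simp add: quadric_vector_def cl_linear pairing_linear power2_eq_square V.scale_right_distrib
      V.scale_sum_right mult.assoc)

text \<open>The orthogonality of \<open>Q\<close> at two basis vectors is expressed by a Pluecker form of degree 4 on the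
  Cramer vectors, which are multiples of the given \<open>t\<close> on the span of \<open>t\<close> and elements of \<open>U\<close> on every
  \<open>U\<close>.\<close>

lemma closure_isotropic:
  fixes t :: "nat \<Rightarrow> 's"
  assumes h: "hyperbolic e f"
    and C: "\<And>U s s'. U \<in> C \<Longrightarrow> s \<in> U \<Longrightarrow> s' \<in> U \<Longrightarrow> polar (quadric_vector e f s) (quadric_vector e f s') = 0"
    and t: "S.indep_fam {..<2} t" "S.span (t ` {..<2}) \<in> S.zariski 2 closure_of C"
  shows "polar (quadric_vector e f (t 0)) (quadric_vector e f (t 1)) = 0"
proof (rule ccontr)
  assume nz: "polar (quadric_vector e f (t 0)) (quadric_vector e f (t 1)) \<noteq> 0"
  obtain l where l: "\<And>i. i < 2 \<Longrightarrow> S.linear_form (l i)"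
    and lt: "\<And>i j. i < 2 \<Longrightarrow> j < 2 \<Longrightarrow> l i (t j) = (if i = j then 1 else 0)"
    using S.dual_forms_exist[OF t(1)] by blast
  define F where "F w = polar (quadric_vector e f (S.cramer 2 l w 0)) (quadric_vector e f (S.cramer 2 l w 1))"
      for w
  have bil: "S.pluecker_form 2 2 (\<lambda>w. pairing (S.cramer 2 l w i) (cl v (S.cramer 2 l w i)))" if "i < 2" for v i
    by (rule S.pluecker_form_cramer_bilinear[OF quadric_form_linear(2) quadric_form_linear(1) that that l])
  have "S.pluecker_form 2 (2 + 2) F"
    unfolding F_def polar_quadric_vectors[OF h]
    by (intro S.pluecker_form.add S.pluecker_form_sum S.pluecker_form.mult bil) simp_all
  from S.openin_zariski_nonvanishing[OF this]
  have op: "openin (S.zariski 2) {U \<in> S.Gr 2. \<forall>w. S.span (w ` {..<2}) = U \<longrightarrow> F w \<noteq> 0}" (is "openin _ ?O") .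
  have mem: "S.span (t ` {..<2}) \<in> {U \<in> S.Gr 2. \<forall>w. S.span (w ` {..<2}) = U \<longrightarrow> F w \<noteq> 0}"
  proof (intro CollectI conjI allI impI)
    show "S.span (t ` {..<2}) \<in> S.Gr 2"
      using S.dim_span_indep_fam[OF finite_lessThan t(1)] by (simp add: S.Gr_iff)
    fix w :: "nat \<Rightarrow> 's" assume w: "S.span (w ` {..<2}) = S.span (t ` {..<2})"
    obtain c where c: "c \<noteq> 0" "\<And>j. j < 2 \<Longrightarrow> S.cramer 2 l w j = sS c (t j)"
      using S.cramer_of_dual_basis[OF l lt w] by blast
    show "F w \<noteq> 0" using nz c(1) by (simp add: F_def c(2) quadric_vector_scale polar_linear)
  qed
  have nbhd: "\<forall>N. S.span (t ` {..<2}) \<in> N \<and> openin (S.zariski 2) N \<longrightarrow> (\<exists>U. U \<in> C \<and> U \<in> N)"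
    using t(2) unfolding in_closure_of by (rule conjunct2)
  have "\<exists>U. U \<in> C \<and> U \<in> ?O" by (rule nbhd[rule_format, OF conjI, OF mem op])
  then obtain U where U: "U \<in> C" "U \<in> S.Gr 2" "\<forall>w. S.span (w ` {..<2}) = U \<longrightarrow> F w \<noteq> 0"
    by (elim exE conjE CollectE) (rule that)
  obtain w :: "nat \<Rightarrow> 's" where w: "S.span (w ` {..<2}) = U" using S.Gr_spanning_family[OF U(2)] by blast
  have "S.cramer 2 l w i \<in> U" for i
    by (rule S.cramer_in_subspace) (use U(2) w in \<open>auto simp: S.Gr_iff intro: S.span_base\<close>)
  then have "F w = 0" unfolding F_def by (intro C[OF U(1)])
  with U(3) w show False by blast
qed

end

section \<open>Tangent spaces of the spinor tenfold and singular sections\<close>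

context spinor_frame
begin

lemma annihilates_unipotent_orbit:
  assumes "k \<noteq> 0"
  shows "\<exists>U. annihilates U (sS k Om + sS c (cl' (f i) (cl (f j) Om)))"
proof (rule annihilates_if_a_coord)
  show "a_coord (sS k Om + sS c (cl' (f i) (cl (f j) Om))) \<noteq> 0"
    using assms by (simp add: coord_linear coords_Om coords_f_f)
  fix m
  have "pairing (cl' (f i) (cl (f j) Om)) (cl (f m) (cl' (f i) (cl (f j) Om))) = 0"
    unfolding pairing_adjoint f_f_commute(2)[of m i] by (simp add: cl'_minus cl_minus f_square)
  then show "pairing (sS k Om + sS c (cl' (f i) (cl (f j) Om))) (cl (f m) (sS k Om
      + sS c (cl' (f i) (cl (f j) Om)))) = 0"
    unfolding quadric_combination by (simp add: pairing_Om_small)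
qed

text \<open>The tangent space of the cone over \<open>X\<close> at the vacuum, of dimension 11, consists of the spinors of
  degree 0 and 2.\<close>

definition tangent_basis :: "nat \<Rightarrow> 's" where
  "tangent_basis = nth [Om, ff A0 A1 Om, ff A0 A2 Om, ff A0 A3 Om,
     ff A0 A4 Om, ff A1 A2 Om, ff A1 A3 Om, ff A1 A4 Om,
     ff A2 A3 Om, ff A2 A4 Om, ff A3 A4 Om]"

lemma less_11: "{..<11} = {0, 1, 2, 3, 4, 5, 6, 7, 8, 9, 10::nat}"
  by (rule Set.set_eqI) (simp only: lessThan_iff insert_iff empty_iff, presburger)

lemma tangent_basis_cases:
  assumes "n < 11" shows "tangent_basis n = Om \<or> (\<exists>i j. tangent_basis n = cl' (f i) (cl (f j) Om))"
proof -
  have "n \<in> {..<11}" using assms by simp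
  then show ?thesis unfolding less_11 tangent_basis_def by (elim insertE emptyE) (simp_all, blast+)
qed

lemma tangent_basis_indep: "S.indep_fam {..<11} tangent_basis"
  unfolding S.indep_fam_def
proof (intro allI impI ballI)
  fix x i assume z: "(\<Sum>i<11. sS (x i) (tangent_basis i)) = 0" and i: "i \<in> {..<11::nat}"
  have la: "S.linear_form a_coord" "S.linear_form (\<lambda>s. b_coord s i j)" for i j
    by (auto intro!: S.linear_formI simp: coord_linear)
  have a: "(\<Sum>i<11. x i * a_coord (tangent_basis i)) = 0"
    using arg_cong[OF z, of a_coord] by (simp only: S.linear_form_sum[OF la(1)] S.linear_form_0[OF la(1)])
  have b: "(\<Sum>n<11. x n * b_coord (tangent_basis n) i j) = 0" for i j
    using arg_cong[OF z, of "\<lambda>s. b_coord s i j"]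
        by (simp only: S.linear_form_sum[OF la(2)] S.linear_form_0[OF la(2)])
  note rules = tangent_basis_def less_11 coords_Om coords_f_f eval_nat_numeral
  have "x 0 = 0" using a by (simp add: rules)
  moreover have "x 1 = 0" using b[of A0 A1] by (simp add: rules)
  moreover have "x 2 = 0" using b[of A0 A2] by (simp add: rules)
  moreover have "x 3 = 0" using b[of A0 A3] by (simp add: rules)
  moreover have "x 4 = 0" using b[of A0 A4] by (simp add: rules)
  moreover have "x 5 = 0" using b[of A1 A2] by (simp add: rules)
  moreover have "x 6 = 0" using b[of A1 A3] by (simp add: rules)
  moreover have "x 7 = 0" using b[of A1 A4] by (simp add: rules)
  moreover have "x 8 = 0" using b[of A2 A3] by (simp add: rules)
  moreover have "x 9 = 0" using b[of A2 A4] by (simp add: rules)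
  moreover have "x 10 = 0" using b[of A3 A4] by (simp add: rules)
  ultimately show "x i = 0" using i unfolding less_11 by (elim insertE emptyE) simp_all
qed

text \<open>The lines through \<open>k Om\<close> in the direction of a basis vector lie in the cone over \<open>X\<close>, so a polynomial which
  vanishes on \<open>X\<close> vanishes on them, and its linear coefficient is additive in the direction.\<close>

lemma tangent_basis_cone_tangent:
  "S.span (tangent_basis ` {..<11}) \<subseteq> S.cone_tangent X (S.span {Om})"
proof
  fix t assume t: "t \<in> S.span (tangent_basis ` {..<11})"
  have "\<exists>p. (\<forall>c. poly p c = F (\<lambda>_. x + sS c t)) \<and> coeff p 1 = 0"
    if F: "S.pluecker_form 1 d F" and van: "\<forall>y. S.span {y} \<in> X \<longrightarrow> F (\<lambda>_. y) = 0" and x: "S.span {x} = S.span {Om}"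
    for F d x
  proof -
    obtain D where D: "S.linear_form D"
      "\<And>t. \<exists>p. (\<forall>c. poly p c = F (\<lambda>_. x + sS c t)) \<and> coeff p 1 = D t"
      using S.pluecker_form_derivative[OF F] by blast
    have "x \<in> S.span {Om}" unfolding x[symmetric] by (rule S.span_base) simp
    then obtain k where k: "x = sS k Om" by (auto simp: S.span_singleton)
    have "k \<noteq> 0"
    proof
      assume "k = 0"
      then have "S.span {Om} \<subseteq> {0}" using x k by simp
      then show False using Om_nonzero S.span_base[of Om "{Om}"] by blast
    qed
    have inX: "F (\<lambda>_. y) = 0" if "\<exists>U. annihilates U y" for y
      using van that X_iff by blast
    have gen: "D (tangent_basis n) = 0" if n: "n < 11" for n
    proof -
      obtain p where p: "\<And>c. poly p c = F (\<lambda>_. x + sS c (tangent_basis n))" "coeff p 1 = D (tangent_basis n)"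
        using D(2) by metis
      have "p = 0"
        using tangent_basis_cases[OF n]
      proof (elim disjE exE)
        assume Om: "tangent_basis n = Om"
        \<comment> \<open>In the direction of \<open>Om\<close> the line passes through the origin for \<open>c = - k\<close>; the extra factor takes
          care of this point.\<close>
        have "poly (p * [:k, 1:]) c = 0" for c
        proof (cases "k + c = 0")
          case True
          have "poly (p * [:k, 1:]) c = poly p c * (k + c)" by (simp add: algebra_simps)
          with True show ?thesis by simp
        next
          case False
          have "x + sS c Om = sS (k + c) Om + sS 0 (ff A0 A1 Om)"
            by (simp add: k S.scale_left_distrib)
          then have "F (\<lambda>_. x + sS c Om) = 0" using annihilates_unipotent_orbit[OF False] inX by metis
          then show ?thesis by (simp add: p(1) Om)
        qed
        then have "p * [:k, 1:] = 0" using poly_all_0_iff_0 by blast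
        then show "p = 0" unfolding mult_eq_0_iff by simp
      next
        fix i j assume "tangent_basis n = cl' (f i) (cl (f j) Om)"
        then have "poly p c = 0" for c
          using annihilates_unipotent_orbit[OF \<open>k \<noteq> 0\<close>, of c i j] inX by (simp add: p(1) k)
        then show "p = 0" using poly_all_0_iff_0 by blast
      qed
      with p(2) show ?thesis by simp
    qed
    have "D t = 0" by (rule S.linear_form_zero_span[OF D(1) _ t]) (use gen in auto)
    with D(2)[of t] show ?thesis by simp
  qed
  then show "t \<in> S.cone_tangent X (S.span {Om})" unfolding S.cone_tangent_def by blast
qed

text \<open>The hyperplanes \<open>cl u Om\<close> contain the tangent space at \<open>Om\<close>.\<close>

lemma tangent_basis_pairing:
  assumes "t \<in> S.span (tangent_basis ` {..<11})" shows "pairing t (cl u Om) = 0"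
proof (rule S.linear_form_zero_span[OF _ _ assms])
  show "S.linear_form (\<lambda>t. pairing t (cl u Om))" by (auto intro!: S.linear_formI simp: pairing_linear)
  have m: "pairing (cl' (f i) (cl (f j) Om)) (cl u Om) = 0" for i j
  proof -
    have "pairing (cl' (f i) (cl (f j) Om)) (cl (f k) Om) = 0" for k
      unfolding pairing_adjoint by (rule pairing_Om_small)
    then show ?thesis unfolding quadric_expansion[of _ u] by (simp add: e_Om)
  qed
  fix y assume "y \<in> tangent_basis ` {..<11}"
  then show "pairing y (cl u Om) = 0" using tangent_basis_cases m quadric_Om by fastforce
qed

end

context half_spinors
begin

interpretation dual: half_spinors sV sS' sS q cl' cl "\<lambda>t s. pairing s t"
  by (rule dual_half_spinors)

text \<open>A point \<open>s = v t0\<close> of \<open>X\<close> satisfies \<open>t0 = u s\<close> for a suitable \<open>u\<close>, so the hyperplane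
  \<open>t0\<close> is tangent to \<open>X\<close> at \<open>s\<close>. As \<open>v\<close> varies in the isotropic subspace opposite to \<open>t0\<close>, which has
  dimension 5, it can be chosen such that \<open>s\<close> satisfies the four equations of \<open>K\<close>. Then only three of the
  equations cut down the tangent space of dimension 11.\<close>

lemma singular_section:
  assumes K: "K \<in> S'.Gr 4" and t0: "t0 \<in> K" "dual.annihilates W t0"
  shows "\<exists>L\<in>X_sec K. 8 \<le> S.dim (S.cone_tangent X L \<inter> annihilator K)"
proof -
  obtain k :: "nat \<Rightarrow> 't" where k: "S'.indep_fam {..<4} k" "S'.span (k ` {..<4}) = K"
    using S'.Gr_spanning_family[OF K] by blast
  obtain e f where fr: "V.span (range e) = W" "spinor_frame sV sS' sS q cl' cl (\<lambda>t s. pairing s t) e f t0"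
    using dual.frame_at[OF t0(2)] by blast
  interpret D: spinor_frame sV sS' sS q cl' cl "\<lambda>t s. pairing s t" e f t0 by (rule fr(2))
  have F: "V.span (range f) \<in> OGr" by (rule hyperbolic_OGr[OF hyperbolic_commute[OF D.hyperbolic_frame]])
  have lin: "V.linear_form (\<lambda>v. pairing (cl' v t) t')" for t t'
    by (auto intro!: V.linear_formI simp: cl'_linear pairing_linear)
  have "\<exists>v\<in>V.span (range f). v \<noteq> 0 \<and> (\<forall>j\<in>{..<4}. pairing (cl' v t0) (k j) = 0)"
    by (rule V.exists_common_zero[OF V.subspace_span finite_lessThan lin]) (use OGr_D(2)[OF F] in simp)
  then obtain v where v: "v \<in> V.span (range f)" "v \<noteq> 0" "\<And>j. j < 4 \<Longrightarrow> pairing (cl' v t0) (k j) = 0" by blast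
  have qv: "q v = 0" by (rule OGr_D(4)[OF F v(1)])
  obtain c where c: "v = (\<Sum>i\<in>UNIV. sV (c i) (f i))" using v(1) V.in_span_fam_iff[of UNIV v f] by auto
  have "\<exists>i. c i \<noteq> 0"
  proof (rule ccontr)
    assume "\<not> ?thesis"
    then have "v = 0" unfolding c by simp
    with v(2) show False ..
  qed
  then obtain i where i: "c i \<noteq> 0" by blast
  have pol: "polar (e i) v = c i"
    unfolding c by (subst polar_commute) (rule hyperbolic_polar_sum(3)[OF D.hyperbolic_frame])
  define s where "s = cl' v t0"
  have t0_eq: "cl (sV (1 / c i) (e i)) s = t0"
    using i by (simp add: s_def cl_linear cl'_anticommute[of "e i"] pol D.e_Om)
  have "s \<noteq> 0"
  proof
    assume "s = 0"
    then have "t0 = 0" using t0_eq by simp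
    with D.Om_nonzero show False ..
  qed
  then obtain W' where W': "annihilates W' s"
    using dual.annihilates_reflect[OF t0(2) qv] unfolding s_def by blast
  obtain e' f' where "spinor_frame sV sS sS' q cl cl' pairing e' f' s" using frame_at[OF W'] by blast
  then interpret fr: spinor_frame sV sS sS' q cl cl' pairing e' f' s .
  let ?T = "S.span (fr.tangent_basis ` {..<11})"
  have Kk: "pairing x t = 0" if "\<And>j. j < 4 \<Longrightarrow> pairing x (k j) = 0" "t \<in> K" for x t
  proof (rule S'.linear_form_zero_span)
    show "S'.linear_form (\<lambda>t. pairing x t)" by (auto intro!: S'.linear_formI simp: pairing_linear)
    show "t \<in> S'.span (k ` {..<4})" using that k(2) by simp
  qed (use that in auto)
  have "S.span {s} \<in> X_sec K"
  proof -
    have "S.span {s} \<in> X" using W' X_iff by blast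
    moreover have "pairing x t = 0" if "x \<in> S.span {s}" "t \<in> K" for x t
      using that Kk[of s t] v(3) by (auto simp: S.span_singleton s_def pairing_linear)
    ultimately show ?thesis by (auto simp: X_sec_def annihilator_def)
  qed
  moreover have "8 \<le> S.dim (S.cone_tangent X (S.span {s}) \<inter> annihilator K)"
  proof -
    obtain d where d: "t0 = (\<Sum>j<4. sS' (d j) (k j))"
      using t0(1) S'.in_span_fam_iff[of "{..<4::nat}" t0 k] k(2) by auto
    have "\<exists>p<4. d p \<noteq> 0"
    proof (rule ccontr)
      assume "\<not> ?thesis"
      then have "t0 = 0" unfolding d by simp
      with D.Om_nonzero show False ..
    qed
    then obtain p where p: "p < 4" "d p \<noteq> 0" by blast
    let ?J = "{..<4} - {p}"
    let ?T' = "?T \<inter> {x. \<forall>j\<in>?J. pairing x (k j) = 0}"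
    have linS: "S.linear_form (\<lambda>x. pairing x t)" for t by (auto intro!: S.linear_formI simp: pairing_linear)
    have "S.dim ?T \<le> S.dim ?T' + card ?J" by (rule S.dim_common_kernel_ge(1)[OF S.subspace_span _ linS]) simp
    moreover have "S.dim ?T = 11" using S.dim_span_indep_fam[OF finite_lessThan fr.tangent_basis_indep] by simp
    moreover have "card ?J = 3" using p(1) by simp
    ultimately have "8 \<le> S.dim ?T'" by linarith
    also have "?T' \<subseteq> S.cone_tangent X (S.span {s}) \<inter> annihilator K"
    proof
      fix x assume x: "x \<in> ?T'"
      have lint: "S'.linear_form (\<lambda>t. pairing x t)" by (auto intro!: S'.linear_formI simp: pairing_linear)
      have "pairing x t0 = 0" using fr.tangent_basis_pairing[of x] x t0_eq by blast
      then have "(\<Sum>j<4. d j * pairing x (k j)) = 0" unfolding d S'.linear_form_sum[OF lint] .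
      moreover have "(\<Sum>j<4. d j * pairing x (k j)) = d p * pairing x (k p)"
        using p(1) x by (subst sum.remove[of _ p]) auto
      ultimately have "pairing x (k p) = 0" using p(2) by simp
      then have "pairing x (k j) = 0" if "j < 4" for j using x that by (cases "j = p") auto
      then have "x \<in> annihilator K" using Kk[of x] by (auto simp: annihilator_def)
      then show "x \<in> S.cone_tangent X (S.span {s}) \<inter> annihilator K"
        using x fr.tangent_basis_cone_tangent by blast
    qed
    then have "S.dim ?T' \<le> S.dim (S.cone_tangent X (S.span {s}) \<inter> annihilator K)" by (rule S.dim_subset)
    finally show ?thesis .
  qed
  ultimately show ?thesis by blast
qed

text \<open>A tangent cone of dimension at least 8 at a smooth point forces local dimension at least 7, but the
  section has dimension 6.\<close>

lemma smooth_section_no_pure_equation: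
  assumes K: "K \<in> S'.Gr 4" and sm: "smooth_sec K" and tr: "dim_transverse K" and t0: "t0 \<in> K"
  shows "\<not> dual.annihilates W t0"
proof
  assume "dual.annihilates W t0"
  from singular_section[OF K t0 this] obtain L where L: "L \<in> X_sec K"
    "8 \<le> S.dim (S.cone_tangent X L \<inter> annihilator K)" by blast
  let ?T = "subtopology (S.zariski 1) (X_sec K)"
  obtain n where n: "has_local_dim ?T L n" "S.dim (S.cone_tangent X L \<inter> annihilator K) = n + 1"
    using sm L(1) unfolding smooth_sec_def by blast
  obtain Z where "closed_chain ?T n Z" using n(1) unfolding has_local_dim_def by blast
  then have "closed_chain ?T (Suc 6) Z" using n(2) L(2) unfolding closed_chain_def by auto
  moreover have "10 - S'.dim K = 6" using K by (simp add: S'.Gr_iff)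
  then have "\<not> (\<exists>Z. closed_chain ?T (Suc 6) Z)" using tr unfolding dim_transverse_def has_krull_dim_def by simp
  ultimately show False by blast
qed

section \<open>Sections containing linear 4-spaces\<close>

text \<open>If \<open>V t0\<close> is orthogonal to \<open>t\<close>, then \<open>t\<close> has coordinates \<open>c = 0\<close> in a frame at
  \<open>t0\<close>, and the quadrics of the isotropic subspace of \<open>t0\<close> contain \<open>c\<close> in every term.\<close>

lemma linear_four_space_quadrics:
  assumes "F4 K \<noteq> {}"
  shows "\<exists>W\<in>OGr. \<forall>u\<in>W. \<forall>t\<in>K. pairing (cl' u t) t = 0"
proof -
  obtain M where M: "M \<in> S.Gr 5" "S.Gr_in 1 M \<subseteq> X_sec K" using assms by (auto simp: F4_def)
  have sec: "S.span {s} \<in> X_sec K" if s: "s \<in> M" "s \<noteq> 0" for s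
  proof -
    have "S.span {s} \<subseteq> M" using s(1) M(1) by (intro S.span_minimal) (auto simp: S.Gr_iff)
    moreover have "S.dim (S.span {s}) = 1" using s(2) by simp
    ultimately have "S.span {s} \<in> S.Gr_in 1 M" by (simp add: S.Gr_in_def S.Gr_iff)
    with M(2) show ?thesis by blast
  qed
  have pure: "\<exists>U. annihilates U s" if s: "s \<in> M" "s \<noteq> 0" for s
  proof -
    have "S.span {s} \<in> X" using sec[OF s] by (simp add: X_sec_def)
    then obtain U s' where U: "annihilates U s'" "S.span {s} = S.span {s'}" using X_iff by blast
    have "s \<in> S.span {s'}" unfolding U(2)[symmetric] by (rule S.span_base) simp
    then obtain c where "s = sS c s'" by (auto simp: S.span_singleton)
    then have "annihilates U s" using U(1) s(2) by (auto simp: annihilates_def cl_linear)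
    then show ?thesis by blast
  qed
  have "S.subspace M" "S.dim M = 5" using M(1) by (simp_all add: S.Gr_iff)
  from linear_family_in_X[OF this pure] obtain W t0 where t0: "dual.annihilates W t0" "\<And>v. cl' v t0 \<in> M" by blast
  have perp: "pairing (cl' v t0) t = 0" if t: "t \<in> K" for v t
  proof (cases "cl' v t0 = 0")
    case False
    from sec[OF t0(2) this] have "S.span {cl' v t0} \<subseteq> annihilator K" by (simp add: X_sec_def)
    moreover have "cl' v t0 \<in> S.span {cl' v t0}" by (rule S.span_base) simp
    ultimately show ?thesis using t by (auto simp: annihilator_def)
  qed simp
  have "pairing (cl' u t) t = 0" if "u \<in> W" "t \<in> K" for u t
    by (rule dual.quadric_vanishes_on_annihilator[OF t0(1) perp[OF that(2)] that(1)])
  moreover have "W \<in> OGr" using t0(1) by (simp add: dual.annihilates_def)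
  ultimately show ?thesis by blast
qed

text \<open>If the line complex contains all of \<open>Gr(2, K)\<close>, the vectors \<open>Q t\<close> with \<open>t\<close> in \<open>K\<close> are mutually
  orthogonal, hence in a maximal isotropic subspace whose quadrics vanish on \<open>K\<close>.\<close>

lemma line_complex_proper:
  assumes K: "K \<in> S'.Gr 4" and sm: "smooth_sec K" and tr: "dim_transverse K"
  shows "line_complex_of K \<noteq> S'.Gr_in 2 K"
proof
  assume all: "line_complex_of K = S'.Gr_in 2 K"
  obtain e f Om where "spinor_frame sV sS sS' q cl cl' pairing e f Om" using frame_exists by blast
  then interpret fr: spinor_frame sV sS sS' q cl cl' pairing e f Om .
  note h = fr.hyperbolic_frame
  let ?q = "dual.quadric_vector e f"
  let ?C = "{K \<in> S'.Gr 2. S'.Gr_in 1 K \<inter> X_dual = {} \<and> special K}"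
  have sK: "S'.subspace K" using K by (simp add: S'.Gr_iff)
  have C: "polar (?q t) (?q t') = 0" if U: "U \<in> ?C" and t: "t \<in> U" "t' \<in> U" for U t t'
  proof -
    have "F4 U \<noteq> {}" using U by (simp add: special_def)
    then obtain W where W: "W \<in> OGr" "\<And>u t. u \<in> W \<Longrightarrow> t \<in> U \<Longrightarrow> pairing (cl' u t) t = 0"
      using linear_four_space_quadrics by blast
    have "?q t \<in> W" if "t \<in> U" for t
      by (rule OGr_maximal[OF W(1)]) (simp add: dual.polar_quadric_vector[OF h] W(2) that)
    then show ?thesis using OGr_D(3)[OF W(1)] t by blast
  qed
  have indep: "polar (?q (t 0)) (?q (t 1)) = 0"
    if t: "S'.indep_fam {..<2} t" "\<And>i. i < 2 \<Longrightarrow> t i \<in> K" for t :: "nat \<Rightarrow> 't"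
  proof (rule dual.closure_isotropic[OF h C t(1)])
    have "S'.span (t ` {..<2}) \<in> S'.Gr_in 2 K"
      using S'.dim_span_indep_fam[OF finite_lessThan t(1)] S'.span_minimal[OF _ sK, of "t ` {..<2}"] t(2)
      by (auto simp: S'.Gr_in_def S'.Gr_iff)
    then show "S'.span (t ` {..<2}) \<in> S'.zariski 2 closure_of ?C"
      using all by (auto simp: line_complex_of_def line_complex_def)
  qed
  have iso2: "polar (?q t) (?q t') = 0"
    if t: "t \<in> K" "t' \<in> K" and ind: "\<And>r s. sS' r t + sS' s t' = 0 \<Longrightarrow> r = 0 \<and> s = 0" for t t'
  proof -
    define g where "g i = (if i = 0 then t else t')" for i :: nat
    have two: "{..<2} = {0, 1::nat}" by auto
    have "S'.indep_fam {..<2} g"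
      unfolding S'.indep_fam_def two using ind by (auto simp: g_def)
    then have "polar (?q (g 0)) (?q (g 1)) = 0" by (rule indep) (use t in \<open>auto simp: g_def\<close>)
    then show ?thesis by (simp add: g_def)
  qed
  \<comment> \<open>The closure condition concerns two independent vectors. The case of equal vectors follows from
    \<open>polar (Q t) (Q (t + y x)) = 0\<close> for \<open>y = 1\<close> and \<open>y = - 1\<close>.\<close>
  have iso1: "polar (?q t) (?q t) = 0" if t: "t \<in> K" "t \<noteq> 0" for t
  proof -
    have "S'.dim {t} < S'.dim K"
      using S'.dim_insert_le[of t "{}"] K unfolding S'.dim_empty by (simp add: S'.Gr_iff)
    from S'.exists_notin_span[OF this] obtain x where x: "x \<in> K" "x \<notin> S'.span {t}" by blast
    note ind = S'.independent_pairI[OF t(2) x(2)]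
    have val: "polar (?q t) (?q (sS' 1 t + sS' y x)) = 0" if y: "y \<noteq> 0" for y
    proof (rule iso2[OF t(1)])
      show "sS' 1 t + sS' y x \<in> K" by (intro S'.subspace_add S'.subspace_scale sK t(1) x(1))
      fix r s assume "sS' r t + sS' s (sS' 1 t + sS' y x) = 0"
      then have "sS' (r + s) t + sS' (s * y) x = 0"
        by (simp add: S'.scale_right_distrib S'.scale_left_distrib add.assoc)
      from ind[OF this] y show "r = 0 \<and> s = 0" by auto
    qed
    have "polar (?q t) (?q x) = 0" by (rule iso2[OF t(1) x(1) ind])
    then have "polar (?q t) (?q t) + 2 * pairing (cl' (?q t) x) t * y = 0" if "y \<noteq> 0" for y
      using val[OF that] unfolding dual.polar_quadric_vector[OF h] dual.quadric_combination by simp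
    from this[of 1] this[of "- 1"] have "2 * polar (?q t) (?q t) = 0" by simp
    then show ?thesis by simp
  qed
  have iso: "polar (?q t) (?q t') = 0" if t: "t \<in> K" "t' \<in> K" for t t'
  proof (cases "t = 0 \<or> t' \<in> S'.span {t}")
    case True
    then consider "t = 0" | c where "t \<noteq> 0" "t' = sS' c t" by (auto simp: S'.span_singleton)
    then show ?thesis
    proof cases
      case 1
      then show ?thesis by (simp add: dual.quadric_vector_def)
    next
      case 2
      then show ?thesis using iso1[OF t(1)] by (simp add: dual.quadric_vector_scale polar_linear)
    qed
  next
    case False
    then show ?thesis
      by (intro iso2[OF t S'.independent_pairI[of t t']]) auto
  qed
  let ?I = "V.span (?q ` K)"
  have "polar x y = 0" if "x \<in> ?I" "y \<in> ?I" for x y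
    by (rule polar_span[OF _ that]) (use iso in auto)
  then obtain U where U: "U \<in> OGr" "?I \<subseteq> U" using isotropic_extend[OF V.subspace_span, of "?q ` K"] by blast
  have "pairing (cl' u t) t = 0" if "t \<in> K" "u \<in> U" for t u
  proof -
    have "?q t \<in> U" using U(2) that(1) V.span_base[of "?q t" "?q ` K"] by blast
    from OGr_D(3)[OF U(1) that(2) this] show ?thesis unfolding dual.polar_quadric_vector[OF h] .
  qed
  then have "\<exists>t\<in>K. \<exists>W. dual.annihilates W t"
    by (intro dual.web_contains_pure[OF U(1) sK]) (use K in \<open>auto simp: S'.Gr_iff\<close>)
  with smooth_section_no_pure_equation[OF K sm tr] show False by blast
qed

text \<open>A quadric vanishing on the hyperplane \<open>K3\<close> of \<open>K\<close> vanishes on \<open>K\<close> if its polar form with one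
  vector \<open>x\<close> outside of \<open>K3\<close> vanishes on a basis of \<open>K\<close>. These are four conditions on a space of quadrics of
  dimension 5.\<close>

lemma generic_no_very_special:
  "\<exists>G. openin (S'.zariski 4) G \<and> G \<noteq> {} \<and> (\<forall>K\<in>G. \<not> (\<exists>K3\<subseteq>K. very_special K3))"
proof -
  obtain G where G: "openin (S'.zariski 4) G" "G \<noteq> {}" "\<And>K. K \<in> G \<Longrightarrow> K \<in> S'.Gr 4"
    and inj: "\<And>K v. K \<in> G \<Longrightarrow> (\<forall>t\<in>K. \<forall>t'\<in>K. pairing (cl' v t') t = 0) \<Longrightarrow> v = 0"
    using dual.generic_quadrics_injective by metis
  have "\<not> very_special K3" if K: "K \<in> G" and sub: "K3 \<subseteq> K" for K K3
  proof
    assume vs: "very_special K3"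
    have K3: "S'.subspace K3" "S'.dim K3 = 3" using vs by (simp_all add: very_special_def S'.Gr_iff)
    have K4: "S'.subspace K" "S'.dim K = 4" using G(3)[OF K] by (simp_all add: S'.Gr_iff)
    have "F4 K3 \<noteq> {}" using vs by (simp add: very_special_def)
    then obtain W where W: "W \<in> OGr" "\<And>u t. u \<in> W \<Longrightarrow> t \<in> K3 \<Longrightarrow> pairing (cl' u t) t = 0"
      using linear_four_space_quadrics by blast
    have "S'.dim K3 < S'.dim K" using K3 K4 by simp
    then obtain x where x: "x \<in> K" "x \<notin> S'.span K3" using S'.exists_notin_span by blast
    have spK: "S'.span (insert x K3) = K"
    proof (rule S'.subspace_dim_equal[OF S'.subspace_span K4(1)])
      show "S'.span (insert x K3) \<subseteq> K" using sub x(1) by (intro S'.span_minimal K4) auto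
      show "S'.dim K \<le> S'.dim (S'.span (insert x K3))" using x(2) K3 K4 by (simp add: S'.dim_insert)
    qed
    obtain k :: "nat \<Rightarrow> 't" where k: "S'.indep_fam {..<4} k" "S'.span (k ` {..<4}) = K"
      using S'.Gr_spanning_family[OF G(3)[OF K]] by blast
    have lin: "V.linear_form (\<lambda>v. pairing (cl' v t') t)" for t t'
      by (auto intro!: V.linear_formI simp: cl'_linear pairing_linear)
    have "\<exists>u\<in>W. u \<noteq> 0 \<and> (\<forall>j\<in>{..<4}. pairing (cl' u x) (k j) = 0)"
      by (rule V.exists_common_zero[OF OGr_D(1)[OF W(1)] finite_lessThan lin]) (use OGr_D(2)[OF W(1)] in simp)
    then obtain u where u: "u \<in> W" "u \<noteq> 0" "\<And>j. j < 4 \<Longrightarrow> pairing (cl' u x) (k j) = 0" by blast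
    have ux: "pairing (cl' u x) t = 0" if "t \<in> K" for t
    proof (rule S'.linear_form_zero_span[OF dual.quadric_form_linear(1)])
      show "t \<in> S'.span (k ` {..<4})" using that k(2) by simp
    qed (use u(3) in auto)
    have uK: "pairing (cl' u t') t = 0" if t: "t \<in> K" "t' \<in> K" for t t'
    proof -
      have gen: "pairing (cl' u b) a = 0" if ab: "a \<in> insert x K3" "b \<in> insert x K3" for a b
      proof -
        have abK: "a \<in> K" "b \<in> K" using ab sub x(1) by auto
        show ?thesis
        proof (cases "a = x \<or> b = x")
          case True
          then show ?thesis using ux[OF abK(1)] ux[OF abK(2)] dual.quadric_commute[where s = a and v = u and s' =
              b] by auto
        next
          case False
          then have ab3: "a \<in> K3" "b \<in> K3" using ab by auto
          show ?thesis by (rule dual.quadric_polarize[OF K3(1) _ ab3]) (rule W(2)[OF u(1)])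
        qed
      qed
      have "pairing (cl' u t') a = 0" if a: "a \<in> insert x K3" for a
        by (rule S'.linear_form_zero_span[OF dual.quadric_form_linear(2) gen[OF a], of "insert x K3"])
           (use spK t(2) in simp_all)
      then show ?thesis
        by (rule S'.linear_form_zero_span[OF dual.quadric_form_linear(1), of "insert x K3"])
           (use spK t(1) in simp_all)
    qed
    have "u = 0" by (rule inj[OF K]) (use uK in blast)
    with u(2) show False ..
  qed
  with G(1,2) show ?thesis by blast
qed

end

theorem lemma7p15:
  fixes sV :: "'k::{alg_closed_field, field_char_0} \<Rightarrow> 'v::ab_group_add \<Rightarrow> 'v"
    and sS :: "'k \<Rightarrow> 's::ab_group_add \<Rightarrow> 's"
    and sS' :: "'k \<Rightarrow> 't::ab_group_add \<Rightarrow> 't"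
    and q :: "'v \<Rightarrow> 'k"
    and cl :: "'v \<Rightarrow> 's \<Rightarrow> 't"
    and cl' :: "'v \<Rightarrow> 't \<Rightarrow> 's"
    and pairing :: "'s \<Rightarrow> 't \<Rightarrow> 'k"
  assumes "half_spinors sV sS sS' q cl cl' pairing"
  shows "(\<forall>K \<in> vector_space_geometry.Gr sS' 4.
            half_spinors.smooth_sec sV sS q cl pairing K \<and>
            half_spinors.dim_transverse sV sS sS' q cl pairing K \<longrightarrow>
            half_spinors.line_complex_of sV sS sS' q cl cl' pairing K \<noteq>
              vector_space_geometry.Gr_in sS' 2 K)
       \<and> (\<exists>G. openin (vector_space_geometry.zariski sS' 4) G \<and> G \<noteq> {} \<and>
            (\<forall>K \<in> G. \<not> (\<exists>K3 \<subseteq> K. half_spinors.very_special sV sS sS' q cl pairing K3)))"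
proof -
  interpret half_spinors sV sS sS' q cl cl' pairing by (rule assms)
  show ?thesis
    by (rule conjI[OF _ generic_no_very_special]) (intro ballI impI, elim conjE, rule line_complex_proper)
qed

end
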